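(* Let $A:\mathbb{T}^2\to\mathbb{T}^2$ be a linear map, induced by an invertible (nonzero determinant) $2\times2$ integer matrix, with integer eigenvalues and at least one eigenvalue greater than $1$. Then there exists a partially hyperbolic surface endomorphism $f:\mathbb{T}^2\to\mathbb{T}^2$ which is homotopic to $A$ and is dynamically incoherent.
   Context: $\mathbb{T}^2=\mathbb{R}^2/\mathbb{Z}^2$. Cone families: on a surface $M$, a cone family $\mathcal{C}$ is a choice at each $p\in M$ of a closed cone $\mathcal{C}(p)=\{v\in T_pM: Q_p(v)\ge 0\}$, where $Q_p$ is a nondegenerate indefinite quadratic form on $T_pM$ depending continuously on $p$. It is $Df$-invariant if $D_pf(\mathcal{C}(p))$ is contained in the interior of $\mathcal{C}(f(p))$ (apart from the zero vector) for all $p\in M$. A map $f:M\to M$ is a (weakly) partially hyperbolic endomorphism if it is a ($C^1$) local diffeomorphism and there is a $Df$-invariant cone family $\mathcal{C}^u$ and $k>0$ such that $\|Df^k v^u\|>1$ for all unit vectors $v^u\in\mathcal{C}^u$. Such an $f$ has a centre direction $E^c$: the continuous $Df$-invariant line field in $TM$ with $E^c(p)\cap \mathcal{C}^u(p)=\{0\}$ for all $p$. A partially hyperbolic endomorphism $f$ of $\mathbb{T}^2$ is dynamically coherent if there exists an $f$-invariant foliation of $\mathbb{T}^2$ tangent to $E^c$; otherwise it is dynamically incoherent. *)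

theory Defs
  imports "HOL-Analysis.Analysis" "HOL-Library.Disjoint_Sets"
begin

section \<open>The torus\<close>

definition lattice_rel :: "real^2 \<Rightarrow> real^2 \<Rightarrow> bool" where
  "lattice_rel x y \<longleftrightarrow> (\<forall>i. x $ i - y $ i \<in> \<int>)"

lemma equivp_lattice_rel: "equivp lattice_rel"
proof (rule equivpI)
  show "reflp lattice_rel"
    by (simp add: reflp_def lattice_rel_def)
  show "symp lattice_rel"
    unfolding symp_def lattice_rel_def by (metis Ints_minus minus_diff_eq)
  show "transp lattice_rel"
  proof (rule transpI)
    fix x y z assume "lattice_rel x y" "lattice_rel y z"
    then have "(x $ i - y $ i) + (y $ i - z $ i) \<in> \<int>" for i
      unfolding lattice_rel_def by (intro Ints_add) auto
    then show "lattice_rel x z" by (simp add: lattice_rel_def)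
  qed
qed

quotient_type torus = "real^2" / lattice_rel
  by (rule equivp_lattice_rel)

abbreviation proj :: "real^2 \<Rightarrow> torus" where
  "proj \<equiv> abs_torus"

lemma proj_eq_iff: "proj x = proj y \<longleftrightarrow> lattice_rel x y"
  by (rule torus.abs_eq_iff)

instantiation torus :: topological_space
begin

definition open_torus :: "torus set \<Rightarrow> bool" where
  "open_torus U \<longleftrightarrow> open (proj -` U)"

instance
  by standard (auto simp: open_torus_def vimage_Union)

end

lift_definition linear_torus_map :: "int^2^2 \<Rightarrow> torus \<Rightarrow> torus"
  is "\<lambda>A x. map_matrix real_of_int A *v x"
proof -
  fix A :: "int^2^2" and x y :: "real^2"
  assume "lattice_rel x y"
  then have "real_of_int (A $ i $ j) * (x $ j - y $ j) \<in> \<int>" for i j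
    unfolding lattice_rel_def by (intro Ints_mult) auto
  then have "(\<Sum>j\<in>UNIV. real_of_int (A $ i $ j) * (x $ j - y $ j)) \<in> \<int>" for i
    by (intro Ints_sum) auto
  then show "lattice_rel (map_matrix real_of_int A *v x) (map_matrix real_of_int A *v y)"
    unfolding lattice_rel_def
    by (simp add: matrix_vector_mult_def right_diff_distrib sum_subtractf)
qed

definition is_eigenvalue :: "('a::field)^'n^'n \<Rightarrow> 'a \<Rightarrow> bool" where
  "is_eigenvalue M l \<longleftrightarrow> (\<exists>v. v \<noteq> 0 \<and> M *v v = l *s v)"


section \<open>Differential calculus on the torus\<close>

text \<open>The smooth structure is the one for which the projection is a local diffeomorphism. Every
  tangent space is identified with \<open>real^2\<close> through the derivative of the projection; the
  identification is independent of the representative since the lattice acts by translations.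
  The Euclidean norm on \<open>real^2\<close> thus gives the flat metric on the torus.
  A differentiable \<open>f\<close> is expressed near \<open>proj x\<close> by a map \<open>G\<close> of the plane that lifts it near \<open>x\<close>.\<close>

definition has_torus_derivative ::
    "(torus \<Rightarrow> torus) \<Rightarrow> (real^2 \<Rightarrow> real^2) \<Rightarrow> torus \<Rightarrow> bool" where
  "has_torus_derivative f D p \<longleftrightarrow>
     (\<exists>x G. proj x = p \<and> (\<forall>\<^sub>F y in nhds x. f (proj y) = proj (G y)) \<and> (G has_derivative D) (at x))"

definition torus_deriv :: "(torus \<Rightarrow> torus) \<Rightarrow> torus \<Rightarrow> real^2 \<Rightarrow> real^2" where
  "torus_deriv f p = (THE D. has_torus_derivative f D p)"

lemma has_torus_derivative_unique:
  assumes "has_torus_derivative f D p" "has_torus_derivative f E p"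
  shows "D = E"
proof -
  obtain x G where G: "proj x = p" "\<forall>\<^sub>F y in nhds x. f (proj y) = proj (G y)"
      "(G has_derivative D) (at x)"
    using assms(1) by (auto simp: has_torus_derivative_def)
  obtain x' G' where G': "proj x' = p" "\<forall>\<^sub>F y in nhds x'. f (proj y) = proj (G' y)"
      "(G' has_derivative E) (at x')"
    using assms(2) by (auto simp: has_torus_derivative_def)
  define z where "z = x' - x"
  have z: "proj (y + z) = proj y" for y
    using G(1) G'(1) by (auto simp: proj_eq_iff z_def lattice_rel_def)
  define H where "H = (\<lambda>y. G' (y + z) - G y)"
  have "((\<lambda>y. G' (y + z)) has_derivative E) (at x)"
  proof -
    have "((\<lambda>y. y + z) has_derivative (\<lambda>h. h)) (at x)"
      by (auto intro!: derivative_eq_intros)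
    moreover have "(G' has_derivative E) (at (x + z))" using G'(3) by (simp add: z_def)
    ultimately show ?thesis using has_derivative_compose by blast
  qed
  then have H: "(H has_derivative (\<lambda>h. E h - D h)) (at x)"
    unfolding H_def using G(3) by (rule has_derivative_diff)
  have "isCont (\<lambda>y. y + z) x" by (intro continuous_intros)
  then have "filterlim (\<lambda>y. y + z) (nhds x') (nhds x)"
    using tendsto_at_iff_tendsto_nhds[of "\<lambda>y. y + z" x] by (simp add: isCont_def z_def)
  then have "\<forall>\<^sub>F y in nhds x. f (proj (y + z)) = proj (G' (y + z))"
    using G'(2) by (auto simp: filterlim_iff)
  with G(2) have ev: "\<forall>\<^sub>F y in nhds x. lattice_rel (G' (y + z)) (G y)"
    by eventually_elim (simp add: z flip: proj_eq_iff)
  then have at_x: "lattice_rel (G' (x + z)) (G x)"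
    by (rule eventually_nhds_x_imp_x)
  have "isCont H x" using H by (rule has_derivative_continuous)
  then have "(H \<longlongrightarrow> H x) (nhds x)"
    by (simp add: isCont_def tendsto_at_iff_tendsto_nhds)
  then have "\<forall>\<^sub>F y in nhds x. dist (H y) (H x) < 1"
    by (rule tendstoD) simp
  with ev have "\<forall>\<^sub>F y in nhds x. H y = H x"
  proof eventually_elim
    case (elim y)
    have "H y $ i = H x $ i" for i
    proof -
      have "(G' (y + z) $ i - G y $ i) - (G' (x + z) $ i - G x $ i) \<in> \<int>"
        using elim(1) at_x unfolding lattice_rel_def by (metis Ints_diff)
      then have "H y $ i - H x $ i \<in> \<int>" by (simp add: H_def)
      moreover have "\<bar>H y $ i - H x $ i\<bar> < 1"
        using dist_vec_nth_le[of "H y" i "H x"] elim(2) by (simp add: dist_real_def)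
      ultimately show ?thesis using Ints_nonzero_abs_less1 by fastforce
    qed
    then show ?case by (simp add: vec_eq_iff)
  qed
  then have "((\<lambda>y. H x) has_derivative (\<lambda>h. E h - D h)) (at x)"
    using H by (elim has_derivative_transform_eventually)
      (auto simp: eventually_at_filter elim: eventually_mono)
  then have "(\<lambda>h. E h - D h) = (\<lambda>h. 0)"
    by (rule has_derivative_unique[OF _ has_derivative_const])
  then show ?thesis by (auto simp: fun_eq_iff)
qed

lemma torus_deriv_eq: "has_torus_derivative f D p \<Longrightarrow> torus_deriv f p = D"
  unfolding torus_deriv_def using has_torus_derivative_unique by blast

lemma torus_deriv_linear_torus_map:
  "torus_deriv (linear_torus_map A) p = (*v) (map_matrix real_of_int A)"
proof (rule torus_deriv_eq)
  obtain x where x: "p = proj x" by (metis Quotient_abs_rep Quotient_torus)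
  have "((*v) (map_matrix real_of_int A) has_derivative (*v) (map_matrix real_of_int A)) (at x)"
    by (intro bounded_linear_imp_has_derivative matrix_vector_mul_bounded_linear)
  then show "has_torus_derivative (linear_torus_map A) ((*v) (map_matrix real_of_int A)) p"
    unfolding has_torus_derivative_def x
    by (intro exI[of _ x] exI[of _ "(*v) (map_matrix real_of_int A)"])
      (simp add: linear_torus_map.abs_eq)
qed

definition torus_C1_on :: "torus set \<Rightarrow> (torus \<Rightarrow> torus) \<Rightarrow> bool" where
  "torus_C1_on U f \<longleftrightarrow>
     (\<exists>D :: torus \<Rightarrow> ((real^2) \<Rightarrow>\<^sub>L (real^2)).
        continuous_on U D \<and> (\<forall>p\<in>U. has_torus_derivative f (blinfun_apply (D p)) p))"

definition C1_local_diffeo :: "(torus \<Rightarrow> torus) \<Rightarrow> bool" where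
  "C1_local_diffeo f \<longleftrightarrow>
     (\<forall>p. \<exists>U V g. open U \<and> p \<in> U \<and> open V \<and> homeomorphism U V f g \<and>
            torus_C1_on U f \<and> torus_C1_on V g)"


section \<open>Partially hyperbolic endomorphisms\<close>

text \<open>A quadratic form on a tangent space is given by its symmetric Gram matrix.\<close>

definition quad_form :: "real^2^2 \<Rightarrow> real^2 \<Rightarrow> real" where
  "quad_form S v = v \<bullet> (S *v v)"

definition nondegenerate_indefinite :: "real^2^2 \<Rightarrow> bool" where
  "nondegenerate_indefinite S \<longleftrightarrow>
     transpose S = S \<and> invertible S \<and> (\<exists>v. quad_form S v > 0) \<and> (\<exists>v. quad_form S v < 0)"

definition cone_family :: "(torus \<Rightarrow> (real^2) set) \<Rightarrow> bool" where
  "cone_family C \<longleftrightarrow>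
     (\<exists>Q :: torus \<Rightarrow> real^2^2. continuous_on UNIV Q \<and>
        (\<forall>p. nondegenerate_indefinite (Q p) \<and> C p = {v. quad_form (Q p) v \<ge> 0}))"

definition cone_invariant :: "(torus \<Rightarrow> torus) \<Rightarrow> (torus \<Rightarrow> (real^2) set) \<Rightarrow> bool" where
  "cone_invariant f C \<longleftrightarrow> (\<forall>p. torus_deriv f p ` C p - {0} \<subseteq> interior (C (f p)))"

definition unstable_cone_family :: "(torus \<Rightarrow> torus) \<Rightarrow> (torus \<Rightarrow> (real^2) set) \<Rightarrow> bool" where
  "unstable_cone_family f C \<longleftrightarrow>
     cone_family C \<and> cone_invariant f C \<and>
     (\<exists>k>0. \<forall>p. \<forall>v\<in>C p. norm v = 1 \<longrightarrow> norm (torus_deriv (f ^^ k) p v) > 1)"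

definition partially_hyperbolic :: "(torus \<Rightarrow> torus) \<Rightarrow> bool" where
  "partially_hyperbolic f \<longleftrightarrow> C1_local_diffeo f \<and> (\<exists>C. unstable_cone_family f C)"

definition continuous_line_field :: "(torus \<Rightarrow> (real^2) set) \<Rightarrow> bool" where
  "continuous_line_field E \<longleftrightarrow>
     (\<forall>p. \<exists>U X. open U \<and> p \<in> U \<and> continuous_on U X \<and> (\<forall>q\<in>U. X q \<noteq> 0 \<and> E q = span {X q}))"

definition centre_direction :: "(torus \<Rightarrow> torus) \<Rightarrow> (torus \<Rightarrow> (real^2) set) \<Rightarrow> bool" where
  "centre_direction f E \<longleftrightarrow>
     continuous_line_field E \<and> (\<forall>p. torus_deriv f p ` E p = E (f p)) \<and>
     (\<exists>C. unstable_cone_family f C \<and> (\<forall>p. E p \<inter> C p = {0}))"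


section \<open>Foliations and dynamical coherence\<close>

text \<open>One-dimensional topological foliations, given by their set of leaves. The components of a
  leaf in a chart are taken in the subspace topology; a leaf meets a chart in at most countably
  many plaques, so these components are exactly its plaques. Path-connectedness (rather than
  connectedness) prevents a union of several dense leaves from counting as one leaf.\<close>

definition foliation :: "torus set set \<Rightarrow> bool" where
  "foliation F \<longleftrightarrow>
     partition_on UNIV F \<and> (\<forall>L\<in>F. path_connected L) \<and>
     (\<forall>p. \<exists>U \<phi> \<psi>. open U \<and> p \<in> U \<and>
        homeomorphism U ({0<..<1::real} \<times> {0<..<1::real}) \<phi> \<psi> \<and>
        (\<forall>L\<in>F. \<forall>K \<in> components (L \<inter> U). \<exists>c\<in>{0<..<1}. K = \<psi> ` ({0<..<1} \<times> {c})))"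

text \<open>Tangency: through each point, the leaf contains a regular \<open>C\<^sup>1\<close> curve with velocity
  in \<open>E\<close>. Curves in the torus are written as projections of curves in the plane.\<close>

definition tangent_to :: "torus set set \<Rightarrow> (torus \<Rightarrow> (real^2) set) \<Rightarrow> bool" where
  "tangent_to F E \<longleftrightarrow>
     (\<forall>L\<in>F. \<forall>p\<in>L. \<exists>\<epsilon>>0. \<exists>\<gamma> \<gamma>'. proj (\<gamma> 0) = p \<and> continuous_on {-\<epsilon><..<\<epsilon>} \<gamma>' \<and>
        (\<forall>t\<in>{-\<epsilon><..<\<epsilon>}. (\<gamma> has_vector_derivative \<gamma>' t) (at t) \<and> \<gamma>' t \<noteq> 0 \<and>
           proj (\<gamma> t) \<in> L \<and> \<gamma>' t \<in> E (proj (\<gamma> t))))"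

definition invariant_foliation :: "(torus \<Rightarrow> torus) \<Rightarrow> torus set set \<Rightarrow> bool" where
  "invariant_foliation f F \<longleftrightarrow> foliation F \<and> (\<forall>L\<in>F. f ` L \<in> F)"

definition dynamically_coherent :: "(torus \<Rightarrow> torus) \<Rightarrow> bool" where
  "dynamically_coherent f \<longleftrightarrow>
     (\<exists>E F. centre_direction f E \<and> invariant_foliation f F \<and> tangent_to F E)"

abbreviation dynamically_incoherent :: "(torus \<Rightarrow> torus) \<Rightarrow> bool" where
  "dynamically_incoherent f \<equiv> \<not> dynamically_coherent f"

end

theory Submission
  imports Defs
begin

text \<open>
  An eigenvector \<open>v\<close> of \<open>A\<close> for the eigenvalue \<open>lam > 1\<close> can be taken primitive and completed to an
  integral basis \<open>v, w\<close> of determinant \<open>1\<close>, so that \<open>A v = lam v\<close> and \<open>A w = c v + mu w\<close>. In the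
  coordinates \<open>(x, y)\<close> of this basis the example is a skew product
  \<open>F (x, y) = (lam x + \<Phi> y, g y)\<close>, where \<open>g\<close> is a monotone circle map of degree \<open>mu\<close> and \<open>\<Phi>\<close> grows by
  \<open>c\<close> over each period; it changes under lattice translations exactly as \<open>A\<close> does, which makes it
  homotopic to \<open>A\<close>.

  The derivative preserves the horizontal direction, and the point is to let this direction change its
  role. On the circle \<open>y = 0\<close> the map \<open>g\<close> expands by \<open>lam\<^sup>2\<close>, more than the factor \<open>lam\<close> in the horizontal
  direction, so the centre is horizontal there. Further away \<open>g\<close> contracts, the horizontal direction is
  dominating and the centre is transverse to it. Near the circle, where \<open>F (x, y) = (lam x + const,
  lam\<^sup>2 y)\<close> up to the sign of the second coordinate, a centre slope proportional to the square root of \<open>y\<close>, odd in \<open>y\<close>, is invariant. Its integral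
  curves \<open>x = const + (2/\<kappa>) sqrt \<bar>y\<bar>\<close> leave the circle towards the right on both sides: the centre
  branches.

  There are two parts. The first shows that such a branching makes the map incoherent. In a
  tangent foliation, the integral curves above the circle belong to the leaves of their end points on
  the circle, because plaques are closed in charts (lemma \<open>leaf_contains_path_endpoint\<close>). The leaf
  through a point of the circle contains a differentiable curve tangent to the centre, and to its left
  this curve cannot leave the circle (lemma \<open>flow_curve_stays_left\<close>). So a single leaf contains an arc
  of the circle together with all the integral curves above it, hence an open set, which is absurd
  (lemma \<open>no_foliation_tangent_to_branching\<close>). This argument needs explicit knowledge of the line
  field. That every centre direction has the expected slopes
  follows from a domination estimate: a centre vector grows at most like the square root of the Jacobian
  (lemma \<open>centre_vectors_dominated\<close>), whereas the form annihilating the expected slope grows faster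
  (lemma \<open>centre_in_invariant_slopes\<close>).

  The second part constructs \<open>g\<close>, \<open>\<Phi>\<close> and a slope field \<open>\<tau>\<close> for which the cones
  \<open>\<rho> \<bar>x\<bar> \<le> \<bar>\<tau> x - y\<bar>\<close> are invariant and expanded. On a zone around the circle \<open>y = 0\<close> the slopes are
  exactly invariant and the estimate reduces to one inequality between \<open>lam g'\<close> and the growth of the form
  \<open>\<tau> x - y\<close> (lemmas \<open>exact_slopes_step\<close> and \<open>exact_zone\<close>). On the short remaining arc \<open>g\<close> has a very large
  slope \<open>M\<close>, so that any cone around the vertical is mapped into a much narrower one (lemma
  \<open>steep_step\<close>). There \<open>\<tau>\<close> returns to zero, \<open>g\<close> picks up its degree and \<open>\<Phi>\<close> its period increment \<open>c\<close>.
\<close>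


section \<open>The projection onto the torus\<close>

lemma lattice_rel_refl [simp]: "lattice_rel x x"
  by (simp add: lattice_rel_def)

lemma proj_rep_torus [simp]: "proj (rep_torus p) = p"
  by (metis Quotient_abs_rep Quotient_torus)

lemma continuous_on_proj [continuous_intros]:
  "continuous_on S f \<Longrightarrow> continuous_on S (\<lambda>x. proj (f x))"
proof -
  have "continuous_on UNIV proj"
    by (simp add: continuous_on_open_vimage open_torus_def)
  then show "continuous_on S f \<Longrightarrow> continuous_on S (\<lambda>x. proj (f x))"
    by (metis continuous_on_compose2 subset_UNIV)
qed

lemma open_proj_image:
  assumes "open V"
  shows "open (proj ` V)"
proof -
  have "proj -` proj ` V = (\<Union>k\<in>{k. \<forall>i. k $ i \<in> \<int>}. (+) k ` V)" (is "?L = ?R")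
  proof
    show "?L \<subseteq> ?R"
    proof
      fix z assume "z \<in> ?L"
      then obtain y where "y \<in> V" "lattice_rel z y" by (auto simp: proj_eq_iff)
      then have "z = (z - y) + y" "\<forall>i. (z - y) $ i \<in> \<int>" "y \<in> V"
        by (auto simp: lattice_rel_def)
      then show "z \<in> ?R" by (intro UN_I[of "z - y"] image_eqI[of _ _ y]) auto
    qed
    show "?R \<subseteq> ?L"
    proof
      fix z assume "z \<in> ?R"
      then obtain k y where k: "\<forall>i. k $ i \<in> \<int>" "y \<in> V" "z = k + y" by auto
      then have "lattice_rel z y" by (simp add: lattice_rel_def)
      then have "proj z = proj y" by (simp add: proj_eq_iff)
      with k(2) show "z \<in> ?L" by simp
    qed
  qed
  then have "open (proj -` proj ` V)"
    by (simp only:) (intro open_UN ballI open_translation assms)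
  then show ?thesis by (simp add: open_torus_def)
qed

lemma continuous_on_torusI:
  assumes "continuous_on UNIV (\<lambda>z. f (proj z))"
  shows "continuous_on UNIV f"
  using assms by (simp add: continuous_on_open_vimage open_torus_def vimage_def)

lemma compact_torus: "compact (UNIV :: torus set)"
proof -
  have "proj z \<in> proj ` cbox 0 1" for z
  proof -
    define y where "y = (\<chi> i. frac (z $ i))"
    have "y \<in> cbox 0 1"
      by (auto simp: mem_box_cart y_def intro: less_imp_le[OF frac_lt_1])
    moreover have "lattice_rel z y" by (simp add: lattice_rel_def y_def frac_def)
    ultimately show ?thesis by (metis imageI proj_eq_iff)
  qed
  then have "UNIV = proj ` cbox 0 1"
    by (metis (no_types) UNIV_eq_I proj_rep_torus)
  moreover have "compact (proj ` cbox 0 1)"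
    by (rule compact_continuous_image[OF continuous_on_proj[OF continuous_on_id] compact_cbox])
  ultimately show ?thesis by simp
qed

lemma inj_on_proj_ball: "inj_on proj (ball z (1/2))"
proof (rule inj_onI)
  fix x y assume xy: "x \<in> ball z (1/2)" "y \<in> ball z (1/2)" "proj x = proj y"
  have "x $ i = y $ i" for i
  proof -
    have "dist x y < 1"
      using xy(1,2) dist_triangle_half_r[of z x 1 y] by (simp add: dist_commute)
    then have "\<bar>x $ i - y $ i\<bar> < 1"
      using dist_vec_nth_le[of x i y] by (simp add: dist_real_def)
    moreover have "x $ i - y $ i \<in> \<int>"
      using xy(3) by (simp add: proj_eq_iff lattice_rel_def)
    ultimately show ?thesis using Ints_nonzero_abs_less1 by fastforce
  qed
  then show "x = y" by (simp add: vec_eq_iff)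
qed

text \<open>The projection has continuous local inverses. They turn every continuity question on the torus
  into one about the plane.\<close>

lemma proj_local_section:
  assumes "open V" "inj_on proj V"
  obtains \<sigma> where "homeomorphism V (proj ` V) proj \<sigma>"
proof (rule homeomorphism_injective_open_map[of V proj "proj ` V"])
  show "continuous_on V proj" using continuous_on_proj[OF continuous_on_id] .
  show "openin (top_of_set (proj ` V)) (proj ` U)" if "openin (top_of_set V) U" for U
  proof -
    have "open U" "U \<subseteq> V" using that assms(1) by (simp_all add: openin_open_eq)
    then show ?thesis using open_proj_image[of U] by (intro open_subset) auto
  qed
qed (use assms in \<open>auto intro: that\<close>)

lemma continuous_on_locally:
  assumes "\<And>x. x \<in> S \<Longrightarrow> \<exists>W. open W \<and> x \<in> W \<and> continuous_on (S \<inter> W) f"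
  shows "continuous_on S f"
  unfolding continuous_on_def
proof
  fix x assume "x \<in> S"
  then obtain W where W: "open W" "x \<in> W" "continuous_on (S \<inter> W) f" using assms by blast
  then have "(f \<longlongrightarrow> f x) (at x within S \<inter> W)" using \<open>x \<in> S\<close> by (simp add: continuous_on_def)
  moreover have "at x within S \<inter> W = at x within S"
    by (rule at_within_nhd[OF W(2,1)]) auto
  ultimately show "(f \<longlongrightarrow> f x) (at x within S)" by simp
qed

text \<open>A product of a quotient map with an identity map need not be a quotient map. Here it is one, because
  the projection is a local homeomorphism; this is what lets homotopies descend.\<close>

lemma continuous_on_torus_param:
  fixes h :: "'a::topological_space \<times> torus \<Rightarrow> 'b::topological_space"
  assumes "continuous_on (S \<times> UNIV) (\<lambda>x. h (fst x, proj (snd x)))"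
  shows "continuous_on (S \<times> UNIV) h"
proof -
  have loc: "continuous_on (S \<times> (proj ` ball (z::real^2) (1/2))) h" for z
  proof -
    obtain \<sigma> where \<sigma>: "homeomorphism (ball z (1/2)) (proj ` ball z (1/2)) proj \<sigma>"
      using proj_local_section[OF open_ball inj_on_proj_ball] .
    have "continuous_on (S \<times> (proj ` ball z (1/2))) (\<lambda>x. (fst x, \<sigma> (snd x)))"
    proof (rule continuous_on_Pair[OF continuous_on_fst[OF continuous_on_id]])
      show "continuous_on (S \<times> (proj ` ball z (1/2))) (\<lambda>x. \<sigma> (snd x))"
        by (rule continuous_on_compose2[OF homeomorphism_cont2[OF \<sigma>]
              continuous_on_snd[OF continuous_on_id]]) auto
    qed
    then have "continuous_on (S \<times> (proj ` ball z (1/2)))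
        (\<lambda>x. h (fst (fst x, \<sigma> (snd x)), proj (snd (fst x, \<sigma> (snd x)))))"
      by (rule continuous_on_compose2[OF assms]) auto
    then show ?thesis
      by (rule continuous_on_eq) (auto simp: homeomorphism_apply2[OF \<sigma>])
  qed
  show ?thesis
  proof (rule continuous_on_locally)
    fix x :: "'a \<times> torus"
    define W where "W = (UNIV :: 'a set) \<times> proj ` ball (rep_torus (snd x)) (1/2)"
    have "open W" "x \<in> W"
      unfolding W_def by (auto simp: mem_Times_iff intro!: open_Times open_proj_image image_eqI[of _ _ "rep_torus (snd x)"])
    moreover have "continuous_on (S \<times> UNIV \<inter> W) h"
      using loc[of "rep_torus (snd x)"] by (simp add: W_def Times_Int_Times)
    ultimately show "\<exists>W. open W \<and> x \<in> W \<and> continuous_on (S \<times> UNIV \<inter> W) h" by blast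
  qed
qed

section \<open>Torus maps with a global lift\<close>

lemma has_torus_derivative_lift:
  assumes "\<And>z. f (proj z) = proj (F z)" "(F has_derivative D) (at z)"
  shows "has_torus_derivative f D (proj z)"
  unfolding has_torus_derivative_def
  by (rule exI[of _ z], rule exI[of _ F]) (simp add: assms)

text \<open>The lift is injective, so by invariance of domain it is a homeomorphism onto an open set. On a
  ball so small that it and its image embed into the torus, the inverse of the lift is a local lift of the
  inverse branch.\<close>

lemma C1_local_diffeo_lift:
  fixes D D' :: "real^2 \<Rightarrow> (real^2) \<Rightarrow>\<^sub>L (real^2)"
  assumes lift: "\<And>z. f (proj z) = proj (F z)"
    and F': "\<And>z. (F has_derivative blinfun_apply (D z)) (at z)"
    and inj: "inj F"
    and D: "continuous_on UNIV D" "\<And>y z. lattice_rel y z \<Longrightarrow> D y = D z"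
    and D': "continuous_on UNIV D'" "\<And>z. blinfun_apply (D z) \<circ> blinfun_apply (D' z) = id"
  shows "C1_local_diffeo f"
  unfolding C1_local_diffeo_def
proof
  fix p
  have contF: "continuous_on S F" for S
    by (intro continuous_at_imp_continuous_on ballI has_derivative_continuous[OF F'])
  define z where "z = rep_torus p"
  have p: "p = proj z" by (simp add: z_def)
  have "open (F -` ball (F z) (1/2))"
    using contF[of UNIV] by (simp add: continuous_on_open_vimage)
  moreover define B where "B = F -` ball (F z) (1/2) \<inter> ball z (1/2)"
  ultimately have B: "open B" "z \<in> B" "B \<subseteq> ball z (1/2)" "F ` B \<subseteq> ball (F z) (1/2)" by auto
  have injB: "inj_on F B" using inj by (rule inj_on_subset) simp
  have FB: "open (F ` B)" by (rule invariance_of_domain[OF contF B(1) injB])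
  obtain G where G: "homeomorphism B (F ` B) F G"
    using invariance_of_domain_homeomorphism[OF B(1) contF _ injB] by auto
  obtain \<sigma> where \<sigma>: "homeomorphism B (proj ` B) proj \<sigma>"
    using proj_local_section[OF B(1)] inj_on_subset[OF inj_on_proj_ball B(3)] by blast
  obtain \<sigma>' where \<sigma>': "homeomorphism (F ` B) (proj ` F ` B) proj \<sigma>'"
    using proj_local_section[OF FB] inj_on_subset[OF inj_on_proj_ball B(4)] by blast
  define g where "g = proj \<circ> (G \<circ> \<sigma>')"
  have "homeomorphism (proj ` B) (proj ` F ` B) (proj \<circ> (F \<circ> \<sigma>)) ((proj \<circ> G) \<circ> \<sigma>')"
    by (intro homeomorphism_compose[OF _ \<sigma>'] homeomorphism_compose[OF homeomorphism_symD[OF \<sigma>]] G)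
  then have hom: "homeomorphism (proj ` B) (proj ` F ` B) f g"
    by (rule homeomorphism_cong)
      (auto simp: lift g_def homeomorphism_apply1[OF \<sigma>])
  have "torus_C1_on (proj ` B) f"
    unfolding torus_C1_on_def
  proof (intro exI conjI ballI)
    have eq: "D (rep_torus (proj y)) = D y" for y
      by (intro D(2)) (simp flip: proj_eq_iff)
    then have "continuous_on UNIV (\<lambda>q. D (rep_torus q))"
      using D(1) by (intro continuous_on_torusI) simp
    then show "continuous_on (proj ` B) (\<lambda>q. D (rep_torus q))"
      by (rule continuous_on_subset) simp
    show "has_torus_derivative f (blinfun_apply (D (rep_torus q))) q" for q
      using has_torus_derivative_lift[OF lift F', of "rep_torus q"] by simp
  qed
  moreover have "torus_C1_on (proj ` F ` B) g"
    unfolding torus_C1_on_def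
  proof (intro exI conjI ballI)
    have "continuous_on (proj ` F ` B) (\<lambda>q. G (\<sigma>' q))"
      by (rule continuous_on_compose2[OF homeomorphism_cont2[OF G] homeomorphism_cont2[OF \<sigma>']])
        (simp add: homeomorphism_image2[OF \<sigma>'])
    then show "continuous_on (proj ` F ` B) (\<lambda>q. D' (G (\<sigma>' q)))"
      by (rule continuous_on_compose2[OF D'(1)]) simp
    fix q assume "q \<in> proj ` F ` B"
    then obtain x where x: "x \<in> B" "q = proj (F x)" by auto
    have "\<forall>\<^sub>F y in nhds (F x). y \<in> F ` B"
      using FB x(1) by (intro eventually_nhds_in_open) auto
    then have "\<forall>\<^sub>F y in nhds (F x). g (proj y) = proj (G y)"
      by eventually_elim (simp add: g_def homeomorphism_apply1[OF \<sigma>'])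
    moreover have "(G has_derivative blinfun_apply (D' x)) (at (F x))"
      by (rule has_derivative_inverse_strong[OF B(1) x(1) contF _ F' D'(2)])
        (simp add: homeomorphism_apply1[OF G])
    moreover have "G (\<sigma>' q) = x"
      using x by (simp add: homeomorphism_apply1[OF \<sigma>'] homeomorphism_apply1[OF G])
    ultimately show "has_torus_derivative g (blinfun_apply (D' (G (\<sigma>' q)))) q"
      unfolding has_torus_derivative_def x(2) by (intro exI[of _ "F x"] exI[of _ G]) simp
  qed
  ultimately show "\<exists>U V g. open U \<and> p \<in> U \<and> open V \<and> homeomorphism U V f g \<and>
      torus_C1_on U f \<and> torus_C1_on V g"
    using hom open_proj_image[OF B(1)] open_proj_image[OF FB] B(2) p
    by (intro exI[of _ "proj ` B"] exI[of _ "proj ` F ` B"] exI[of _ g]) simp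
qed

text \<open>Two lifts that transform in the same way under the lattice are joined by straight segments in
  the plane, and this homotopy descends.\<close>

lemma homotopic_linear_torus_map:
  fixes A :: "int^2^2"
  defines "M \<equiv> map_matrix real_of_int A"
  assumes lift: "\<And>z. f (proj z) = proj (F z)" and contF: "continuous_on UNIV F"
    and equiv: "\<And>y z. lattice_rel y z \<Longrightarrow> F y - F z = M *v (y - z)"
  shows "homotopic_with_canon (\<lambda>_. True) UNIV UNIV f (linear_torus_map A)"
proof -
  define H where "H = (\<lambda>(t::real, z). (1 - t) *\<^sub>R F z + t *\<^sub>R (M *v z))"
  define h where "h = (\<lambda>(t::real, p). proj (H (t, rep_torus p)))"
  have h: "h (t, proj z) = proj (H (t, z))" for t z
  proof -
    define y where "y = rep_torus (proj z)"
    have y: "lattice_rel y z" by (simp add: y_def flip: proj_eq_iff)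
    have "H (t, y) - H (t, z) = (1 - t) *\<^sub>R (F y - F z) + t *\<^sub>R (M *v (y - z))"
      by (simp add: H_def algebra_simps matrix_vector_mult_diff_distrib)
    also have "\<dots> = M *v (y - z)" by (simp add: equiv[OF y] algebra_simps)
    finally have eq: "H (t, y) - H (t, z) = M *v y - M *v z"
      by (simp add: matrix_vector_mult_diff_distrib)
    have "proj (M *v y) = proj (M *v z)"
      using y by (metis M_def linear_torus_map.abs_eq proj_eq_iff)
    then have "lattice_rel (H (t, y)) (H (t, z))"
      by (simp add: proj_eq_iff lattice_rel_def eq flip: vector_minus_component)
    then show ?thesis by (simp add: h_def proj_eq_iff y_def)
  qed
  have "continuous_on ({0..1} \<times> UNIV) H"
  proof -
    have "continuous_on ({0..1::real} \<times> UNIV) (\<lambda>x. F (snd x))"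
      by (rule continuous_on_compose2[OF contF continuous_on_snd[OF continuous_on_id]]) simp
    moreover have "continuous_on ({0..1::real} \<times> UNIV) (\<lambda>x. M *v snd x)"
      by (rule continuous_on_compose2[OF linear_continuous_on[OF matrix_vector_mul_bounded_linear]
            continuous_on_snd[OF continuous_on_id]]) (rule subset_UNIV)
    ultimately show ?thesis
      unfolding H_def case_prod_unfold by (intro continuous_intros)
  qed
  then have "continuous_on ({0..1} \<times> UNIV) h"
    by (intro continuous_on_torus_param) (simp add: h continuous_on_proj)
  moreover have "h (0, p) = f p" for p
    using h[of 0 "rep_torus p"] lift[of "rep_torus p"] by (simp add: H_def)
  moreover have "h (1, p) = linear_torus_map A p" for p
    using h[of 1 "rep_torus p"] linear_torus_map.abs_eq[of A "rep_torus p"] by (simp add: H_def M_def)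
  ultimately show ?thesis
    unfolding homotopic_with_def by (intro exI[of _ h]) (auto simp: prod_topology_subtopology)
qed

section \<open>Skew products over a circle map\<close>

text \<open>The coordinates \<open>xc\<close> and \<open>yc\<close> are dual to the basis \<open>v, w\<close>; they are given by Cramer's rule and take
  integer values on the lattice because the determinant is one.\<close>

locale unimodular_basis =
  fixes v w :: "int^2"
  assumes unimodular: "v $ 1 * w $ 2 - v $ 2 * w $ 1 = 1"
begin

definition pt :: "real \<Rightarrow> real \<Rightarrow> real^2" where
  "pt x y = (\<chi> i. x * of_int (v $ i) + y * of_int (w $ i))"

definition xc :: "real^2 \<Rightarrow> real" where
  "xc z = z $ 1 * of_int (w $ 2) - z $ 2 * of_int (w $ 1)"

definition yc :: "real^2 \<Rightarrow> real" where
  "yc z = z $ 2 * of_int (v $ 1) - z $ 1 * of_int (v $ 2)"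

lemma unimodular_real:
  "real_of_int (v $ 1) * of_int (w $ 2) = 1 + of_int (v $ 2) * of_int (w $ 1)"
  using arg_cong[OF unimodular, of real_of_int] by simp

lemma xc_pt [simp]: "xc (pt x y) = x"
proof -
  have "xc (pt x y) = x * (of_int (v $ 1) * of_int (w $ 2) - of_int (v $ 2) * of_int (w $ 1))"
    by (simp add: xc_def pt_def algebra_simps)
  then show ?thesis by (simp add: unimodular_real)
qed

lemma yc_pt [simp]: "yc (pt x y) = y"
proof -
  have "yc (pt x y) = y * (of_int (v $ 1) * of_int (w $ 2) - of_int (v $ 2) * of_int (w $ 1))"
    by (simp add: yc_def pt_def algebra_simps)
  then show ?thesis by (simp add: unimodular_real)
qed

lemma pt_xc_yc [simp]: "pt (xc z) (yc z) = z"
proof -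
  have "xc z * of_int (v $ i) + yc z * of_int (w $ i) = z $ i" if "i = 1 \<or> i = 2" for i
  proof -
    have "xc z * of_int (v $ i) + yc z * of_int (w $ i) =
        z $ i * (of_int (v $ 1) * of_int (w $ 2) - of_int (v $ 2) * of_int (w $ 1))"
      using that by (auto simp: xc_def yc_def algebra_simps)
    then show ?thesis by (simp add: unimodular_real)
  qed
  then show ?thesis by (simp add: pt_def vec_eq_iff forall_2)
qed

lemma coords_eqI: "xc y = xc z \<Longrightarrow> yc y = yc z \<Longrightarrow> y = z"
  by (metis pt_xc_yc)

lemma xc_linear [simp]:
  "xc (y + z) = xc y + xc z" "xc (y - z) = xc y - xc z" "xc (r *\<^sub>R z) = r * xc z" "xc 0 = 0"
  "xc (- z) = - xc z"
  by (simp_all add: xc_def algebra_simps)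

lemma yc_linear [simp]:
  "yc (y + z) = yc y + yc z" "yc (y - z) = yc y - yc z" "yc (r *\<^sub>R z) = r * yc z" "yc 0 = 0"
  "yc (- z) = - yc z"
  by (simp_all add: yc_def algebra_simps)

lemma pt_add: "pt x y + pt x' y' = pt (x + x') (y + y')"
  and pt_diff: "pt x y - pt x' y' = pt (x - x') (y - y')"
  and pt_scaleR: "r *\<^sub>R pt x y = pt (r * x) (r * y)"
  by (auto intro: coords_eqI)

lemma bounded_linear_xc: "bounded_linear xc" and bounded_linear_yc: "bounded_linear yc"
  by (auto intro!: linear_conv_bounded_linear[THEN iffD1] linearI)

lemmas continuous_on_xc [continuous_intros] = bounded_linear.continuous_on[OF bounded_linear_xc]
lemmas continuous_on_yc [continuous_intros] = bounded_linear.continuous_on[OF bounded_linear_yc]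

lemma continuous_on_pt [continuous_intros]:
  assumes "continuous_on S a" "continuous_on S b"
  shows "continuous_on S (\<lambda>t. pt (a t) (b t))"
proof -
  have eq: "(\<lambda>t. pt (a t) (b t)) = (\<lambda>t. a t *\<^sub>R pt 1 0 + b t *\<^sub>R pt 0 1)"
    by (simp add: pt_add pt_scaleR)
  show ?thesis unfolding eq by (intro continuous_intros assms)
qed

lemma coord_bounds:
  obtains K where "K > 0" "\<And>z. \<bar>xc z\<bar> \<le> K * norm z" "\<And>z. \<bar>yc z\<bar> \<le> K * norm z"
    "\<And>z. norm z \<le> K * (\<bar>xc z\<bar> + \<bar>yc z\<bar>)"
proof -
  obtain K1 where K1: "K1 > 0" "\<And>z. norm (xc z) \<le> norm z * K1"
    using bounded_linear.pos_bounded[OF bounded_linear_xc] by auto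
  obtain K2 where K2: "K2 > 0" "\<And>z. norm (yc z) \<le> norm z * K2"
    using bounded_linear.pos_bounded[OF bounded_linear_yc] by auto
  define K where "K = K1 + K2 + norm (pt 1 0) + norm (pt 0 1)"
  show ?thesis
  proof (rule that[of K])
    show "K > 0" using K1(1) K2(1) by (simp add: K_def add_pos_nonneg)
    show "\<bar>xc z\<bar> \<le> K * norm z" for z
    proof -
      have "\<bar>xc z\<bar> \<le> K1 * norm z" using K1(2)[of z] by (simp add: mult.commute)
      also have "\<dots> \<le> K * norm z" using K2(1) by (intro mult_right_mono) (auto simp: K_def)
      finally show ?thesis .
    qed
    show "\<bar>yc z\<bar> \<le> K * norm z" for z
    proof -
      have "\<bar>yc z\<bar> \<le> K2 * norm z" using K2(2)[of z] by (simp add: mult.commute)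
      also have "\<dots> \<le> K * norm z" using K1(1) by (intro mult_right_mono) (auto simp: K_def)
      finally show ?thesis .
    qed
    show "norm z \<le> K * (\<bar>xc z\<bar> + \<bar>yc z\<bar>)" for z
    proof -
      have "norm z = norm (xc z *\<^sub>R pt 1 0 + yc z *\<^sub>R pt 0 1)"
        by (simp add: pt_add pt_scaleR)
      also have "\<dots> \<le> \<bar>xc z\<bar> * norm (pt 1 0) + \<bar>yc z\<bar> * norm (pt 0 1)"
        by (metis norm_triangle_ineq norm_scaleR)
      also have "\<dots> \<le> \<bar>xc z\<bar> * K + \<bar>yc z\<bar> * K"
        using K1(1) K2(1) by (intro add_mono mult_left_mono) (auto simp: K_def)
      finally show ?thesis by (simp add: algebra_simps)
    qed
  qed
qed

lemma lattice_rel_iff: "lattice_rel y z \<longleftrightarrow> xc y - xc z \<in> \<int> \<and> yc y - yc z \<in> \<int>"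
proof
  assume "lattice_rel y z"
  then have "(y - z) $ i \<in> \<int>" for i by (simp add: lattice_rel_def)
  then have "xc (y - z) \<in> \<int> \<and> yc (y - z) \<in> \<int>"
    unfolding xc_def yc_def by (intro conjI Ints_diff Ints_mult Ints_of_int)
  then show "xc y - xc z \<in> \<int> \<and> yc y - yc z \<in> \<int>" by simp
next
  assume *: "xc y - xc z \<in> \<int> \<and> yc y - yc z \<in> \<int>"
  have "(y - z) $ i = xc (y - z) * of_int (v $ i) + yc (y - z) * of_int (w $ i)" for i
    by (subst pt_xc_yc[symmetric]) (simp add: pt_def)
  also have "\<dots> i \<in> \<int>" for i
    using * by (auto intro!: Ints_add Ints_mult)
  finally show "lattice_rel y z" by (simp add: lattice_rel_def)
qed

end

lemma shift_periodic_int: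
  fixes h :: "real \<Rightarrow> 'a::real_vector"
  assumes "\<And>y. h (y + 1) = h y + a"
  shows "h (y + of_int n) = h y + of_int n *\<^sub>R a"
proof -
  have pos: "h (y + of_nat n) = h y + of_nat n *\<^sub>R a" for y n
  proof (induction n)
    case (Suc n)
    have "h (y + of_nat (Suc n)) = h ((y + of_nat n) + 1)" by (simp add: add_ac)
    then show ?case by (simp only: assms Suc) (simp add: algebra_simps)
  qed simp
  show ?thesis
  proof (cases "n \<ge> 0")
    case True
    then show ?thesis using pos[of y "nat n"] by simp
  next
    case False
    then show ?thesis using pos[of "y + of_int n" "nat (- n)"] by simp
  qed
qed

locale skew_product = unimodular_basis v w for v w :: "int^2" +
  fixes lam :: real and c mu :: int and \<Phi> g \<psi> \<gamma> :: "real \<Rightarrow> real"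
  assumes lam: "lam \<ge> 2" "lam \<in> \<int>"
    and \<Phi>_shift: "\<And>y. \<Phi> (y + 1) = \<Phi> y + of_int c"
    and g_shift: "\<And>y. g (y + 1) = g y + of_int mu"
    and \<Phi>_deriv: "\<And>y. (\<Phi> has_real_derivative \<psi> y) (at y)"
    and g_deriv: "\<And>y. (g has_real_derivative \<gamma> y) (at y)"
    and \<psi>_cont: "continuous_on UNIV \<psi>" and \<gamma>_cont: "continuous_on UNIV \<gamma>"
    and \<gamma>_nz: "\<And>y. \<gamma> y \<noteq> 0"
    and \<psi>_periodic: "\<And>y. \<psi> (y + 1) = \<psi> y" and \<gamma>_periodic: "\<And>y. \<gamma> (y + 1) = \<gamma> y"
begin

definition F :: "real^2 \<Rightarrow> real^2" where
  "F z = pt (lam * xc z + \<Phi> (yc z)) (g (yc z))"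

definition f :: "torus \<Rightarrow> torus" where
  "f p = proj (F (rep_torus p))"

definition DF :: "real^2 \<Rightarrow> real^2 \<Rightarrow> real^2" where
  "DF z h = pt (lam * xc h + \<psi> (yc z) * yc h) (\<gamma> (yc z) * yc h)"

text \<open>The lift has the same translation behaviour as the linear map with matrix rows \<open>(lam, c)\<close> and
  \<open>(0, mu)\<close>. Hence it descends to the torus, and the induced map is homotopic to that linear map.\<close>

lemma F_lattice:
  assumes "lattice_rel y z"
  shows "F y - F z = pt (lam * xc (y - z) + of_int c * yc (y - z)) (of_int mu * yc (y - z))"
proof -
  obtain n where n: "yc y = yc z + of_int n"
    using assms by (auto simp: lattice_rel_iff elim!: Ints_cases) (metis add.commute diff_add_cancel)
  show ?thesis
    unfolding F_def pt_diff
    using shift_periodic_int[of \<Phi> _ "yc z" n, OF \<Phi>_shift] shift_periodic_int[of g _ "yc z" n, OF g_shift]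
    by (simp add: n algebra_simps)
qed

lemma F_lattice_rel: "lattice_rel y z \<Longrightarrow> lattice_rel (F y) (F z)"
proof -
  assume r: "lattice_rel y z"
  have "xc (F y - F z) \<in> \<int>" "yc (F y - F z) \<in> \<int>"
    using r lam(2) by (auto simp only: F_lattice[OF r] xc_pt yc_pt xc_linear yc_linear lattice_rel_iff
        intro!: Ints_add Ints_mult Ints_of_int)
  then show "lattice_rel (F y) (F z)" by (simp add: lattice_rel_iff)
qed

lemma f_proj: "f (proj z) = proj (F z)"
proof -
  have "lattice_rel (rep_torus (proj z)) z" by (simp flip: proj_eq_iff)
  then show ?thesis by (simp add: f_def proj_eq_iff F_lattice_rel)
qed

lemma periodic_lattice:
  fixes h :: "real \<Rightarrow> 'a::real_vector"
  assumes "\<And>y. h (y + 1) = h y" "lattice_rel y z"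
  shows "h (yc y) = h (yc z)"
proof -
  obtain n where n: "yc y = yc z + of_int n"
    using assms(2) by (auto simp: lattice_rel_iff elim!: Ints_cases) (metis add.commute diff_add_cancel)
  show ?thesis using shift_periodic_int[of h 0 "yc z" n] assms(1) by (simp add: n)
qed

lemma F_has_derivative: "(F has_derivative DF z) (at z)"
proof -
  have x: "(xc has_derivative xc) (at z)" and y: "(yc has_derivative yc) (at z)"
    by (auto intro: bounded_linear_imp_has_derivative bounded_linear_xc bounded_linear_yc)
  have "((\<lambda>z. \<Phi> (yc z)) has_derivative (\<lambda>h. \<psi> (yc z) * yc h)) (at z)"
    using has_derivative_compose[OF y \<Phi>_deriv[THEN has_field_derivative_imp_has_derivative]]
    by simp
  moreover have "((\<lambda>z. g (yc z)) has_derivative (\<lambda>h. \<gamma> (yc z) * yc h)) (at z)"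
    using has_derivative_compose[OF y g_deriv[THEN has_field_derivative_imp_has_derivative]]
    by simp
  ultimately have "((\<lambda>z. (lam * xc z + \<Phi> (yc z)) *\<^sub>R pt 1 0 + g (yc z) *\<^sub>R pt 0 1) has_derivative
      (\<lambda>h. (lam * xc h + \<psi> (yc z) * yc h) *\<^sub>R pt 1 0 + (\<gamma> (yc z) * yc h) *\<^sub>R pt 0 1)) (at z)"
    by (auto intro!: derivative_eq_intros x)
  then show ?thesis
    by (simp add: F_def[abs_def] DF_def[abs_def] pt_scaleR pt_add)
qed

lemma torus_deriv_f: "torus_deriv f (proj z) = DF z"
  by (intro torus_deriv_eq has_torus_derivative_lift[OF f_proj F_has_derivative])

lemma inj_g: "inj g"
proof (rule injI, rule ccontr)
  fix x y assume *: "g x = g y" "x \<noteq> y"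
  define a b where "a = min x y" and "b = max x y"
  have ab: "a < b" "g a = g b" using * by (auto simp: a_def b_def min_def max_def)
  obtain z where "g b - g a = (b - a) * \<gamma> z"
    using MVT2[OF ab(1), of g \<gamma>] g_deriv by blast
  with ab \<gamma>_nz[of z] show False by simp
qed

lemma inj_F: "inj F"
proof (rule injI)
  fix y z assume eq: "F y = F z"
  have "yc y = yc z" using arg_cong[OF eq, of yc] by (simp add: F_def inj_eq[OF inj_g])
  moreover have "xc y = xc z"
    using arg_cong[OF eq, of xc] lam(1) calculation by (simp add: F_def)
  ultimately show "y = z" by (metis coords_eqI)
qed

lemma C1_local_diffeo_f: "C1_local_diffeo f"
proof -
  define X where "X = Blinfun (\<lambda>h. pt (xc h) 0)"
  define Y where "Y = Blinfun (\<lambda>h. pt (yc h) 0)"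
  define Z where "Z = Blinfun (\<lambda>h. pt 0 (yc h))"
  have X: "blinfun_apply X h = pt (xc h) 0" for h
    unfolding X_def by (subst bounded_linear_Blinfun_apply)
      (auto intro!: linear_conv_bounded_linear[THEN iffD1] linearI simp: pt_add pt_scaleR)
  have Y: "blinfun_apply Y h = pt (yc h) 0" for h
    unfolding Y_def by (subst bounded_linear_Blinfun_apply)
      (auto intro!: linear_conv_bounded_linear[THEN iffD1] linearI simp: pt_add pt_scaleR)
  have Z: "blinfun_apply Z h = pt 0 (yc h)" for h
    unfolding Z_def by (subst bounded_linear_Blinfun_apply)
      (auto intro!: linear_conv_bounded_linear[THEN iffD1] linearI simp: pt_add pt_scaleR)
  define D where "D z = lam *\<^sub>R X + \<psi> (yc z) *\<^sub>R Y + \<gamma> (yc z) *\<^sub>R Z" for z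
  define D' where "D' z = (1/lam) *\<^sub>R X + (- \<psi> (yc z) / (\<gamma> (yc z) * lam)) *\<^sub>R Y
      + (1 / \<gamma> (yc z)) *\<^sub>R Z" for z
  have D_apply: "blinfun_apply (D z) = DF z" for z
    by (auto simp: D_def X Y Z DF_def blinfun.bilinear_simps pt_add pt_scaleR fun_eq_iff)
  have cont: "continuous_on UNIV (\<lambda>z. \<psi> (yc z))" "continuous_on UNIV (\<lambda>z. \<gamma> (yc z))"
    by (rule continuous_on_compose2[OF \<psi>_cont] continuous_on_compose2[OF \<gamma>_cont];
        simp add: continuous_on_yc continuous_on_id)+
  show ?thesis
  proof (rule C1_local_diffeo_lift[OF f_proj _ inj_F, where D = D and D' = D'])
    show "(F has_derivative blinfun_apply (D z)) (at z)" for z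
      by (simp add: D_apply F_has_derivative)
    show "continuous_on UNIV D"
      unfolding D_def[abs_def] by (intro continuous_intros cont)
    show "continuous_on UNIV D'"
      unfolding D'_def[abs_def] using lam(1) \<gamma>_nz by (intro continuous_intros cont) auto
    show "D y = D z" if "lattice_rel y z" for y z
      using periodic_lattice[of \<psi>, OF \<psi>_periodic that] periodic_lattice[of \<gamma>, OF \<gamma>_periodic that]
      by (simp add: D_def)
    show "blinfun_apply (D z) \<circ> blinfun_apply (D' z) = id" for z
    proof
      fix h
      have D': "blinfun_apply (D' z) h =
          pt ((1/lam) * xc h + (- \<psi> (yc z) / (\<gamma> (yc z) * lam)) * yc h) ((1 / \<gamma> (yc z)) * yc h)"
        by (simp add: D'_def X Y Z blinfun.bilinear_simps pt_add pt_diff pt_scaleR)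
      show "(blinfun_apply (D z) \<circ> blinfun_apply (D' z)) h = id h"
        unfolding o_apply D_apply D' DF_def id_apply
        using lam(1) \<gamma>_nz[of "yc z"] by (intro coords_eqI) (simp_all add: field_simps)
    qed
  qed
qed

lemma homotopic_f:
  fixes A :: "int^2^2"
  defines "M \<equiv> map_matrix real_of_int A"
  assumes "\<And>x y. M *v pt x y = pt (lam * x + of_int c * y) (of_int mu * y)"
  shows "homotopic_with_canon (\<lambda>_. True) UNIV UNIV f (linear_torus_map A)"
proof (rule homotopic_linear_torus_map[of f F, OF f_proj])
  show "continuous_on UNIV F"
    by (meson F_has_derivative continuous_at_imp_continuous_on has_derivative_continuous)
  show "F y - F z = map_matrix real_of_int A *v (y - z)" if "lattice_rel y z" for y z
    using F_lattice[OF that] assms(2)[of "xc (y - z)" "yc (y - z)"] unfolding M_def pt_xc_yc by simp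
qed

end

section \<open>Centre vectors are dominated by the Jacobian\<close>

definition cross2 :: "real^2 \<Rightarrow> real^2 \<Rightarrow> real" where
  "cross2 a b = a $ 1 * b $ 2 - a $ 2 * b $ 1"

lemma quad_form_eq:
  "transpose S = S \<Longrightarrow>
    quad_form S h = S $ 1 $ 1 * (h $ 1)\<^sup>2 + 2 * S $ 1 $ 2 * h $ 1 * h $ 2 + S $ 2 $ 2 * (h $ 2)\<^sup>2"
proof -
  assume "transpose S = S"
  then have "transpose S $ 1 $ 2 = S $ 1 $ 2" by (rule arg_cong)
  then have "S $ 2 $ 1 = S $ 1 $ 2" by (simp add: transpose_def)
  then show ?thesis
    by (simp add: quad_form_def inner_vec_def matrix_vector_mult_def sum_2 power2_eq_square algebra_simps)
qed

lemma quad_form_0 [simp]: "quad_form S 0 = 0"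
  by (simp add: quad_form_def)

lemma quad_form_scaleR: "quad_form S (r *\<^sub>R h) = r\<^sup>2 * quad_form S h"
  by (simp add: quad_form_def matrix_vector_mult_scaleR power2_eq_square)

lemma continuous_on_quad_form [continuous_intros]:
  assumes "continuous_on U S" "continuous_on U h"
  shows "continuous_on U (\<lambda>t. quad_form (S t) (h t))"
proof -
  have "continuous_on U (\<lambda>t. S t *v h t)"
    unfolding matrix_vector_mult_def by (intro continuous_intros assms)
  then show ?thesis unfolding quad_form_def by (intro continuous_intros assms)
qed

text \<open>Along the segment from \<open>a\<close> in direction \<open>w\<close> the form is a quadratic polynomial with leading
  coefficient at most \<open>- L\<close> that is nonnegative at two parameters at distance \<open>\<eta>\<close>. Its discriminant is
  therefore at least \<open>(L \<eta>)\<^sup>2\<close>; on the other hand it equals \<open>-4 det S\<close> times the squared area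
  spanned by \<open>a\<close> and \<open>w\<close>.\<close>

lemma quad_form_segment_bound:
  assumes sym: "transpose S = S" and w: "quad_form S w \<le> - L" "L \<ge> 0"
    and a: "quad_form S a \<ge> 0" "quad_form S (a + \<eta> *\<^sub>R w) \<ge> 0"
  shows "(L * \<eta>)\<^sup>2 \<le> 4 * \<bar>det S\<bar> * (cross2 a w)\<^sup>2"
proof -
  define B where "B = S $ 1 $ 1 * a $ 1 * w $ 1 + S $ 1 $ 2 * (a $ 1 * w $ 2 + a $ 2 * w $ 1)
      + S $ 2 $ 2 * a $ 2 * w $ 2"
  define qa where "qa = quad_form S a"
  define l where "l = - quad_form S w"
  have "transpose S $ 1 $ 2 = S $ 1 $ 2" using sym by (rule arg_cong)
  then have s21: "S $ 2 $ 1 = S $ 1 $ 2" by (simp add: transpose_def)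
  have disc: "B\<^sup>2 + l * qa = - det S * (cross2 a w)\<^sup>2"
    by (simp add: B_def l_def qa_def quad_form_eq[OF sym] det_2 cross2_def s21 power2_eq_square algebra_simps)
  have pol: "quad_form S (a + \<eta> *\<^sub>R w) = qa + 2 * \<eta> * B - l * \<eta>\<^sup>2"
    by (simp add: B_def l_def qa_def quad_form_eq[OF sym] power2_eq_square algebra_simps)
  have l: "l \<ge> L" using w by (simp add: l_def)
  have "(l * \<eta>)\<^sup>2 \<le> 4 * (B\<^sup>2 + l * qa)"
  proof -
    define t where "t = l * \<eta>"
    have "l * (qa + 2 * \<eta> * B - l * \<eta>\<^sup>2) \<ge> 0"
      using a pol l w(2) by (auto simp: qa_def)
    then have q: "l * qa \<ge> t * (t - 2 * B)" by (simp add: t_def algebra_simps power2_eq_square)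
    have "l * qa \<ge> 0" using a l w(2) by (simp add: qa_def)
    show ?thesis
    proof (cases "t\<^sup>2 \<le> (2 * B)\<^sup>2")
      case True
      then show ?thesis using \<open>l * qa \<ge> 0\<close> by (simp add: t_def)
    next
      case False
      then have "\<bar>2 * B\<bar> < \<bar>t\<bar>" by (meson abs_le_square_iff not_le)
      then have "(2 * B - t) * (2 * B - 3 * t) \<ge> 0"
        by (cases "t \<ge> 0") (rule mult_nonpos_nonpos mult_nonneg_nonneg; linarith)+
      then have "t\<^sup>2 \<le> 4 * (B\<^sup>2 + t * (t - 2 * B))" by (simp add: algebra_simps power2_eq_square)
      also have "\<dots> \<le> 4 * (B\<^sup>2 + l * qa)" using q by simp
      finally show ?thesis by (simp add: t_def)
    qed
  qed
  also have "\<dots> \<le> 4 * (\<bar>det S\<bar> * (cross2 a w)\<^sup>2)"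
    unfolding disc by (intro mult_left_mono mult_right_mono) auto
  finally have "(l * \<eta>)\<^sup>2 \<le> 4 * \<bar>det S\<bar> * (cross2 a w)\<^sup>2" by simp
  moreover have "(L * \<eta>)\<^sup>2 \<le> (l * \<eta>)\<^sup>2"
    using l w(2) by (simp add: power_mult_distrib mult_right_mono power_mono)
  ultimately show ?thesis by linarith
qed

primrec deriv_iter :: "(torus \<Rightarrow> torus) \<Rightarrow> nat \<Rightarrow> torus \<Rightarrow> real^2 \<Rightarrow> real^2" where
  "deriv_iter f 0 p h = h"
| "deriv_iter f (Suc n) p h = torus_deriv f ((f ^^ n) p) (deriv_iter f n p h)"

text \<open>The value of the form on unit vectors of the line field is a continuous function on the torus, well
  defined since the form is even, so that compactness gives a uniform bound.\<close>

lemma line_field_uniformly_outside_cone: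
  assumes E: "continuous_line_field E" and Q: "continuous_on UNIV Q"
    and neg: "\<And>p h. h \<in> E p \<Longrightarrow> h \<noteq> 0 \<Longrightarrow> quad_form (Q p) h < 0"
  obtains m where "m > 0" "\<And>p h. h \<in> E p \<Longrightarrow> quad_form (Q p) h \<le> - m * (norm h)\<^sup>2"
proof -
  define X where "X p = (SOME h. h \<noteq> 0 \<and> E p = span {h})" for p
  have X: "X p \<noteq> 0 \<and> E p = span {X p}" for p
  proof -
    have "\<exists>h. h \<noteq> 0 \<and> E p = span {h}" using E unfolding continuous_line_field_def by blast
    then show ?thesis unfolding X_def by (rule someI_ex)
  qed
  define \<phi> where "\<phi> p = quad_form (Q p) (X p) / (norm (X p))\<^sup>2" for p
  have \<phi>_eq: "quad_form (Q p) h = \<phi> p * (norm h)\<^sup>2" if "h \<in> E p" for p h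
  proof -
    obtain r where "h = r *\<^sub>R X p" using \<open>h \<in> E p\<close> X[of p] by (auto simp: span_singleton)
    then show ?thesis
      using X[of p] by (simp add: \<phi>_def quad_form_scaleR power_mult_distrib)
  qed
  have "continuous_on UNIV \<phi>"
  proof (rule continuous_on_locally)
    fix p
    have "\<exists>U Y. open U \<and> p \<in> U \<and> continuous_on U Y \<and> (\<forall>q\<in>U. Y q \<noteq> 0 \<and> E q = span {Y q})"
      using E unfolding continuous_line_field_def by (rule spec)
    then obtain U Y where U: "open U" "p \<in> U" "continuous_on U Y"
      and Y: "\<forall>q\<in>U. Y q \<noteq> 0 \<and> E q = span {Y q}" by (elim exE conjE)
    have "continuous_on U (\<lambda>q. quad_form (Q q) (Y q) / (norm (Y q))\<^sup>2)"
      using Y continuous_on_subset[OF Q] by (intro continuous_intros U(3)) auto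
    then have "continuous_on U \<phi>"
    proof (rule continuous_on_eq)
      fix q assume "q \<in> U"
      then have "Y q \<in> E q" "Y q \<noteq> 0" using Y by (auto simp: span_base)
      then show "quad_form (Q q) (Y q) / (norm (Y q))\<^sup>2 = \<phi> q" using \<phi>_eq[of "Y q" q] by simp
    qed
    then show "\<exists>W. open W \<and> p \<in> W \<and> continuous_on (UNIV \<inter> W) \<phi>" using U(1,2) by auto
  qed
  then obtain p0 where p0: "\<And>p. \<phi> p \<le> \<phi> p0"
    using continuous_attains_sup[OF compact_torus] by blast
  have "\<phi> p0 < 0"
    using neg[of "X p0" p0] X[of p0] by (simp add: \<phi>_def divide_neg_pos span_base)
  then show ?thesis
    using p0 by (intro that[of "- \<phi> p0"]) (auto simp: \<phi>_eq intro!: mult_right_mono)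
qed

text \<open>The centre vector \<open>h\<close> is compared with a vector \<open>a\<close> such that both \<open>a\<close> and \<open>a + \<eta> h\<close> lie in the cone.
  Both stay in the cones forever while \<open>h\<close> stays uniformly outside, and the area spanned by \<open>a\<close> and
  \<open>h\<close> is multiplied by the Jacobian, so the bound for segments limits the length of the images of
  \<open>h\<close>.\<close>

lemma centre_vectors_dominated:
  assumes E: "centre_direction f E"
    and lin: "\<And>p. linear (torus_deriv f p)"
    and jac: "\<And>p a b. cross2 (torus_deriv f p a) (torus_deriv f p b) = d p * cross2 a b"
    and h: "h \<in> E p"
  shows "\<exists>K. \<forall>n. (norm (deriv_iter f n p h))\<^sup>2 \<le> K * (\<Prod>i<n. \<bar>d ((f ^^ i) p)\<bar>)"
proof -
  obtain C where line: "continuous_line_field E" and inv: "\<And>p. torus_deriv f p ` E p = E (f p)"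
    and C: "unstable_cone_family f C" and trans: "\<And>p. E p \<inter> C p = {0}"
    using E unfolding centre_direction_def by blast
  obtain Q where Q: "continuous_on UNIV Q" "\<And>p. nondegenerate_indefinite (Q p)"
    and CQ: "\<And>p. C p = {v. quad_form (Q p) v \<ge> 0}"
    using C unfolding unstable_cone_family_def cone_family_def by blast
  have sym: "transpose (Q p) = Q p" for p using Q(2) by (simp add: nondegenerate_indefinite_def)
  have cinv: "torus_deriv f p a \<in> C (f p)" if "a \<in> C p" for p a
  proof (cases "torus_deriv f p a = 0")
    case False
    then show ?thesis
      using C that interior_subset unfolding unstable_cone_family_def cone_invariant_def by blast
  qed (simp add: CQ)
  have "quad_form (Q p) h < 0" if "h \<in> E p" "h \<noteq> 0" for p h
    using trans[of p] that by (auto simp: CQ not_le[symmetric])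
  then obtain m where m: "m > 0" "\<And>p h. h \<in> E p \<Longrightarrow> quad_form (Q p) h \<le> - m * (norm h)\<^sup>2"
    using line_field_uniformly_outside_cone[OF line Q(1)] by metis
  have "continuous_on UNIV (\<lambda>p. \<bar>det (Q p)\<bar>)"
    unfolding det_2 by (intro continuous_intros Q(1))
  then obtain p0 where p0: "\<And>p. \<bar>det (Q p)\<bar> \<le> \<bar>det (Q p0)\<bar>"
    using continuous_attains_sup[OF compact_torus] by blast
  define D where "D = \<bar>det (Q p0)\<bar>"
  obtain a \<eta> where a: "a \<in> C p" "a + \<eta> *\<^sub>R h \<in> C p" "\<eta> > 0"
  proof -
    obtain a where a: "quad_form (Q p) a > 0"
      using Q(2)[of p] by (auto simp: nondegenerate_indefinite_def)
    have "continuous_on UNIV (\<lambda>s. quad_form (Q p) (a + s *\<^sub>R h))" by (intro continuous_intros)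
    then have "open ((\<lambda>s. quad_form (Q p) (a + s *\<^sub>R h)) -` {0<..})"
      by (simp add: continuous_on_open_vimage)
    moreover have "0 \<in> (\<lambda>s. quad_form (Q p) (a + s *\<^sub>R h)) -` {0<..}" using a by simp
    ultimately obtain e where e: "e > 0" "ball 0 e \<subseteq> (\<lambda>s. quad_form (Q p) (a + s *\<^sub>R h)) -` {0<..}"
      using openE by blast
    have "e/2 \<in> ball 0 e" using e(1) by simp
    then have "quad_form (Q p) (a + (e/2) *\<^sub>R h) > 0" using e(2) by blast
    then show ?thesis using that[of a "e/2"] a e(1) by (simp add: CQ)
  qed
  have iter_add: "deriv_iter f n p (a + \<eta> *\<^sub>R h) = deriv_iter f n p a + \<eta> *\<^sub>R deriv_iter f n p h" for n
    by (induction n) (simp_all add: linear_add[OF lin] linear_cmul[OF lin])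
  have iter_C: "deriv_iter f n p b \<in> C ((f ^^ n) p)" if "b \<in> C p" for n b
    by (induction n) (simp_all add: that cinv)
  have iter_E: "deriv_iter f n p h \<in> E ((f ^^ n) p)" for n
  proof (induction n)
    case (Suc n)
    then show ?case using inv[of "(f ^^ n) p"] by auto
  qed (simp add: h)
  have iter_cross: "cross2 (deriv_iter f n p a) (deriv_iter f n p h) = (\<Prod>i<n. d ((f ^^ i) p)) * cross2 a h" for n
    by (induction n) (simp_all add: jac)
  \<comment> \<open>This is the constant obtained by taking square roots in the bound for segments.\<close>
  define K where "K = 2 * sqrt D * \<bar>cross2 a h\<bar> / (m * \<eta>)"
  have "(norm (deriv_iter f n p h))\<^sup>2 \<le> K * (\<Prod>i<n. \<bar>d ((f ^^ i) p)\<bar>)" for n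
  proof -
    define x where "x = (norm (deriv_iter f n p h))\<^sup>2"
    define P where "P = (\<Prod>i<n. \<bar>d ((f ^^ i) p)\<bar>)"
    have P: "P = \<bar>\<Prod>i<n. d ((f ^^ i) p)\<bar>" by (simp add: P_def abs_prod)
    have "(m * x * \<eta>)\<^sup>2 \<le> 4 * \<bar>det (Q ((f ^^ n) p))\<bar> * (cross2 (deriv_iter f n p a) (deriv_iter f n p h))\<^sup>2"
    proof (rule quad_form_segment_bound[OF sym])
      show "quad_form (Q ((f ^^ n) p)) (deriv_iter f n p h) \<le> - (m * x)"
        using m(2)[OF iter_E[of n]] by (simp add: x_def)
      show "0 \<le> m * x" using m(1) by (simp add: x_def)
      show "0 \<le> quad_form (Q ((f ^^ n) p)) (deriv_iter f n p a)"
        using iter_C[OF a(1), of n] by (simp add: CQ)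
      show "0 \<le> quad_form (Q ((f ^^ n) p)) (deriv_iter f n p a + \<eta> *\<^sub>R deriv_iter f n p h)"
        using iter_C[OF a(2), of n] unfolding iter_add by (simp add: CQ)
    qed
    also have "\<dots> \<le> 4 * D * (cross2 (deriv_iter f n p a) (deriv_iter f n p h))\<^sup>2"
      using p0 by (intro mult_right_mono mult_left_mono) (auto simp: D_def)
    also have "\<dots> = (2 * sqrt D * P * \<bar>cross2 a h\<bar>)\<^sup>2"
      by (simp add: iter_cross power_mult_distrib P D_def)
    finally have "m * x * \<eta> \<le> 2 * sqrt D * P * \<bar>cross2 a h\<bar>"
      by (rule power2_le_imp_le) (simp add: P D_def)
    then show ?thesis using m(1) a(3) by (simp add: K_def x_def P_def field_simps)
  qed
  then show ?thesis by blast
qed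

section \<open>Cones and the centre direction of a skew product\<close>

context unimodular_basis
begin

lemma cross2_coords: "cross2 a b = xc a * yc b - yc a * xc b"
proof -
  have "xc a * yc b - yc a * xc b =
      cross2 a b * (of_int (v $ 1) * of_int (w $ 2) - of_int (v $ 2) * of_int (w $ 1))"
    by (simp add: cross2_def xc_def yc_def algebra_simps)
  then show ?thesis by (simp add: unimodular_real)
qed

text \<open>The Gram matrix, in the standard basis, of the form \<open>(T x - y)\<^sup>2 - (\<rho> x)\<^sup>2\<close> in the coordinates of
  \<open>v, w\<close>. The rows \<open>a\<close> and \<open>b\<close> are the coefficients of the coordinates \<open>xc\<close> and \<open>yc\<close>.\<close>

definition cone_matrix :: "real \<Rightarrow> real \<Rightarrow> real^2^2" where
  "cone_matrix \<rho> T = (\<chi> i j.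
     (let a = \<lambda>i::2. if i = 1 then of_int (w $ 2) else - of_int (w $ 1);
          b = \<lambda>i::2. if i = 1 then - of_int (v $ 2) else of_int (v $ 1)
      in (T * a i - b i) * (T * a j - b j) - \<rho>\<^sup>2 * a i * a j))"

lemma two_neq_one [simp]: "(2::2) \<noteq> 1" "(1::2) \<noteq> 2"
  by auto

lemma transpose_cone_matrix: "transpose (cone_matrix \<rho> T) = cone_matrix \<rho> T"
  by (simp add: transpose_def cone_matrix_def vec_eq_iff Let_def algebra_simps)

lemma cone_matrix_nth:
  "cone_matrix \<rho> T $ 1 $ 1 = (T * of_int (w $ 2) + of_int (v $ 2))\<^sup>2 - (\<rho> * of_int (w $ 2))\<^sup>2"
  "cone_matrix \<rho> T $ 1 $ 2 = - (T * of_int (w $ 2) + of_int (v $ 2)) * (T * of_int (w $ 1) + of_int (v $ 1))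
     + \<rho>\<^sup>2 * of_int (w $ 2) * of_int (w $ 1)"
  "cone_matrix \<rho> T $ 2 $ 1 = - (T * of_int (w $ 2) + of_int (v $ 2)) * (T * of_int (w $ 1) + of_int (v $ 1))
     + \<rho>\<^sup>2 * of_int (w $ 2) * of_int (w $ 1)"
  "cone_matrix \<rho> T $ 2 $ 2 = (T * of_int (w $ 1) + of_int (v $ 1))\<^sup>2 - (\<rho> * of_int (w $ 1))\<^sup>2"
  unfolding cone_matrix_def Let_def by (simp_all add: power2_eq_square) algebra+

lemma quad_form_cone_matrix: "quad_form (cone_matrix \<rho> T) h = (T * xc h - yc h)\<^sup>2 - (\<rho> * xc h)\<^sup>2"
  unfolding quad_form_eq[OF transpose_cone_matrix] cone_matrix_nth xc_def yc_def by algebra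

lemma det_cone_matrix: "det (cone_matrix \<rho> T) = - (\<rho>\<^sup>2)"
proof -
  have "det (cone_matrix \<rho> T) =
      - (\<rho>\<^sup>2) * (of_int (v $ 1) * of_int (w $ 2) - of_int (v $ 2) * of_int (w $ 1))\<^sup>2"
    unfolding det_2 cone_matrix_nth by algebra
  then show ?thesis by (simp add: unimodular_real)
qed

lemma nondegenerate_cone_matrix:
  assumes "\<rho> > 0" shows "nondegenerate_indefinite (cone_matrix \<rho> T)"
proof -
  have "quad_form (cone_matrix \<rho> T) (pt 0 1) > 0" "quad_form (cone_matrix \<rho> T) (pt 1 T) < 0"
    using assms by (simp_all add: quad_form_cone_matrix)
  then show ?thesis
    using assms unfolding nondegenerate_indefinite_def
    by (auto simp: transpose_cone_matrix invertible_det_nz det_cone_matrix)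
qed

lemma continuous_on_cone_matrix:
  assumes "continuous_on S T" shows "continuous_on S (\<lambda>p. cone_matrix \<rho> (T p))"
  unfolding cone_matrix_def Let_def by (intro continuous_intros assms)

end

context skew_product
begin

lemma yc_F [simp]: "yc (F z) = g (yc z)"
  by (simp add: F_def)

lemma linear_DF: "linear (DF z)"
  by (intro linearI coords_eqI) (simp_all add: DF_def algebra_simps)

lemma torus_deriv_f_rep: "torus_deriv f p = DF (rep_torus p)"
  using torus_deriv_f[of "rep_torus p"] by simp

primrec DFn :: "nat \<Rightarrow> real^2 \<Rightarrow> real^2 \<Rightarrow> real^2" where
  "DFn 0 z h = h"
| "DFn (Suc n) z h = DF ((F ^^ n) z) (DFn n z h)"

lemma funpow_f_proj: "(f ^^ n) (proj z) = proj ((F ^^ n) z)"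
  by (induction n) (simp_all add: f_proj)

lemma deriv_iter_f: "deriv_iter f n (proj z) h = DFn n z h"
  by (induction n) (simp_all add: funpow_f_proj torus_deriv_f)

lemma torus_deriv_funpow: "torus_deriv (f ^^ n) (proj z) = DFn n z"
proof (rule torus_deriv_eq, rule has_torus_derivative_lift[of "f ^^ n" "F ^^ n", OF funpow_f_proj])
  show "((F ^^ n) has_derivative DFn n z) (at z)"
  proof (induction n)
    case 0
    then show ?case by (simp add: id_def has_derivative_ident)
  next
    case (Suc n)
    show ?case using has_derivative_compose[OF Suc F_has_derivative] by (simp add: o_def)
  qed
qed

lemma yc_funpow_F: "yc ((F ^^ n) z) = (g ^^ n) (yc z)"
  by (induction n) simp_all

text \<open>Where the slope field \<open>\<tau>\<close> is invariant, its annihilating form \<open>\<tau> dx - dy\<close> is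
  multiplied by a factor whose square beats the Jacobian, so that no centre direction can contain
  a vector on which the form does not vanish.\<close>

lemma centre_in_invariant_slopes:
  assumes E: "centre_direction f E"
    and Z: "\<And>y. y \<in> Z \<Longrightarrow> g y \<in> Z" and bnd: "\<And>y. y \<in> Z \<Longrightarrow> \<bar>\<tau> y\<bar> \<le> 1"
    and inv: "\<And>y. y \<in> Z \<Longrightarrow> lam * \<tau> (g y) = \<tau> y * (\<gamma> y - \<psi> y * \<tau> (g y))"
    and dom: "\<And>y. y \<in> Z \<Longrightarrow> lam * \<bar>\<gamma> y\<bar> \<le> 3/4 * (\<gamma> y - \<psi> y * \<tau> (g y))\<^sup>2"
    and z: "yc z \<in> Z" and h: "h \<in> E (proj z)"
  shows "yc h = \<tau> (yc z) * xc h"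
proof -
  define Y where "Y n = (g ^^ n) (yc z)" for n
  have Y: "Y n \<in> Z" for n by (induction n) (simp_all add: Y_def z Z)
  define \<omega> where "\<omega> n = \<tau> (Y n) * xc (DFn n z h) - yc (DFn n z h)" for n
  define \<Lambda> where "\<Lambda> n = \<gamma> (Y n) - \<psi> (Y n) * \<tau> (Y (Suc n))" for n
  define J where "J p = lam * \<gamma> (yc (rep_torus p))" for p
  have J_proj: "J (proj z) = lam * \<gamma> (yc z)" for z
  proof -
    have "lattice_rel (rep_torus (proj z)) z" by (simp flip: proj_eq_iff)
    then show ?thesis using periodic_lattice[of \<gamma>, OF \<gamma>_periodic] by (simp add: J_def)
  qed
  have "cross2 (torus_deriv f p a) (torus_deriv f p b) = J p * cross2 a b" for p a b
    by (simp add: torus_deriv_f_rep cross2_coords DF_def J_def algebra_simps)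
  then obtain K where "\<And>n. (norm (DFn n z h))\<^sup>2 \<le> K * (\<Prod>i<n. \<bar>J ((f ^^ i) (proj z))\<bar>)"
    using centre_vectors_dominated[OF E _ _ h, of J] linear_DF
    by (auto simp: torus_deriv_f_rep deriv_iter_f)
  then have K: "(norm (DFn n z h))\<^sup>2 \<le> K * (\<Prod>i<n. lam * \<bar>\<gamma> (Y i)\<bar>)" for n
    using lam(1) by (simp add: funpow_f_proj J_proj yc_funpow_F Y_def abs_mult)
  have \<omega>_Suc: "\<omega> (Suc n) = \<Lambda> n * \<omega> n" for n
  proof -
    have "\<omega> (Suc n) = \<tau> (Y (Suc n)) * (lam * xc (DFn n z h) + \<psi> (Y n) * yc (DFn n z h))
        - \<gamma> (Y n) * yc (DFn n z h)"
      by (simp add: \<omega>_def DF_def yc_funpow_F Y_def)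
    also have "\<dots> = (lam * \<tau> (Y (Suc n))) * xc (DFn n z h)
        - (\<gamma> (Y n) - \<psi> (Y n) * \<tau> (Y (Suc n))) * yc (DFn n z h)"
      by (simp add: algebra_simps)
    also have "lam * \<tau> (Y (Suc n)) = \<tau> (Y n) * \<Lambda> n"
      using inv[OF Y[of n]] by (simp add: Y_def \<Lambda>_def)
    finally show ?thesis by (simp add: \<omega>_def \<Lambda>_def algebra_simps)
  qed
  define P where "P n = (\<Prod>i<n. lam * \<bar>\<gamma> (Y i)\<bar>)" for n
  define G where "G n = (\<Prod>i<n. (\<Lambda> i)\<^sup>2)" for n
  have \<omega>_eq: "(\<omega> n)\<^sup>2 = G n * (\<omega> 0)\<^sup>2" for n
    by (induction n) (simp_all add: \<omega>_Suc G_def power_mult_distrib)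
  have P_pos: "P n > 0" for n
    using lam(1) \<gamma>_nz by (auto simp: P_def intro!: prod_pos)
  have PG: "P n \<le> (3/4) ^ n * G n" for n
  proof -
    have "P n \<le> (\<Prod>i<n. 3/4 * (\<Lambda> i)\<^sup>2)"
      unfolding P_def using dom[OF Y] lam(1) by (intro prod_mono) (auto simp: \<Lambda>_def Y_def)
    then show ?thesis by (simp only: G_def prod.distrib prod_constant card_lessThan)
  qed
  have G_pos: "G n > 0" for n
  proof (rule ccontr)
    assume "\<not> G n > 0"
    then have "(3/4) ^ n * G n \<le> 0" by (simp add: mult_nonneg_nonpos)
    with P_pos[of n] PG[of n] show False by linarith
  qed
  obtain B where B: "B > 0" "\<And>z. \<bar>xc z\<bar> \<le> B * norm z" "\<And>z. \<bar>yc z\<bar> \<le> B * norm z"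
    using coord_bounds by metis
  have "(\<omega> 0)\<^sup>2 \<le> (4 * B\<^sup>2 * \<bar>K\<bar>) * (3/4) ^ n" for n
  proof -
    have "\<bar>\<omega> n\<bar> \<le> \<bar>\<tau> (Y n)\<bar> * \<bar>xc (DFn n z h)\<bar> + \<bar>yc (DFn n z h)\<bar>"
      unfolding \<omega>_def by (metis abs_mult abs_triangle_ineq4)
    also have "\<dots> \<le> 1 * (B * norm (DFn n z h)) + B * norm (DFn n z h)"
      using bnd[OF Y[of n]] B by (intro add_mono mult_mono) auto
    finally have "\<bar>\<omega> n\<bar> \<le> 2 * B * norm (DFn n z h)" by simp
    then have "(\<omega> n)\<^sup>2 \<le> (2 * B * norm (DFn n z h))\<^sup>2"
      by (metis abs_ge_zero power2_abs power_mono)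
    also have "\<dots> \<le> 4 * B\<^sup>2 * (K * P n)"
      using K[of n] by (simp add: power_mult_distrib P_def mult_left_mono)
    also have "\<dots> \<le> 4 * B\<^sup>2 * (\<bar>K\<bar> * ((3/4) ^ n * G n))"
      using PG[of n] P_pos[of n] by (intro mult_left_mono mult_mono) auto
    finally have "G n * (\<omega> 0)\<^sup>2 \<le> G n * ((4 * B\<^sup>2 * \<bar>K\<bar>) * (3/4) ^ n)"
      unfolding \<omega>_eq[of n] by (simp add: mult_ac)
    then show ?thesis using G_pos[of n] by (simp only: mult_le_cancel_left_pos)
  qed
  moreover have "(\<lambda>n. (4 * B\<^sup>2 * \<bar>K\<bar>) * (3/4) ^ n) \<longlonglongrightarrow> (4 * B\<^sup>2 * \<bar>K\<bar>) * 0"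
    by (intro tendsto_intros LIMSEQ_realpow_zero) auto
  ultimately have "(\<omega> 0)\<^sup>2 \<le> (4 * B\<^sup>2 * \<bar>K\<bar>) * 0"
    by (intro LIMSEQ_le_const) auto
  then show ?thesis by (simp add: \<omega>_def Y_def)
qed

end

text \<open>The assumption \<open>step\<close> is cone invariance and expansion in coordinates: \<open>\<tau> a - b\<close> is the form that
  vanishes on the slope \<open>\<tau>\<close>, and \<open>(lam a + \<psi> b, \<gamma> b)\<close> is the image of the vector \<open>(a, b)\<close>. Closed cones
  are mapped into open ones and the form grows by the factor \<open>G\<close>.\<close>

locale skew_cone = skew_product +
  fixes \<tau> :: "real \<Rightarrow> real" and \<rho> G :: real
  assumes \<tau>_cont: "continuous_on UNIV \<tau>" and \<tau>_periodic: "\<And>y. \<tau> (y + 1) = \<tau> y"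
    and \<rho>: "\<rho> > 0" and G: "G > 1"
    and step: "\<And>y a b. \<rho> * \<bar>a\<bar> \<le> \<bar>\<tau> y * a - b\<bar> \<Longrightarrow> \<tau> y * a - b \<noteq> 0 \<Longrightarrow>
        \<rho> * \<bar>lam * a + \<psi> y * b\<bar> < \<bar>\<tau> (g y) * (lam * a + \<psi> y * b) - \<gamma> y * b\<bar> \<and>
        G * \<bar>\<tau> y * a - b\<bar> \<le> \<bar>\<tau> (g y) * (lam * a + \<psi> y * b) - \<gamma> y * b\<bar>"
begin

definition \<omega> :: "real^2 \<Rightarrow> real^2 \<Rightarrow> real" where
  "\<omega> z h = \<tau> (yc z) * xc h - yc h"

definition C :: "torus \<Rightarrow> (real^2) set" where
  "C p = {h. quad_form (cone_matrix \<rho> (\<tau> (yc (rep_torus p)))) h \<ge> 0}"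

lemma \<tau>_rep: "\<tau> (yc (rep_torus (proj z))) = \<tau> (yc z)"
proof -
  have "lattice_rel (rep_torus (proj z)) z" by (simp flip: proj_eq_iff)
  then show ?thesis using periodic_lattice[of \<tau>, OF \<tau>_periodic] by simp
qed

lemma C_proj: "h \<in> C (proj z) \<longleftrightarrow> \<rho> * \<bar>xc h\<bar> \<le> \<bar>\<omega> z h\<bar>"
proof -
  have "h \<in> C (proj z) \<longleftrightarrow> (\<rho> * xc h)\<^sup>2 \<le> (\<omega> z h)\<^sup>2"
    by (simp add: C_def \<tau>_rep quad_form_cone_matrix \<omega>_def)
  also have "\<dots> \<longleftrightarrow> \<rho> * \<bar>xc h\<bar> \<le> \<bar>\<omega> z h\<bar>"
    using \<rho> by (simp add: abs_le_square_iff[symmetric] abs_mult)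
  finally show ?thesis .
qed

lemma interior_C: "\<rho> * \<bar>xc h\<bar> < \<bar>\<omega> z h\<bar> \<Longrightarrow> h \<in> interior (C (proj z))"
proof -
  assume *: "\<rho> * \<bar>xc h\<bar> < \<bar>\<omega> z h\<bar>"
  have "open {h. \<rho> * \<bar>xc h\<bar> < \<bar>\<omega> z h\<bar>}"
    unfolding \<omega>_def by (intro open_Collect_less continuous_intros)
  then show ?thesis by (rule interiorI) (use * in \<open>auto simp: C_proj\<close>)
qed

lemma cone_family_C: "cone_family C"
  unfolding cone_family_def
proof (intro exI conjI allI)
  have "continuous_on UNIV (\<lambda>z. \<tau> (yc z))"
    by (rule continuous_on_compose2[OF \<tau>_cont]) (auto intro: continuous_on_yc continuous_on_id)
  then show "continuous_on UNIV (\<lambda>p. cone_matrix \<rho> (\<tau> (yc (rep_torus p))))"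
    by (intro continuous_on_torusI) (simp add: \<tau>_rep continuous_on_cone_matrix)
qed (auto simp: nondegenerate_cone_matrix \<rho> C_def)

lemma \<omega>_nonzero: "h \<in> C (proj z) \<Longrightarrow> h \<noteq> 0 \<Longrightarrow> \<omega> z h \<noteq> 0"
proof
  assume *: "h \<in> C (proj z)" "h \<noteq> 0" "\<omega> z h = 0"
  then have "xc h = 0" using \<rho> by (simp add: C_proj mult_le_0_iff)
  with * show False by (metis \<omega>_def coords_eqI diff_0 mult_zero_right neg_equal_0_iff_equal xc_linear(4) yc_linear(4))
qed

lemma step_\<omega>:
  assumes "h \<in> C (proj z)" "h \<noteq> 0"
  shows "\<rho> * \<bar>xc (DF z h)\<bar> < \<bar>\<omega> (F z) (DF z h)\<bar>" "G * \<bar>\<omega> z h\<bar> \<le> \<bar>\<omega> (F z) (DF z h)\<bar>"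
  using step[of "xc h" "yc z" "yc h"] assms(1) \<omega>_nonzero[OF assms]
  by (simp_all add: C_proj \<omega>_def DF_def)

text \<open>On the cones the form \<open>\<omega>\<close> is comparable with the norm, so the uniform growth of \<open>\<omega>\<close> in each
  step becomes growth of the norm after enough steps to beat the constants of comparison.\<close>

lemma unstable_cone_family_C: "unstable_cone_family f C"
  unfolding unstable_cone_family_def
proof (intro conjI cone_family_C)
  show "cone_invariant f C"
    unfolding cone_invariant_def
  proof (intro allI subsetI)
    fix p k assume k: "k \<in> torus_deriv f p ` C p - {0}"
    define z where "z = rep_torus p"
    have p: "p = proj z" by (simp add: z_def)
    obtain h where h: "h \<in> C (proj z)" "k = DF z h" "h \<noteq> 0"
      using k linear_0[OF linear_DF, of z] by (auto simp: p torus_deriv_f)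
    then show "k \<in> interior (C (f p))"
      using step_\<omega>(1)[OF h(1,3)] by (simp add: p f_proj interior_C)
  qed
  obtain B where B: "B > 0" "\<And>z. \<bar>xc z\<bar> \<le> B * norm z" "\<And>z. \<bar>yc z\<bar> \<le> B * norm z"
      "\<And>z. norm z \<le> B * (\<bar>xc z\<bar> + \<bar>yc z\<bar>)"
    using coord_bounds by metis
  obtain T where T: "T \<ge> 0" "\<And>y. \<bar>\<tau> y\<bar> \<le> T"
  proof -
    have "compact (\<tau> ` {0..1})"
      by (intro compact_continuous_image continuous_on_subset[OF \<tau>_cont]) auto
    then obtain T where T: "\<And>y. y \<in> {0..1} \<Longrightarrow> \<bar>\<tau> y\<bar> \<le> T"
      by (metis compact_imp_bounded bounded_iff imageI real_norm_def)
    have "\<bar>\<tau> y\<bar> \<le> T" for y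
    proof -
      have "\<tau> (frac y) = \<tau> y"
        using shift_periodic_int[of \<tau> 0 y "- \<lfloor>y\<rfloor>"] \<tau>_periodic by (simp add: frac_def)
      moreover have "frac y \<in> {0..1}" using frac_lt_1[of y] by simp
      ultimately show ?thesis using T by metis
    qed
    moreover from this[of 0] have "T \<ge> 0" by linarith
    ultimately show ?thesis using that by blast
  qed
  have iter: "DFn n z h \<in> C (proj ((F ^^ n) z)) \<and> G ^ n * \<bar>\<omega> z h\<bar> \<le> \<bar>\<omega> ((F ^^ n) z) (DFn n z h)\<bar>
      \<and> DFn n z h \<noteq> 0"
    if h: "h \<in> C (proj z)" "h \<noteq> 0" for n z h
  proof (induction n)
    case (Suc n)
    define k where "k = DFn n z h"
    define y where "y = (F ^^ n) z"
    have k: "k \<in> C (proj y)" "G ^ n * \<bar>\<omega> z h\<bar> \<le> \<bar>\<omega> y k\<bar>" "k \<noteq> 0"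
      using Suc by (auto simp: k_def y_def)
    note s = step_\<omega>[OF k(1,3)]
    have "G ^ Suc n * \<bar>\<omega> z h\<bar> \<le> G * \<bar>\<omega> y k\<bar>" using k(2) G by simp
    also note s(2)
    finally have "G ^ Suc n * \<bar>\<omega> z h\<bar> \<le> \<bar>\<omega> (F y) (DF y k)\<bar>" .
    moreover have "DF y k \<in> C (proj (F y))" using s(1) by (simp add: C_proj)
    moreover have "DF y k \<noteq> 0"
      using s(1) \<rho> by (auto simp: \<omega>_def)
    ultimately show ?case by (simp add: k_def y_def)
  qed (simp add: h)
  \<comment> \<open>The product of the two constants that compare \<open>\<omega>\<close> with the norm on the cones.\<close>
  define K where "K = B * (T + 1) * (B * (1 / \<rho> * (T + 1) + 1))"
  obtain n where n: "K < G ^ n" using real_arch_pow[OF G] by blast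
  have K: "K \<ge> 0" using B(1) T(1) \<rho> by (simp add: K_def)
  define k where "k = Suc n"
  have k: "k > 0" "K < G ^ k"
    using n G by (auto simp: k_def intro: less_le_trans[OF n] power_increasing)
  have "norm (torus_deriv (f ^^ k) p h) > 1" if h: "h \<in> C p" "norm h = 1" for p h
  proof -
    define z where "z = rep_torus p"
    have p: "p = proj z" by (simp add: z_def)
    have nz: "h \<noteq> 0" using h by auto
    define k' where "k' = DFn k z h"
    have "\<bar>\<omega> y a\<bar> \<le> B * (T + 1) * norm a" for y a
    proof -
      have "\<bar>\<omega> y a\<bar> \<le> \<bar>\<tau> (yc y)\<bar> * \<bar>xc a\<bar> + \<bar>yc a\<bar>"
        unfolding \<omega>_def by (metis abs_mult abs_triangle_ineq4)
      also have "\<dots> \<le> T * (B * norm a) + B * norm a"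
        using T B by (intro add_mono mult_mono) auto
      finally show ?thesis by (simp add: algebra_simps)
    qed
    then have "G ^ k * \<bar>\<omega> z h\<bar> \<le> B * (T + 1) * norm k'"
      using iter[OF h(1)[unfolded p] nz, of k] unfolding k'_def by (meson order_trans)
    moreover have "1 \<le> B * (1 / \<rho> * (T + 1) + 1) * \<bar>\<omega> z h\<bar>"
    proof -
      have x: "\<bar>xc h\<bar> \<le> 1 / \<rho> * \<bar>\<omega> z h\<bar>"
        using h(1) \<rho> unfolding p C_proj by (simp add: field_simps)
      have "\<bar>yc h\<bar> = \<bar>\<tau> (yc z) * xc h - \<omega> z h\<bar>" by (simp add: \<omega>_def)
      also have "\<dots> \<le> \<bar>\<tau> (yc z)\<bar> * \<bar>xc h\<bar> + \<bar>\<omega> z h\<bar>" by (metis abs_mult abs_triangle_ineq4)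
      also have "\<dots> \<le> T * (1 / \<rho> * \<bar>\<omega> z h\<bar>) + \<bar>\<omega> z h\<bar>"
        using T x by (intro add_mono mult_mono) auto
      finally have "\<bar>xc h\<bar> + \<bar>yc h\<bar> \<le> (1 / \<rho> * (T + 1) + 1) * \<bar>\<omega> z h\<bar>"
        using x \<rho> by (simp add: field_simps)
      then have "B * (\<bar>xc h\<bar> + \<bar>yc h\<bar>) \<le> B * ((1 / \<rho> * (T + 1) + 1) * \<bar>\<omega> z h\<bar>)"
        using B(1) by simp
      then show ?thesis using B(4)[of h] h(2) by simp
    qed
    ultimately have "G ^ k * 1 \<le> G ^ k * (B * (1 / \<rho> * (T + 1) + 1) * \<bar>\<omega> z h\<bar>)"
      using G by (intro mult_left_mono) auto
    also have "\<dots> = (B * (1 / \<rho> * (T + 1) + 1)) * (G ^ k * \<bar>\<omega> z h\<bar>)" by simp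
    also have "\<dots> \<le> (B * (1 / \<rho> * (T + 1) + 1)) * (B * (T + 1) * norm k')"
      using \<open>G ^ k * \<bar>\<omega> z h\<bar> \<le> B * (T + 1) * norm k'\<close> B(1) T(1) \<rho> by (intro mult_left_mono) auto
    also have "\<dots> = K * norm k'" by (simp add: K_def)
    finally have "G ^ k \<le> K * norm k'" by simp
    with k(2) have "K < K * norm k'" by linarith
    then have "norm k' > 1" using K
      by (metis less_irrefl mult.right_neutral mult_left_mono not_le)
    then show ?thesis by (simp add: p torus_deriv_funpow k'_def)
  qed
  with k(1) show "\<exists>k>0. \<forall>p. \<forall>v\<in>C p. norm v = 1 \<longrightarrow> 1 < norm (torus_deriv (f ^^ k) p v)" by blast
qed

lemma partially_hyperbolic_f: "partially_hyperbolic f"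
  unfolding partially_hyperbolic_def using C1_local_diffeo_f unstable_cone_family_C by blast

end

section \<open>Leaves of foliations\<close>

lemma leaf_unique:
  assumes "foliation F" "L \<in> F" "L' \<in> F" "p \<in> L" "p \<in> L'" shows "L = L'"
  using assms unfolding foliation_def partition_on_def disjoint_def by blast

lemma obtain_leaf:
  assumes "foliation F" obtains L where "L \<in> F" "p \<in> L"
proof -
  have "\<Union>F = UNIV" using assms unfolding foliation_def partition_on_def by blast
  then show ?thesis using that by blast
qed

text \<open>The components of the trace of a leaf in a chart are plaques, so a connected piece of the leaf inside
  the chart lies in a single plaque. This is the form in which charts are used below.\<close>

lemma foliation_chart:
  assumes "foliation F"
  obtains U \<phi> \<psi> where "open U" "p \<in> U"
    "homeomorphism U ({0<..<1::real} \<times> {0<..<1::real}) \<phi> \<psi>"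
    "\<And>S L. L \<in> F \<Longrightarrow> S \<subseteq> L \<inter> U \<Longrightarrow> connected S \<Longrightarrow> S \<noteq> {} \<Longrightarrow>
       \<exists>q\<in>{0<..<1}. S \<subseteq> \<psi> ` ({0<..<1} \<times> {q}) \<and> \<psi> ` ({0<..<1} \<times> {q}) \<subseteq> L"
proof -
  have "\<exists>U \<phi> \<psi>. open U \<and> p \<in> U \<and>
        homeomorphism U ({0<..<1::real} \<times> {0<..<1::real}) \<phi> \<psi> \<and>
        (\<forall>L\<in>F. \<forall>K \<in> components (L \<inter> U). \<exists>c\<in>{0<..<1}. K = \<psi> ` ({0<..<1} \<times> {c}))"
    using assms unfolding foliation_def by (elim conjE) (erule spec)
  then obtain U \<phi> \<psi> where U: "open U" "p \<in> U"
      "homeomorphism U ({0<..<1::real} \<times> {0<..<1::real}) \<phi> \<psi>"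
    and K: "\<forall>L\<in>F. \<forall>K \<in> components (L \<inter> U). \<exists>c\<in>{0<..<1}. K = \<psi> ` ({0<..<1} \<times> {c})"
    by (elim exE conjE)
  show ?thesis
  proof (rule that[OF U])
    fix S L assume S: "L \<in> F" "S \<subseteq> L \<inter> U" "connected S" "S \<noteq> {}"
    then obtain K' where K': "K' \<in> components (L \<inter> U)" "S \<subseteq> K'"
      using exists_component_superset[of S "L \<inter> U"] by blast
    with K S(1) obtain q where "q \<in> {0<..<1}" "K' = \<psi> ` ({0<..<1} \<times> {q})" by blast
    moreover have "K' \<subseteq> L" using in_components_subset[OF K'(1)] by blast
    ultimately show "\<exists>q\<in>{0<..<1}. S \<subseteq> \<psi> ` ({0<..<1} \<times> {q}) \<and> \<psi> ` ({0<..<1} \<times> {q}) \<subseteq> L"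
      using K'(2) by blast
  qed
qed

text \<open>Near its end the path runs in one plaque, along which the transverse coordinate of the chart is
  constant, and this persists in the limit.\<close>

lemma leaf_contains_path_endpoint:
  fixes c :: "real \<Rightarrow> torus"
  assumes F: "foliation F" "L \<in> F" and e: "e > 0" and c: "continuous_on {0..e} c"
    and cL: "\<And>t. 0 < t \<Longrightarrow> t \<le> e \<Longrightarrow> c t \<in> L"
  shows "c 0 \<in> L"
proof -
  obtain U \<phi> \<psi> where U: "open U" "c 0 \<in> U"
    and hom: "homeomorphism U ({0<..<1::real} \<times> {0<..<1::real}) \<phi> \<psi>"
    and plaque: "\<And>S L. L \<in> F \<Longrightarrow> S \<subseteq> L \<inter> U \<Longrightarrow> connected S \<Longrightarrow> S \<noteq> {} \<Longrightarrow>
       \<exists>q\<in>{0<..<1}. S \<subseteq> \<psi> ` ({0<..<1} \<times> {q}) \<and> \<psi> ` ({0<..<1} \<times> {q}) \<subseteq> L"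
    using foliation_chart[OF F(1), of "c 0"] by metis
  obtain A where A: "open A" "A \<inter> {0..e} = c -` U \<inter> {0..e}"
    using c U(1) unfolding continuous_on_open_invariant by blast
  have "0 \<in> c -` U \<inter> {0..e}" using U(2) e by simp
  then have "0 \<in> A" unfolding A(2)[symmetric] by simp
  then obtain d0 where d0: "d0 > 0" "ball 0 d0 \<subseteq> A" using A(1) openE by blast
  define d where "d = min e (d0 / 2)"
  have d: "d > 0" "d \<le> e" using e d0(1) by (auto simp: d_def)
  have cU: "c t \<in> U" if "t \<in> {0..d}" for t
  proof -
    have "t \<in> ball 0 d0" using that d0(1) by (auto simp: d_def)
    then have "t \<in> A \<inter> {0..e}" using d0(2) that d(2) by auto
    then show ?thesis unfolding A(2) by simp
  qed
  have cont: "continuous_on {0..d} c" by (rule continuous_on_subset[OF c]) (use d in auto)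
  have "connected (c ` {0<..d})"
    by (rule connected_continuous_image[OF continuous_on_subset[OF cont]]) auto
  moreover have "c ` {0<..d} \<subseteq> L \<inter> U" using cL cU d by auto
  moreover have "c ` {0<..d} \<noteq> {}" using d by simp
  ultimately obtain q where q: "q \<in> {0<..<1}" "c ` {0<..d} \<subseteq> \<psi> ` ({0<..<1} \<times> {q})"
    "\<psi> ` ({0<..<1} \<times> {q}) \<subseteq> L"
    using plaque[OF F(2)] by metis
  have "snd (\<phi> (c t)) = q" if "t \<in> {0<..d}" for t
  proof -
    have "c t \<in> \<psi> ` ({0<..<1} \<times> {q})" using subsetD[OF q(2) imageI[OF that]] .
    then obtain s where "s \<in> {0<..<1}" "c t = \<psi> (s, q)" by (elim imageE SigmaE) simp
    then show ?thesis using homeomorphism_apply2[OF hom, of "(s, q)"] q(1) by simp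
  qed
  moreover have "continuous_on {0..d} (\<lambda>t. snd (\<phi> (c t)))"
    by (intro continuous_on_snd continuous_on_compose2[OF homeomorphism_cont1[OF hom] cont])
      (use cU in auto)
  ultimately have "snd (\<phi> (c 0)) = q"
    using continuous_constant_on_closure[of "{0<..d}" "\<lambda>t. snd (\<phi> (c t))" q 0] d(1) by simp
  moreover have "\<phi> (c 0) \<in> {0<..<1} \<times> {0<..<1}"
    unfolding homeomorphism_image1[OF hom, symmetric] by (rule imageI[OF U(2)])
  ultimately have "\<phi> (c 0) \<in> {0<..<1} \<times> {q}" by (auto simp: mem_Times_iff)
  then have "\<psi> (\<phi> (c 0)) \<in> L" using subsetD[OF q(3) imageI] by simp
  then show ?thesis using homeomorphism_apply1[OF hom U(2)] by simp
qed

text \<open>An open subset of the leaf would contain a short vertical segment of some chart. Being connected,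
  this segment would lie in a single horizontal plaque.\<close>

lemma leaf_has_empty_interior:
  assumes F: "foliation F" "L \<in> F" and V: "open V" "p \<in> V" "V \<subseteq> L"
  shows False
proof -
  obtain U \<phi> \<psi> where U: "open U" "p \<in> U"
    and hom: "homeomorphism U ({0<..<1::real} \<times> {0<..<1::real}) \<phi> \<psi>"
    and plaque: "\<And>S L. L \<in> F \<Longrightarrow> S \<subseteq> L \<inter> U \<Longrightarrow> connected S \<Longrightarrow> S \<noteq> {} \<Longrightarrow>
       \<exists>q\<in>{0<..<1}. S \<subseteq> \<psi> ` ({0<..<1} \<times> {q}) \<and> \<psi> ` ({0<..<1} \<times> {q}) \<subseteq> L"
    using foliation_chart[OF F(1), of p] by metis
  let ?Q = "{0<..<1::real} \<times> {0<..<1::real}"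
  have "open ?Q" by (intro open_Times open_greaterThanLessThan)
  then have op: "open (\<psi> -` V \<inter> ?Q)"
    using homeomorphism_cont2[OF hom] V(1) by (simp add: continuous_on_open_vimage)
  have mem: "\<phi> p \<in> \<psi> -` V \<inter> ?Q"
    using imageI[OF U(2), of \<phi>] homeomorphism_image1[OF hom] homeomorphism_apply1[OF hom U(2)] V(2)
    by simp
  obtain e where e: "e > 0" "ball (\<phi> p) e \<subseteq> \<psi> -` V \<inter> ?Q"
    by (rule openE[OF op mem])
  define s q where "s = fst (\<phi> p)" and "q = snd (\<phi> p)"
  define I where "I = (\<lambda>t. (s, t)) ` {q..q + e/2}"
  have "I \<subseteq> ball (\<phi> p) e"
    using e(1) by (auto simp: I_def s_def q_def dist_prod_def dist_real_def)
  then have I: "I \<subseteq> \<psi> -` V \<inter> ?Q" using e(2) by (rule order_trans)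
  have "connected I" unfolding I_def by (intro connected_continuous_image continuous_intros) auto
  then have "connected (\<psi> ` I)"
    by (rule connected_continuous_image[OF continuous_on_subset[OF homeomorphism_cont2[OF hom]], rotated])
      (use I in simp)
  moreover have "\<psi> ` I \<subseteq> L \<inter> U"
  proof
    fix y assume "y \<in> \<psi> ` I"
    then obtain x where "x \<in> I" "y = \<psi> x" by (elim imageE)
    moreover from this have "x \<in> \<psi> -` V" "\<psi> x \<in> \<psi> ` ?Q" using I by auto
    ultimately show "y \<in> L \<inter> U" using V(3) by (auto simp: homeomorphism_image2[OF hom])
  qed
  moreover have "\<psi> ` I \<noteq> {}" using e(1) by (simp add: I_def)
  ultimately obtain r where r: "r \<in> {0<..<1}" "\<psi> ` I \<subseteq> \<psi> ` ({0<..<1} \<times> {r})"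
    using plaque[OF F(2)] by metis
  have "snd x = r" if x: "x \<in> I" for x
  proof -
    have "\<psi> x \<in> \<psi> ` ({0<..<1} \<times> {r})" using subsetD[OF r(2) imageI[OF x]] .
    then obtain y where y: "y \<in> {0<..<1} \<times> {r}" "\<psi> x = \<psi> y" by (elim imageE)
    have "x \<in> ?Q" "y \<in> ?Q" using x I y(1) r(1) by auto
    then have "x = y" using homeomorphism_apply2[OF hom] y(2) by metis
    with y(1) show ?thesis by auto
  qed
  from this[of "(s, q)"] this[of "(s, q + e/2)"] e(1) show False by (simp add: I_def image_iff)
qed

section \<open>A branching line field is not tangent to a foliation\<close>

text \<open>Integral curves of a slope field that depends on \<open>y\<close> only, traversed in the direction of increasing
  \<open>x\<close>.\<close>

definition flow_curve :: "(real \<Rightarrow> real) \<Rightarrow> real \<Rightarrow> (real \<Rightarrow> real) \<Rightarrow> (real \<Rightarrow> real) \<Rightarrow> (real \<Rightarrow> real) \<Rightarrow> bool" where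
  "flow_curve T \<epsilon> x y x' \<longleftrightarrow> \<epsilon> > 0 \<and>
     (\<forall>t\<in>{-\<epsilon><..<\<epsilon>}. (x has_real_derivative x' t) (at t) \<and> x' t > 0 \<and>
        (y has_real_derivative T (y t) * x' t) (at t))"

text \<open>Along an integral curve of the slope \<open>k sqrt y\<close> the quantity \<open>sqrt \<bar>y\<bar> - (k/2) x\<close> is conserved on
  either side of \<open>y = 0\<close>. The sign is the same on both sides because the square root is extended to
  negative numbers as an odd function; this is where the branching comes from.\<close>

lemma sqrt_abs_flow_derivative:
  assumes "(y has_real_derivative k * sqrt (y t) * x') (at t)" "y t \<noteq> 0"
  shows "((\<lambda>t. sqrt \<bar>y t\<bar>) has_real_derivative k / 2 * x') (at t)"
proof (cases "y t > 0")
  case True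
  have "((\<lambda>t. sqrt (y t)) has_real_derivative k / 2 * x') (at t)"
    using True by (auto intro!: derivative_eq_intros assms(1) simp: field_simps)
  moreover have "\<forall>\<^sub>F t in nhds t. y t > 0"
  proof -
    have "(y \<longlongrightarrow> y t) (nhds t)"
      using DERIV_isCont[OF assms(1)] by (simp add: isCont_def tendsto_at_iff_tendsto_nhds)
    then show ?thesis using True by (rule order_tendstoD)
  qed
  then have "\<forall>\<^sub>F t in nhds t. sqrt (y t) = sqrt \<bar>y t\<bar>" by eventually_elim simp
  ultimately show ?thesis by (rule DERIV_cong_ev[OF refl _ refl, THEN iffD1, rotated])
next
  case False
  then have neg: "y t < 0" using assms(2) by simp
  have "((\<lambda>t. sqrt (- y t)) has_real_derivative
      inverse (sqrt (- y t)) / 2 * - (k * sqrt (y t) * x')) (at t)"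
    by (rule DERIV_chain2[OF DERIV_real_sqrt DERIV_minus[OF assms(1)]]) (use neg in simp)
  moreover have "inverse (sqrt (- y t)) / 2 * - (k * sqrt (y t) * x') = k / 2 * x'"
    using neg by (simp add: real_sqrt_minus field_simps)
  ultimately have "((\<lambda>t. sqrt (- y t)) has_real_derivative k / 2 * x') (at t)"
    by (simp only:)
  moreover have "\<forall>\<^sub>F t in nhds t. y t < 0"
  proof -
    have "(y \<longlongrightarrow> y t) (nhds t)"
      using DERIV_isCont[OF assms(1)] by (simp add: isCont_def tendsto_at_iff_tendsto_nhds)
    then show ?thesis using neg by (rule order_tendstoD)
  qed
  then have "\<forall>\<^sub>F t in nhds t. sqrt (- y t) = sqrt \<bar>y t\<bar>" by eventually_elim simp
  ultimately show ?thesis by (rule DERIV_cong_ev[OF refl _ refl, THEN iffD1, rotated])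
qed

lemma flow_curve_sqrt_const:
  assumes fc: "flow_curve (\<lambda>y. k * sqrt y) \<epsilon> x y x'"
    and ab: "a \<le> b" "{a..b} \<subseteq> {-\<epsilon><..<\<epsilon>}" and nz: "\<And>t. a < t \<Longrightarrow> t < b \<Longrightarrow> y t \<noteq> 0"
  shows "sqrt \<bar>y a\<bar> - k / 2 * x a = sqrt \<bar>y b\<bar> - k / 2 * x b"
proof (cases "a = b")
  case False
  with ab have "a < b" by simp
  have der: "(x has_real_derivative x' t) (at t)" "(y has_real_derivative k * sqrt (y t) * x' t) (at t)"
    if "t \<in> {a..b}" for t
    using fc that ab(2) unfolding flow_curve_def by auto
  define W where "W t = sqrt \<bar>y t\<bar> - k / 2 * x t" for t
  have "isCont x t" "isCont y t" if "t \<in> {a..b}" for t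
    using der[OF that] by (auto intro: DERIV_isCont)
  then have "continuous_on {a..b} x" "continuous_on {a..b} y"
    by (auto intro: continuous_at_imp_continuous_on)
  then have "continuous_on {a..b} W"
    unfolding W_def by (intro continuous_intros)
  moreover have "(W has_real_derivative 0) (at t)" if "a < t" "t < b" for t
  proof -
    have "t \<in> {a..b}" using that by simp
    note d = sqrt_abs_flow_derivative[OF der(2)[OF this] nz[OF that]] der(1)[OF this]
    have "(W has_real_derivative k / 2 * x' t - k / 2 * x' t) (at t)"
      unfolding W_def by (intro DERIV_diff DERIV_cmult d)
    then show ?thesis by simp
  qed
  ultimately have "W b = W a" by (intro DERIV_isconst_end[OF \<open>a < b\<close>])
  then show ?thesis by (simp add: W_def)
qed simp

lemma flow_curve_increasing:
  assumes "flow_curve T \<epsilon> x y x'" "a < b" "a \<in> {-\<epsilon><..<\<epsilon>}" "b \<in> {-\<epsilon><..<\<epsilon>}"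
  shows "x a < x b"
proof (rule DERIV_pos_imp_increasing[OF assms(2)])
  fix t assume "a \<le> t" "t \<le> b"
  then have "t \<in> {-\<epsilon><..<\<epsilon>}" using assms(3,4) by auto
  then show "\<exists>y. (x has_real_derivative y) (at t) \<and> 0 < y"
    using assms(1) unfolding flow_curve_def by blast
qed

text \<open>To the left of a time at which the curve reaches \<open>y = 0\<close>, the conserved quantity would force
  \<open>sqrt \<bar>y\<bar>\<close> to be negative as long as \<open>y \<noteq> 0\<close>.\<close>

lemma flow_curve_stays_left:
  assumes fc: "flow_curve (\<lambda>y. k * sqrt y) \<epsilon> x y x'" and k: "k > 0" and y0: "y 0 = 0"
    and t: "- \<epsilon> < t" "t \<le> 0"
  shows "y t = 0"
proof (rule ccontr)
  assume yt: "y t \<noteq> 0"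
  have e: "\<epsilon> > 0" using fc by (simp add: flow_curve_def)
  have cont: "continuous_on {t..0} y"
    using fc t e unfolding flow_curve_def
    by (intro continuous_at_imp_continuous_on ballI) (auto intro!: DERIV_isCont)
  define S where "S = {u \<in> {t..0}. y u = 0}"
  have "closed S" unfolding S_def using continuous_closed_preimage_constant[OF cont] by simp
  moreover have S: "0 \<in> S" "bdd_below S" using t y0 by (auto simp: S_def intro: bdd_belowI[of _ t])
  ultimately have I: "Inf S \<in> S" by (intro closed_contains_Inf) auto
  have It: "t < Inf S" "Inf S \<le> 0" "y (Inf S) = 0" using I yt by (auto simp: S_def less_le)
  have "y u \<noteq> 0" if "t < u" "u < Inf S" for u
    using that It cInf_lower[OF _ S(2), of u] by (force simp: S_def)
  then have "sqrt \<bar>y t\<bar> - k / 2 * x t = sqrt \<bar>y (Inf S)\<bar> - k / 2 * x (Inf S)"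
    using It t e by (intro flow_curve_sqrt_const[OF fc]) auto
  then have "sqrt \<bar>y t\<bar> = k / 2 * (x t - x (Inf S))" by (simp add: It(3) algebra_simps)
  also have "\<dots> < 0"
    using flow_curve_increasing[OF fc It(1)] It t e k by (intro mult_pos_neg) auto
  finally show False by simp
qed

context unimodular_basis
begin

text \<open>A curve in the torus can be lifted to start at any prescribed representative of its initial point,
  since lattice translations do not change projections or velocities.\<close>

lemma tangent_curve:
  assumes tan: "tangent_to F E" and L: "L \<in> F" "proj z0 \<in> L"
  obtains \<epsilon> \<gamma> \<gamma>' where "\<epsilon> > 0" "\<gamma> 0 = z0" "continuous_on {-\<epsilon><..<\<epsilon>} \<gamma>'"
    "\<And>t. t \<in> {-\<epsilon><..<\<epsilon>} \<Longrightarrow> (\<gamma> has_vector_derivative \<gamma>' t) (at t) \<and> \<gamma>' t \<noteq> 0 \<and>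
       proj (\<gamma> t) \<in> L \<and> \<gamma>' t \<in> E (proj (\<gamma> t))"
proof -
  have "\<exists>\<epsilon>>0. \<exists>\<gamma> \<gamma>'. proj (\<gamma> 0) = proj z0 \<and> continuous_on {-\<epsilon><..<\<epsilon>} \<gamma>' \<and>
        (\<forall>t\<in>{-\<epsilon><..<\<epsilon>}. (\<gamma> has_vector_derivative \<gamma>' t) (at t) \<and> \<gamma>' t \<noteq> 0 \<and>
           proj (\<gamma> t) \<in> L \<and> \<gamma>' t \<in> E (proj (\<gamma> t)))"
    using tan L unfolding tangent_to_def by (elim ballE) auto
  then obtain \<epsilon> \<gamma> \<gamma>' where e: "\<epsilon> > 0" "proj (\<gamma> 0) = proj z0" "continuous_on {-\<epsilon><..<\<epsilon>} \<gamma>'"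
    and \<gamma>: "\<forall>t\<in>{-\<epsilon><..<\<epsilon>}. (\<gamma> has_vector_derivative \<gamma>' t) (at t) \<and> \<gamma>' t \<noteq> 0 \<and>
           proj (\<gamma> t) \<in> L \<and> \<gamma>' t \<in> E (proj (\<gamma> t))"
    by (elim exE conjE)
  have "lattice_rel z0 (\<gamma> 0)" using e(2) by (metis proj_eq_iff)
  then have pr: "proj (\<gamma> t + (z0 - \<gamma> 0)) = proj (\<gamma> t)" for t
    by (simp add: proj_eq_iff lattice_rel_def)
  show ?thesis
  proof (rule that[of \<epsilon> "\<lambda>t. \<gamma> t + (z0 - \<gamma> 0)" \<gamma>'])
    fix t assume "t \<in> {-\<epsilon><..<\<epsilon>}"
    then show "((\<lambda>t. \<gamma> t + (z0 - \<gamma> 0)) has_vector_derivative \<gamma>' t) (at t) \<and> \<gamma>' t \<noteq> 0 \<and>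
       proj (\<gamma> t + (z0 - \<gamma> 0)) \<in> L \<and> \<gamma>' t \<in> E (proj (\<gamma> t + (z0 - \<gamma> 0)))"
      using \<gamma> unfolding pr by (auto intro!: derivative_eq_intros)
  qed (use e in auto)
qed

lemma tangent_flow_curve:
  assumes tan: "tangent_to F E" and L: "L \<in> F" "proj z0 \<in> L"
    and E: "\<And>z h. \<bar>yc z\<bar> < r \<Longrightarrow> h \<in> E (proj z) \<Longrightarrow> yc h = T (yc z) * xc h"
    and z0: "\<bar>yc z0\<bar> < r"
  obtains \<epsilon> x y x' where "flow_curve T \<epsilon> x y x'" "x 0 = xc z0" "y 0 = yc z0"
    "\<And>t. t \<in> {-\<epsilon><..<\<epsilon>} \<Longrightarrow> proj (pt (x t) (y t)) \<in> L"
proof -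
  obtain \<epsilon> \<gamma> \<gamma>' where e: "\<epsilon> > 0" "\<gamma> 0 = z0" "continuous_on {-\<epsilon><..<\<epsilon>} \<gamma>'"
    and \<gamma>: "\<And>t. t \<in> {-\<epsilon><..<\<epsilon>} \<Longrightarrow> (\<gamma> has_vector_derivative \<gamma>' t) (at t) \<and> \<gamma>' t \<noteq> 0 \<and>
       proj (\<gamma> t) \<in> L \<and> \<gamma>' t \<in> E (proj (\<gamma> t))"
    using tangent_curve[OF tan L] by metis
  define x y where "x = (\<lambda>t. xc (\<gamma> t))" and "y = (\<lambda>t. yc (\<gamma> t))"
  define x' y' where "x' = (\<lambda>t. xc (\<gamma>' t))" and "y' = (\<lambda>t. yc (\<gamma>' t))"
  have dx: "(x has_real_derivative x' t) (at t)" and dy: "(y has_real_derivative y' t) (at t)"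
    if "t \<in> {-\<epsilon><..<\<epsilon>}" for t
    using bounded_linear.has_vector_derivative[OF bounded_linear_xc, of \<gamma> "\<gamma>' t"]
      bounded_linear.has_vector_derivative[OF bounded_linear_yc, of \<gamma> "\<gamma>' t"] \<gamma>[OF that]
    by (simp_all add: x_def y_def x'_def y'_def has_real_derivative_iff_has_vector_derivative)
  have "isCont y 0" using dy[of 0] e(1) by (auto intro: DERIV_isCont)
  then have "isCont (\<lambda>t. \<bar>y t\<bar>) 0" by (intro continuous_intros)
  moreover have "\<bar>y 0\<bar> < r" using z0 e(2) by (simp add: y_def)
  ultimately have "\<forall>\<^sub>F t in nhds 0. \<bar>y t\<bar> < r"
    unfolding isCont_def tendsto_at_iff_tendsto_nhds[of "\<lambda>t. \<bar>y t\<bar>" 0] by (rule order_tendstoD)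
  then obtain d where d: "d > 0" "\<And>t. \<bar>t\<bar> < d \<Longrightarrow> \<bar>y t\<bar> < r"
    by (auto simp: eventually_nhds_metric dist_real_def)
  define \<delta> where "\<delta> = min d \<epsilon>"
  have \<delta>: "\<delta> > 0" "\<And>t. t \<in> {-\<delta><..<\<delta>} \<Longrightarrow> t \<in> {-\<epsilon><..<\<epsilon>} \<and> \<bar>y t\<bar> < r"
    using d e(1) by (auto simp: \<delta>_def)
  have y': "y' t = T (y t) * x' t" if "t \<in> {-\<delta><..<\<delta>}" for t
    using E[of "\<gamma> t" "\<gamma>' t"] \<delta>(2)[OF that] \<gamma>[of t] by (simp add: x'_def y'_def y_def)
  have nz: "x' t \<noteq> 0" if "t \<in> {-\<delta><..<\<delta>}" for t
  proof
    assume "x' t = 0"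
    then have "\<gamma>' t = 0" using y'[OF that] by (intro coords_eqI) (simp_all add: x'_def y'_def)
    then show False using \<gamma> \<delta>(2)[OF that] by blast
  qed
  have cont: "continuous_on {-\<delta><..<\<delta>} x'"
    unfolding x'_def by (intro continuous_on_xc continuous_on_subset[OF e(3)]) (use \<delta>(2) in blast)
  have "connected (x' ` {-\<delta><..<\<delta>})" by (rule connected_continuous_image[OF cont]) simp
  then have sign: "(\<forall>t\<in>{-\<delta><..<\<delta>}. x' t > 0) \<or> (\<forall>t\<in>{-\<delta><..<\<delta>}. x' t < 0)"
    using nz unfolding connected_iff_interval by (smt (verit) imageE imageI)
  have L': "proj (pt (x t) (y t)) \<in> L" if "t \<in> {-\<delta><..<\<delta>}" for t
    using \<gamma> \<delta>(2)[OF that] by (simp add: x_def y_def)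
  have 0: "x 0 = xc z0" "y 0 = yc z0" using e(2) by (simp_all add: x_def y_def)
  from sign show ?thesis
  proof
    assume pos: "\<forall>t\<in>{-\<delta><..<\<delta>}. x' t > 0"
    show ?thesis
    proof (rule that[of \<delta> x y x'])
      show "flow_curve T \<delta> x y x'"
        unfolding flow_curve_def using \<delta> dx dy y' pos by metis
    qed (use 0 L' in auto)
  next
    assume neg: "\<forall>t\<in>{-\<delta><..<\<delta>}. x' t < 0"
    show ?thesis
    proof (rule that[of \<delta> "\<lambda>t. x (- t)" "\<lambda>t. y (- t)" "\<lambda>t. - x' (- t)"])
      show "flow_curve T \<delta> (\<lambda>t. x (- t)) (\<lambda>t. y (- t)) (\<lambda>t. - x' (- t))"
        unfolding flow_curve_def
      proof (intro conjI ballI \<delta>(1))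
        fix t assume "t \<in> {-\<delta><..<\<delta>}"
        then have t: "- t \<in> {-\<delta><..<\<delta>}" by auto
        show "((\<lambda>t. x (- t)) has_real_derivative - x' (- t)) (at t)"
          using dx[of "- t"] \<delta>(2)[OF t] by (intro DERIV_mirror[THEN iffD1]) simp
        show "((\<lambda>t. y (- t)) has_real_derivative T (y (- t)) * - x' (- t)) (at t)"
          using DERIV_mirror[of y "y' (- t)" t, THEN iffD1, OF dy[of "- t"]] \<delta>(2)[OF t]
          by (simp add: y'[OF t])
        show "- x' (- t) > 0" using neg t by auto
      qed
    qed (use 0 L' in auto)
  qed
qed

text \<open>The half cusps \<open>\<sigma> c\<close>, which emanate from the points \<open>(c, 0)\<close> to the upper right, are integral
  curves. Tangency makes the set of parameters belonging to a fixed leaf open, so each half cusp lies in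
  one leaf, and this leaf contains the end point. The leaf of the origin also contains an arc to the left
  of the origin, because a tangent curve cannot leave \<open>y = 0\<close> in that direction. The half cusps
  over this arc sweep out an open set.\<close>

lemma no_foliation_tangent_to_branching:
  assumes F: "foliation F" and tan: "tangent_to F E" and k: "k > 0" and r: "r > 0"
    and E: "\<And>z h. \<bar>yc z\<bar> < r \<Longrightarrow> h \<in> E (proj z) \<Longrightarrow> yc h = k * sqrt (yc z) * xc h"
  shows False
proof -
  \<comment> \<open>Up to horizontal distance \<open>R\<close> from its end point a half cusp stays in the region where the slopes are known.\<close>
  define R where "R = 2 * sqrt r / k"
  have R: "R > 0" using k r by (simp add: R_def)
  define \<sigma> where "\<sigma> c x = pt x ((k / 2 * (x - c))\<^sup>2)" for c x
  have small: "\<bar>(k / 2 * (x - c))\<^sup>2\<bar> < r" if "c < x" "x < c + R" for c x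
  proof -
    have "k / 2 * (x - c) < k / 2 * R" using that k by simp
    then have "k / 2 * (x - c) < sqrt r" using k by (simp add: R_def)
    then have "(k / 2 * (x - c))\<^sup>2 < (sqrt r)\<^sup>2" using that k by (intro power_strict_mono) auto
    then show ?thesis using r by simp
  qed
  have local_leaf: "\<exists>d>0. \<forall>x1. \<bar>x1 - x0\<bar> < d \<longrightarrow> proj (\<sigma> c x1) \<in> L"
    if x0: "c < x0" "x0 < c + R" and L: "L \<in> F" "proj (\<sigma> c x0) \<in> L" for c x0 L
  proof -
    have "\<bar>yc (\<sigma> c x0)\<bar> < r" using small[OF x0] by (simp add: \<sigma>_def)
    from tangent_flow_curve[where T = "\<lambda>y. k * sqrt y" and r = r, OF tan L E this]
    obtain \<epsilon> x y x' where fc: "flow_curve (\<lambda>y. k * sqrt y) \<epsilon> x y x'"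
      and init': "x 0 = xc (\<sigma> c x0)" "y 0 = yc (\<sigma> c x0)"
      and L': "\<And>t. t \<in> {-\<epsilon><..<\<epsilon>} \<Longrightarrow> proj (pt (x t) (y t)) \<in> L"
      by metis
    have init: "x 0 = x0" "y 0 = (k / 2 * (x0 - c))\<^sup>2" using init' by (simp_all add: \<sigma>_def)
    have e: "\<epsilon> > 0" using fc by (simp add: flow_curve_def)
    have isC: "isCont x t" "isCont y t" if "t \<in> {-\<epsilon><..<\<epsilon>}" for t
      using fc that unfolding flow_curve_def by (auto intro: DERIV_isCont)
    have "y 0 > 0" using init(2) x0 k by simp
    moreover have "(y \<longlongrightarrow> y 0) (nhds 0)"
      using isC(2)[of 0] e by (simp add: isCont_def tendsto_at_iff_tendsto_nhds)
    ultimately have "\<forall>\<^sub>F t in nhds 0. y t > 0" by (rule order_tendstoD[rotated])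
    then obtain d0 where d0: "d0 > 0" "\<And>t. \<bar>t\<bar> < d0 \<Longrightarrow> y t > 0"
      by (auto simp: eventually_nhds_metric dist_real_def)
    define d where "d = min d0 \<epsilon> / 2"
    have d: "d > 0" "d < \<epsilon>" "d < d0" using d0 e by (auto simp: d_def)
    have y_eq: "y t = (k / 2 * (x t - c))\<^sup>2" if t: "\<bar>t\<bar> \<le> d" for t
    proof -
      have "sqrt \<bar>y t\<bar> - k / 2 * x t = sqrt \<bar>y 0\<bar> - k / 2 * x 0"
      proof (cases "t \<le> 0")
        case True
        show ?thesis
        proof (rule flow_curve_sqrt_const[OF fc True])
          show "y u \<noteq> 0" if "t < u" "u < 0" for u using d0(2)[of u] t that d by auto
        qed (use t d in auto)
      next
        case False
        show ?thesis
        proof (rule flow_curve_sqrt_const[OF fc, symmetric])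
          show "y u \<noteq> 0" if "0 < u" "u < t" for u using d0(2)[of u] t that d by auto
        qed (use t d False in auto)
      qed
      then have "sqrt (y t) = k / 2 * (x t - c)"
        using d0(2)[of t] t d x0 k by (simp add: init real_sqrt_abs abs_mult algebra_simps)
      then have "(sqrt (y t))\<^sup>2 = (k / 2 * (x t - c))\<^sup>2" by (rule arg_cong)
      then show ?thesis using d0(2)[of t] t d by simp
    qed
    have mono: "x (- d) < x0" "x0 < x d"
      using flow_curve_increasing[OF fc, of "-d" 0] flow_curve_increasing[OF fc, of 0 d] d e
      by (auto simp: init)
    have "proj (\<sigma> c x1) \<in> L" if x1: "x (-d) \<le> x1" "x1 \<le> x d" for x1
    proof -
      obtain t where t: "-d \<le> t" "t \<le> d" "x t = x1"
        using IVT[of x "-d" x1 d] x1 isC(1) d by auto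
      then have "\<sigma> c x1 = pt (x t) (y t)" using y_eq[of t] by (simp add: \<sigma>_def)
      then show ?thesis using L'[of t] t d by auto
    qed
    then show ?thesis
      using mono by (intro exI[of _ "min (x0 - x (-d)) (x d - x0)"]) auto
  qed
  have cusp: "proj (\<sigma> c x0) \<in> L"
    if c: "c < x0" "x0 < c + R" and L: "L \<in> F" "proj (pt c 0) \<in> L" for c x0 L
  proof -
    obtain L1 where L1: "L1 \<in> F" "proj (\<sigma> c x0) \<in> L1" using obtain_leaf[OF F] .
    have all: "proj (\<sigma> c x1) \<in> L1" if x1: "x1 \<in> {c<..<c + R}" for x1
    proof (rule connected_induction_simple[of "{c<..<c + R}" x0 x1 "\<lambda>x. proj (\<sigma> c x) \<in> L1"])
      fix a assume a: "a \<in> {c<..<c + R}"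
      obtain L2 where L2: "L2 \<in> F" "proj (\<sigma> c a) \<in> L2" using obtain_leaf[OF F] .
      obtain d where d: "d > 0" "\<And>x. \<bar>x - a\<bar> < d \<Longrightarrow> proj (\<sigma> c x) \<in> L2"
        using local_leaf[of c a L2] a L2 by auto
      have same: "x \<in> ball a d \<Longrightarrow> y \<in> ball a d \<Longrightarrow> proj (\<sigma> c x) \<in> L1 \<Longrightarrow> proj (\<sigma> c y) \<in> L1" for x y
        using leaf_unique[OF F L2(1) L1(1)] d(2)[of x] d(2)[of y]
        by (auto simp: dist_real_def abs_minus_commute)
      show "\<exists>T. openin (top_of_set {c<..<c + R}) T \<and> a \<in> T \<and>
          (\<forall>x\<in>T. \<forall>y\<in>T. proj (\<sigma> c x) \<in> L1 \<longrightarrow> proj (\<sigma> c y) \<in> L1)"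
      proof (intro exI[of _ "{c<..<c + R} \<inter> ball a d"] conjI ballI impI)
        show "openin (top_of_set {c<..<c + R}) ({c<..<c + R} \<inter> ball a d)"
          by (rule openin_open_Int) simp
        show "a \<in> {c<..<c + R} \<inter> ball a d" using a d(1) by simp
      qed (use same in blast)
    qed (use c L1 x1 in auto)
    have "proj (\<sigma> c (c + 0)) \<in> L1"
    proof (rule leaf_contains_path_endpoint[OF F L1(1), of "R / 2"])
      show "continuous_on {0..R/2} (\<lambda>t. proj (\<sigma> c (c + t)))"
        unfolding \<sigma>_def by (intro continuous_intros)
      show "proj (\<sigma> c (c + t)) \<in> L1" if "0 < t" "t \<le> R/2" for t
        using all[of "c + t"] that R by auto
    qed (use R in auto)
    then have "proj (pt c 0) \<in> L1" by (simp add: \<sigma>_def)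
    then show ?thesis using leaf_unique[OF F L(1) L1(1) L(2)] L1(2) by simp
  qed
  obtain L where L: "L \<in> F" "proj (pt 0 0) \<in> L" using obtain_leaf[OF F] .
  have "\<bar>yc (pt 0 0)\<bar> < r" using r by simp
  from tangent_flow_curve[where T = "\<lambda>y. k * sqrt y" and r = r, OF tan L E this]
  obtain \<epsilon> x y x' where fc: "flow_curve (\<lambda>y. k * sqrt y) \<epsilon> x y x'"
    and init': "x 0 = xc (pt 0 0)" "y 0 = yc (pt 0 0)"
    and L': "\<And>t. t \<in> {-\<epsilon><..<\<epsilon>} \<Longrightarrow> proj (pt (x t) (y t)) \<in> L"
    by metis
  have init: "x 0 = 0" "y 0 = 0" using init' by simp_all
  have e: "\<epsilon> > 0" using fc by (simp add: flow_curve_def)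
  define d where "d = - x (- \<epsilon>/2)"
  have d: "d > 0" using flow_curve_increasing[OF fc, of "-\<epsilon>/2" 0] e by (simp add: d_def init)
  have left: "proj (pt c 0) \<in> L" if "-d \<le> c" "c \<le> 0" for c
  proof -
    have "isCont x t" if "t \<in> {-\<epsilon><..<\<epsilon>}" for t
      using fc that unfolding flow_curve_def by (auto intro: DERIV_isCont)
    then have "\<exists>t\<ge>-\<epsilon>/2. t \<le> 0 \<and> x t = c"
      using that e by (intro IVT) (auto simp: d_def init)
    then obtain t where t: "-\<epsilon>/2 \<le> t" "t \<le> 0" "x t = c" by blast
    moreover have "y t = 0" using flow_curve_stays_left[OF fc k init(2)] t e by simp
    ultimately show ?thesis using L'[of t] e by auto
  qed
  \<comment> \<open>The union of the half cusps whose end points lie between \<open>(- d, 0)\<close> and the origin.\<close>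
  define V where "V = {z. 0 < yc z \<and> sqrt (yc z) * (2 / k) < R \<and>
      - d < xc z - sqrt (yc z) * (2 / k) \<and> xc z - sqrt (yc z) * (2 / k) < 0}"
  have "open V"
    unfolding V_def by (intro open_Collect_conj open_Collect_less continuous_intros)
  moreover have "pt (s - d/2) ((k / 2 * s)\<^sup>2) \<in> V" if "s = min (R/2) (d/4)" for s
  proof -
    have "s > 0" "s < R" using that R d by auto
    moreover have "sqrt ((k / 2 * s)\<^sup>2) * (2 / k) = s"
      using \<open>s > 0\<close> k by (simp add: real_sqrt_abs abs_mult)
    ultimately show ?thesis using d k by (simp add: V_def)
  qed
  then have "\<exists>z. z \<in> V" by blast
  moreover have "proj ` V \<subseteq> L"
  proof
    fix p assume "p \<in> proj ` V"
    then obtain z where z: "z \<in> V" "p = proj z" by blast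
    define c where "c = xc z - sqrt (yc z) * (2 / k)"
    have "\<sigma> c (xc z) = z"
      using z(1) k by (auto intro!: coords_eqI simp: \<sigma>_def c_def V_def power_mult_distrib)
    moreover have "proj (\<sigma> c (xc z)) \<in> L"
      using z(1) k d by (intro cusp left L) (auto simp: V_def c_def)
    ultimately show "p \<in> L" using z(2) by simp
  qed
  ultimately show False
    using leaf_has_empty_interior[OF F L(1) open_proj_image] by blast
qed

end

section \<open>Periodic functions on the line\<close>

definition periodise :: "(real \<Rightarrow> real) \<Rightarrow> real \<Rightarrow> real" where
  "periodise h y = h (y - of_int (round y))"

lemma periodise_shift [simp]: "periodise h (y + of_int n) = periodise h y"
proof -
  have "y + of_int n + 1/2 = y + 1/2 + of_int n" by simp
  then have "\<lfloor>y + of_int n + 1/2\<rfloor> = \<lfloor>y + 1/2\<rfloor> + n" by (simp only: floor_add_int)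
  then show ?thesis by (simp add: periodise_def round_def)
qed

lemma periodise_eq:
  assumes "h (-1/2) = h (1/2)" "\<bar>y\<bar> \<le> 1/2"
  shows "periodise h y = h y"
proof (cases "y = 1/2")
  case True
  have "round y = 1" unfolding True round_def by simp
  moreover have "y - of_int 1 = -1/2" using True by simp
  ultimately show ?thesis using assms(1) True unfolding periodise_def by metis
next
  case False
  have "0 \<le> y + 1/2" "y + 1/2 < 1" using assms(2) False by linarith+
  then have "round y = 0" by (simp add: round_def floor_eq_iff)
  then show ?thesis by (simp add: periodise_def)
qed

lemma continuous_on_periodise:
  assumes "continuous_on {-1/2..1/2} h" "h (-1/2) = h (1/2)"
  shows "continuous_on UNIV (periodise h)"
proof -
  have one: "continuous_on {of_int n - 1/2..of_int n + 1/2} (periodise h)" for n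
  proof -
    have "continuous_on {of_int n - 1/2..of_int n + 1/2} (\<lambda>y. h (y - of_int n))"
      by (rule continuous_on_compose2[OF assms(1)]) (auto intro!: continuous_intros)
    then show ?thesis
    proof (rule continuous_on_eq)
      fix y :: real assume "y \<in> {of_int n - 1/2..of_int n + 1/2}"
      then have "periodise h (y - of_int n) = h (y - of_int n)"
        unfolding atLeastAtMost_iff by (intro periodise_eq assms(2)) linarith
      then show "h (y - of_int n) = periodise h y"
        using periodise_shift[of h "y - of_int n" n] by simp
    qed
  qed
  have "isCont (periodise h) y" for y
  proof -
    define n where "n = \<lfloor>y\<rfloor>"
    have "continuous_on ({of_int n - 1/2..of_int n + 1/2} \<union> {of_int (n + 1) - 1/2..of_int (n + 1) + 1/2}) (periodise h)"
      by (intro continuous_on_closed_Un one) auto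
    moreover have "{of_int n - 1/2..of_int n + 1/2} \<union> {of_int (n + 1) - 1/2..of_int (n + 1) + 1/2} = {of_int n - 1/2..of_int n + 3/2::real}"
      by auto
    ultimately have "continuous_on {of_int n - 1/2..of_int n + 3/2} (periodise h)" by simp
    moreover have "y \<in> interior {of_int n - 1/2..of_int n + 3/2}"
      using floor_correct[of y]
      unfolding n_def interior_atLeastAtMost_real greaterThanLessThan_iff by linarith
    ultimately show ?thesis by (rule continuous_on_interior)
  qed
  then show ?thesis by (simp add: continuous_at_imp_continuous_on)
qed

lemma antiderivative_periodic:
  fixes h :: "real \<Rightarrow> real"
  assumes "continuous_on UNIV h" "\<And>y. h (y + 1) = h y"
  obtains H where "\<And>y. (H has_real_derivative h y) (at y)" "H 0 = 0"
    "\<And>y. H (y + 1) = H y + (H (1/2) - H (-1/2))"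
proof -
  have "\<exists>H. \<forall>x::real. -\<infinity> < ereal x \<longrightarrow> ereal x < \<infinity> \<longrightarrow> (H has_vector_derivative h x) (at x)"
    using assms(1) by (intro einterval_antiderivative) (auto simp: continuous_on_eq_continuous_at)
  then obtain H0 where H0: "\<And>x. (H0 has_real_derivative h x) (at x)"
    by (auto simp: has_real_derivative_iff_has_vector_derivative)
  define H where "H y = H0 y - H0 0" for y
  have H: "(H has_real_derivative h x) (at x)" for x
    unfolding H_def by (auto intro!: derivative_eq_intros H0)
  have "((\<lambda>y. H (y + 1) - H y) has_real_derivative 0) (at y)" for y
  proof -
    have "((\<lambda>y. H (y + 1)) has_real_derivative h (y + 1)) (at y)"
      using DERIV_shift[of H "h (y + 1)" y 1] H by (simp add: add.commute)
    then show ?thesis using DERIV_diff[OF _ H, of _ "h (y + 1)" y] by (simp add: assms(2))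
  qed
  then have "H (y + 1) - H y = H (-1/2 + 1) - H (-1/2)" for y
    by (intro DERIV_isconst_all) auto
  moreover have "-1/2 + 1 = (1/2 :: real)" by simp
  ultimately have "H (y + 1) - H y = H (1/2) - H (-1/2)" for y by metis
  then have "H (y + 1) = H y + (H (1/2) - H (-1/2))" for y by (metis add.commute diff_add_cancel)
  with H show ?thesis using that[of H] by (simp add: H_def)
qed

lemma periodise_odd:
  assumes "\<And>y. h (- y) = - h y" "h (-1/2) = h (1/2)"
  shows "periodise h (- y) = - periodise h y"
proof -
  define n where "n = round y"
  define y0 where "y0 = y - of_int n"
  have y: "y = y0 + of_int n" "- y = - y0 + of_int (- n)" by (simp_all add: y0_def)
  have y0: "\<bar>y0\<bar> \<le> 1/2" using of_int_round_abs_le[of y] by (simp add: y0_def n_def abs_minus_commute)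
  have "periodise h (- y) = periodise h (- y0)" unfolding y(2) by (rule periodise_shift)
  also have "\<dots> = - h y0" using y0 assms by (simp add: periodise_eq)
  also have "h y0 = periodise h y0" using y0 assms(2) by (simp add: periodise_eq)
  also have "\<dots> = periodise h y" unfolding y(1) by (rule periodise_shift[symmetric])
  finally show ?thesis .
qed

lemma antiderivative_eq:
  fixes G g :: "real \<Rightarrow> real"
  assumes "\<And>y. (G has_real_derivative D y) (at y)" "\<And>y. (g has_real_derivative E y) (at y)"
    and "\<And>y. \<bar>y\<bar> < b \<Longrightarrow> D y = E y" "G 0 = g 0" "b > 0" "\<bar>y\<bar> \<le> b"
  shows "G y = g y"
proof -
  have d: "((\<lambda>y. G y - g y) has_real_derivative D y - E y) (at y)" for y
    by (intro DERIV_diff assms)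
  then have c: "continuous_on S (\<lambda>y. G y - g y)" for S
    by (intro continuous_at_imp_continuous_on ballI DERIV_isCont)
  have z: "((\<lambda>y. G y - g y) has_real_derivative 0) (at y)" if "-b < y" "y < b" for y
    using d[of y] assms(3)[of y] that by (simp add: abs_less_iff)
  have "G x - g x = G (-b) - g (-b)" if "\<bar>x\<bar> \<le> b" for x
    using that assms(5) by (intro DERIV_isconst2[of "-b" b "\<lambda>y. G y - g y"] c z) (auto simp: abs_le_iff)
  from this[of y] this[of 0] assms show ?thesis by simp
qed

section \<open>Pointwise cone estimates\<close>

text \<open>Here \<open>T\<close> and \<open>T'\<close> are the values of the slope field at a point and at its image. The first condition
  says that the slope \<open>T\<close> is mapped to the slope \<open>T'\<close>; then \<open>\<gamma> - \<psi> T'\<close> is the factor by which the form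
  annihilating the slope is multiplied. The third condition bounds the Jacobian \<open>lam \<gamma>\<close> by the square of
  this factor, which says that the pull-back of slopes contracts near \<open>T'\<close>.\<close>

definition exact_slopes :: "real \<Rightarrow> real \<Rightarrow> real \<Rightarrow> real \<Rightarrow> real \<Rightarrow> real \<Rightarrow> bool" where
  "exact_slopes lam \<rho> T T' \<gamma> \<psi> \<longleftrightarrow>
     lam * T' = T * (\<gamma> - \<psi> * T') \<and> lam \<le> \<gamma> - \<psi> * T' \<and>
     lam * \<gamma> \<le> 3/4 * (\<gamma> - \<psi> * T')\<^sup>2 \<and> \<rho> * \<bar>\<psi>\<bar> \<le> lam / 8"

lemma exact_slopes_reflect:
  "exact_slopes lam \<rho> T T' \<gamma> \<psi> \<Longrightarrow> exact_slopes lam \<rho> (- T) (- T') \<gamma> (- \<psi>)"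
  by (simp add: exact_slopes_def)

text \<open>The image \<open>\<omega>'\<close> of the form is \<open>\<Lambda> \<omega>\<close>, and the new horizontal component is \<open>R u - \<psi> \<omega>\<close>, where
  \<open>R\<close> is the factor of the derivative along the slope \<open>T\<close>, so that \<open>R \<Lambda>\<close> is the Jacobian \<open>lam \<gamma>\<close>. Domination gives \<open>R \<le> 3/4 \<Lambda>\<close>,
  and the choice of \<open>\<rho>\<close> makes the remaining term harmless.\<close>

lemma exact_slopes_step:
  assumes ex: "exact_slopes lam \<rho> T T' \<gamma> \<psi>" and lam: "lam \<ge> 2" and \<rho>: "\<rho> > 0" and \<gamma>: "\<gamma> > 0"
    and cone: "\<rho> * \<bar>u\<bar> \<le> \<bar>T * u - v\<bar>" "T * u - v \<noteq> 0"
  shows "\<rho> * \<bar>lam * u + \<psi> * v\<bar> < \<bar>T' * (lam * u + \<psi> * v) - \<gamma> * v\<bar>"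
    and "2 * \<bar>T * u - v\<bar> \<le> \<bar>T' * (lam * u + \<psi> * v) - \<gamma> * v\<bar>"
proof -
  define \<Lambda> where "\<Lambda> = \<gamma> - \<psi> * T'"
  define R where "R = lam + \<psi> * T"
  define \<omega> where "\<omega> = T * u - v"
  have inv: "lam * T' = T * \<Lambda>" and \<Lambda>: "lam \<le> \<Lambda>" and dom: "lam * \<gamma> \<le> 3/4 * \<Lambda>\<^sup>2"
    and \<psi>: "\<rho> * \<bar>\<psi>\<bar> \<le> lam / 8"
    using ex by (auto simp: exact_slopes_def \<Lambda>_def)
  have \<omega>': "T' * (lam * u + \<psi> * v) - \<gamma> * v = \<Lambda> * \<omega>"
  proof -
    have "T' * (lam * u + \<psi> * v) - \<gamma> * v = (lam * T') * u - \<Lambda> * v"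
      by (simp add: \<Lambda>_def algebra_simps)
    then show ?thesis unfolding inv by (simp add: \<omega>_def algebra_simps)
  qed
  have "R * \<Lambda> = lam * \<gamma>"
  proof -
    have "R * \<Lambda> = lam * \<gamma> - \<psi> * (lam * T') + \<psi> * (T * \<Lambda>)"
      by (simp add: R_def \<Lambda>_def algebra_simps)
    then show ?thesis by (simp add: inv)
  qed
  then have "R * \<Lambda> \<le> (3/4 * \<Lambda>) * \<Lambda>" "0 < R * \<Lambda>"
    using dom lam \<gamma> by (simp_all add: power2_eq_square)
  then have R: "0 < R" "R \<le> 3/4 * \<Lambda>"
    using \<Lambda> lam by (simp_all add: zero_less_mult_iff mult_le_cancel_right)
  have "lam * u + \<psi> * v = R * u - \<psi> * \<omega>" by (simp add: R_def \<omega>_def algebra_simps)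
  then have "\<rho> * \<bar>lam * u + \<psi> * v\<bar> \<le> \<rho> * (R * \<bar>u\<bar> + \<bar>\<psi>\<bar> * \<bar>\<omega>\<bar>)"
    using R(1) \<rho> abs_triangle_ineq4[of "R * u" "\<psi> * \<omega>"] by (simp add: abs_mult)
  also have "\<dots> = R * (\<rho> * \<bar>u\<bar>) + (\<rho> * \<bar>\<psi>\<bar>) * \<bar>\<omega>\<bar>" by (simp add: algebra_simps)
  also have "\<dots> \<le> 3/4 * \<Lambda> * \<bar>\<omega>\<bar> + \<Lambda> / 8 * \<bar>\<omega>\<bar>"
    using R cone(1) \<psi> \<Lambda> \<rho> lam by (intro add_mono mult_mono) (auto simp: \<omega>_def)
  also have "\<dots> < \<Lambda> * \<bar>\<omega>\<bar>" using \<Lambda> lam cone(2) by (simp add: \<omega>_def)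
  also have "\<dots> = \<bar>\<Lambda> * \<omega>\<bar>" using \<Lambda> lam by (simp add: abs_mult)
  finally show "\<rho> * \<bar>lam * u + \<psi> * v\<bar> < \<bar>T' * (lam * u + \<psi> * v) - \<gamma> * v\<bar>" unfolding \<omega>' .
  show "2 * \<bar>T * u - v\<bar> \<le> \<bar>T' * (lam * u + \<psi> * v) - \<gamma> * v\<bar>"
    unfolding \<omega>' using \<Lambda> lam by (simp add: abs_mult \<omega>_def mult_right_mono)
qed

text \<open>Without invariance of slopes the image of the form has an additional term in \<open>u\<close>. Its coefficient
  stays bounded because \<open>\<bar>T\<bar> \<gamma>\<close> does, so a large \<open>\<gamma>\<close> outweighs it.\<close>

lemma steep_step:
  fixes lam \<rho> T T' \<gamma> \<psi> u v :: real
  assumes lam: "lam \<ge> 2" and \<rho>: "\<rho> > 0" and T: "\<bar>T\<bar> * \<gamma> \<le> lam" "\<bar>T\<bar> \<le> 1" "\<bar>T'\<bar> \<le> 1"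
    and \<psi>: "\<bar>\<psi>\<bar> \<le> lam + 1"
    and \<gamma>: "\<gamma> \<ge> (3 * lam + 1) / \<rho> + \<rho> * (lam + 1) + 3 * lam + 4"
    and cone: "\<rho> * \<bar>u\<bar> \<le> \<bar>T * u - v\<bar>" "T * u - v \<noteq> 0"
  shows "\<rho> * \<bar>lam * u + \<psi> * v\<bar> < \<bar>T' * (lam * u + \<psi> * v) - \<gamma> * v\<bar>"
    and "2 * \<bar>T * u - v\<bar> \<le> \<bar>T' * (lam * u + \<psi> * v) - \<gamma> * v\<bar>"
proof -
  define \<omega> where "\<omega> = T * u - v"
  have \<omega>: "\<bar>\<omega>\<bar> > 0" using cone(2) by (simp add: \<omega>_def)
  have u: "\<bar>u\<bar> \<le> \<bar>\<omega>\<bar> / \<rho>" using cone(1) \<rho> by (simp add: \<omega>_def field_simps)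
  have "\<gamma> > 0"
  proof -
    have "(3 * lam + 1) / \<rho> > 0" "\<rho> * (lam + 1) > 0" using lam \<rho> by auto
    then show ?thesis using \<gamma> lam by linarith
  qed
  have \<psi>T: "\<bar>\<psi> * T\<bar> \<le> (lam + 1) * 1" unfolding abs_mult using \<psi> T by (intro mult_mono) auto
  have R: "\<bar>lam + \<psi> * T\<bar> \<le> 2 * lam + 1" 
  proof -
    have "\<bar>lam + \<psi> * T\<bar> \<le> \<bar>lam\<bar> + \<bar>\<psi> * T\<bar>" by (rule abs_triangle_ineq)
    also have "\<dots> \<le> lam + (lam + 1) * 1" using \<psi>T lam by (intro add_mono) auto
    finally show ?thesis by simp
  qed
  have e: "\<bar>T' * (lam + \<psi> * T) - \<gamma> * T\<bar> \<le> 3 * lam + 1"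
  proof -
    have "\<bar>T' * (lam + \<psi> * T)\<bar> \<le> 1 * (2 * lam + 1)"
      unfolding abs_mult using R T by (intro mult_mono) auto
    moreover have "\<bar>\<gamma> * T\<bar> \<le> lam" using T(1) \<open>\<gamma> > 0\<close> by (simp add: abs_mult mult.commute)
    moreover have "\<bar>T' * (lam + \<psi> * T) - \<gamma> * T\<bar> \<le> \<bar>T' * (lam + \<psi> * T)\<bar> + \<bar>\<gamma> * T\<bar>"
      by (rule abs_triangle_ineq4)
    ultimately show ?thesis by simp
  qed
  have \<Lambda>: "\<gamma> - (lam + 1) \<le> \<gamma> - T' * \<psi>"
  proof -
    have "\<bar>T' * \<psi>\<bar> \<le> 1 * (lam + 1)" unfolding abs_mult using \<psi> T by (intro mult_mono) auto
    from order_trans[OF abs_ge_self this] show ?thesis by simp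
  qed
  define d where "d = T' * (lam + \<psi> * T) - \<gamma> * T"
  define \<Lambda> where "\<Lambda> = \<gamma> - T' * \<psi>"
  have "T' * (lam * u + \<psi> * v) - \<gamma> * v = d * u + \<Lambda> * \<omega>"
    by (simp add: d_def \<Lambda>_def \<omega>_def algebra_simps)
  moreover have "\<bar>d * u + \<Lambda> * \<omega>\<bar> \<ge> \<bar>\<Lambda> * \<omega>\<bar> - \<bar>d * u\<bar>"
    using abs_triangle_ineq2[of "\<Lambda> * \<omega>" "- (d * u)"] by (simp add: add.commute)
  ultimately have "\<bar>T' * (lam * u + \<psi> * v) - \<gamma> * v\<bar> \<ge> \<bar>\<Lambda>\<bar> * \<bar>\<omega>\<bar> - \<bar>d\<bar> * \<bar>u\<bar>"
    by (simp only: abs_mult)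
  moreover have "\<bar>d\<bar> * \<bar>u\<bar> \<le> (3 * lam + 1) * (\<bar>\<omega>\<bar> / \<rho>)"
    unfolding d_def using e u lam by (intro mult_mono) auto
  moreover have "(\<gamma> - (lam + 1)) * \<bar>\<omega>\<bar> \<le> \<bar>\<Lambda>\<bar> * \<bar>\<omega>\<bar>"
    unfolding \<Lambda>_def using \<Lambda> by (intro mult_right_mono) auto
  ultimately have "\<bar>T' * (lam * u + \<psi> * v) - \<gamma> * v\<bar> \<ge> (\<gamma> - (lam + 1)) * \<bar>\<omega>\<bar> - (3 * lam + 1) * (\<bar>\<omega>\<bar> / \<rho>)"
    by linarith
  also have "(\<gamma> - (lam + 1)) * \<bar>\<omega>\<bar> - (3 * lam + 1) * (\<bar>\<omega>\<bar> / \<rho>) =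
      (\<gamma> - (lam + 1) - (3 * lam + 1) / \<rho>) * \<bar>\<omega>\<bar>"
    using \<rho> by (simp add: field_simps)
  finally have "(\<rho> * (lam + 1) + 2 * lam + 3) * \<bar>\<omega>\<bar> \<le> \<bar>T' * (lam * u + \<psi> * v) - \<gamma> * v\<bar>"
    using \<gamma> by (elim order_trans[rotated]) (intro mult_right_mono, auto)
  then have big: "\<bar>T' * (lam * u + \<psi> * v) - \<gamma> * v\<bar> \<ge>
      \<rho> * (lam + 1) * \<bar>\<omega>\<bar> + (2 * lam + 1) * \<bar>\<omega>\<bar> + 2 * \<bar>\<omega>\<bar>"
    by (simp add: algebra_simps)
  have "lam * u + \<psi> * v = (lam + \<psi> * T) * u - \<psi> * \<omega>" by (simp add: \<omega>_def algebra_simps)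
  then have "\<rho> * \<bar>lam * u + \<psi> * v\<bar> \<le> \<rho> * (\<bar>lam + \<psi> * T\<bar> * \<bar>u\<bar> + \<bar>\<psi>\<bar> * \<bar>\<omega>\<bar>)"
    using \<rho> abs_triangle_ineq4[of "(lam + \<psi> * T) * u" "\<psi> * \<omega>"] by (simp add: abs_mult)
  also have "\<dots> \<le> \<rho> * ((2 * lam + 1) * (\<bar>\<omega>\<bar> / \<rho>) + (lam + 1) * \<bar>\<omega>\<bar>)"
    using R u \<psi> lam \<rho> by (intro mult_left_mono add_mono mult_mono) auto
  also have "\<dots> = (2 * lam + 1) * \<bar>\<omega>\<bar> + \<rho> * (lam + 1) * \<bar>\<omega>\<bar>" using \<rho> by (simp add: field_simps)
  finally have "\<rho> * \<bar>lam * u + \<psi> * v\<bar> \<le> (2 * lam + 1) * \<bar>\<omega>\<bar> + \<rho> * (lam + 1) * \<bar>\<omega>\<bar>" .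
  with big \<omega> show "\<rho> * \<bar>lam * u + \<psi> * v\<bar> < \<bar>T' * (lam * u + \<psi> * v) - \<gamma> * v\<bar>" by linarith
  have "\<rho> * (lam + 1) * \<bar>\<omega>\<bar> \<ge> 0" "(2 * lam + 1) * \<bar>\<omega>\<bar> \<ge> 0" using \<rho> lam by auto
  with big show "2 * \<bar>T * u - v\<bar> \<le> \<bar>T' * (lam * u + \<psi> * v) - \<gamma> * v\<bar>" unfolding \<omega>_def by linarith
qed

section \<open>The circle map and its slope field\<close>

definition clamp01 :: "real \<Rightarrow> real" where
  "clamp01 z = max 0 z - max 0 (z - 1)"

definition clamp01_int :: "real \<Rightarrow> real" where
  "clamp01_int z = (max 0 z)\<^sup>2 / 2 - (max 0 (z - 1))\<^sup>2 / 2"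

lemma clamp01_bounds [simp]: "0 \<le> clamp01 z" "clamp01 z \<le> 1"
  by (auto simp: clamp01_def max_def)

lemma clamp01_eq: "z \<le> 0 \<Longrightarrow> clamp01 z = 0" "1 \<le> z \<Longrightarrow> clamp01 z = 1"
    "0 \<le> z \<Longrightarrow> z \<le> 1 \<Longrightarrow> clamp01 z = z"
  by (auto simp: clamp01_def max_def)

lemma clamp01_int_eq: "z \<le> 0 \<Longrightarrow> clamp01_int z = 0" "1 \<le> z \<Longrightarrow> clamp01_int z = z - 1/2"
    "0 \<le> z \<Longrightarrow> z \<le> 1 \<Longrightarrow> clamp01_int z = z\<^sup>2 / 2"
  by (auto simp: clamp01_int_def max_def power2_eq_square field_simps)

lemma continuous_on_clamp01 [continuous_intros]:
  "continuous_on S f \<Longrightarrow> continuous_on S (\<lambda>x. clamp01 (f x))"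
  unfolding clamp01_def by (intro continuous_intros)

lemma has_derivative_max_square:
  "((\<lambda>z. (max 0 z)\<^sup>2 / 2) has_real_derivative max 0 z) (at z)" for z :: real
proof (cases "z = 0")
  case True
  have "((\<lambda>h::real. ((max 0 h)\<^sup>2 / 2) / h) \<longlongrightarrow> 0) (at 0)"
  proof (rule Lim_null_comparison[where g = "\<lambda>h. \<bar>h\<bar>"])
    show "\<forall>\<^sub>F h::real in at 0. norm (((max 0 h)\<^sup>2 / 2) / h) \<le> \<bar>h\<bar>"
      by (rule always_eventually) (auto simp: max_def power2_eq_square)
    show "((\<lambda>h::real. \<bar>h\<bar>) \<longlongrightarrow> 0) (at 0)" by (rule tendsto_rabs_zero) (rule tendsto_ident_at)
  qed
  then show ?thesis by (simp add: DERIV_def True)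
next
  case False
  show ?thesis
  proof (cases "z > 0")
    case True
    have "((\<lambda>z. z\<^sup>2 / 2) has_real_derivative z) (at z)" by (auto intro!: derivative_eq_intros)
    then show ?thesis
      by (rule DERIV_cong_ev[THEN iffD1, rotated -1])
        (use True in \<open>auto simp: max_def intro: eventually_mono[OF eventually_nhds_in_open[of "{0<..}"]]\<close>)
  next
    case False
    with \<open>z \<noteq> 0\<close> have neg: "z < 0" by simp
    have "((\<lambda>z. 0) has_real_derivative 0) (at z)" by simp
    then show ?thesis
      by (rule DERIV_cong_ev[THEN iffD1, rotated -1])
        (use neg in \<open>auto simp: max_def intro: eventually_mono[OF eventually_nhds_in_open[of "{..<0}"]]\<close>)
  qed
qed

lemma clamp01_int_derivative: "(clamp01_int has_real_derivative clamp01 z) (at z)"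
proof -
  have "((\<lambda>z. (max 0 (z - 1))\<^sup>2 / 2) has_real_derivative max 0 (z - 1)) (at z)"
  proof -
    have "((\<lambda>z. z - 1) has_real_derivative 1) (at z)" by (auto intro!: derivative_eq_intros)
    from DERIV_chain2[OF has_derivative_max_square this] show ?thesis by simp
  qed
  then show ?thesis
    unfolding clamp01_int_def[abs_def] clamp01_def
    by (intro DERIV_diff has_derivative_max_square)
qed

lemma clamp01_int_deriv_comp:
  "(u has_real_derivative u') (at y) \<Longrightarrow>
    ((\<lambda>y. clamp01_int (u y)) has_real_derivative clamp01 (u y) * u') (at y)"
  by (rule DERIV_chain2[OF clamp01_int_derivative])

text \<open>The unscaled slope field near the circle \<open>y = 0\<close>. It saturates at height \<open>1/8\<close>.\<close>

definition sqrt8 :: "real \<Rightarrow> real" where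
  "sqrt8 y = max (-1) (min 1 (sqrt (8 * y)))"

lemma sqrt8_minus: "sqrt8 (- y) = - sqrt8 y"
proof -
  define s where "s = sqrt (8 * y)"
  have "sqrt (8 * - y) = - s" by (simp add: s_def real_sqrt_minus)
  then show ?thesis unfolding sqrt8_def s_def[symmetric] by (auto simp: max_def min_def)
qed

lemma sqrt8_bounds: "\<bar>sqrt8 y\<bar> \<le> 1"
proof -
  have "\<bar>max (-1) (min 1 s)\<bar> \<le> 1" for s :: real by (auto simp: max_def min_def)
  then show ?thesis by (simp only: sqrt8_def)
qed

lemma sqrt8_mono: "x \<le> y \<Longrightarrow> sqrt8 x \<le> sqrt8 y"
  unfolding sqrt8_def by (intro max.mono min.mono order_refl real_sqrt_le_mono) auto

lemma sqrt8_small: "\<bar>y\<bar> \<le> 1/8 \<Longrightarrow> sqrt8 y = sqrt (8 * y)"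
proof -
  assume "\<bar>y\<bar> \<le> 1/8"
  then have "8 * y \<le> 1" "-1 \<le> 8 * y" by (auto simp: abs_le_iff)
  then have "sqrt (8 * y) \<le> sqrt 1" "sqrt (-1) \<le> sqrt (8 * y)" by (auto simp del: real_sqrt_one)
  then show ?thesis by (simp add: sqrt8_def real_sqrt_minus)
qed

lemma sqrt8_large: "y \<ge> 1/8 \<Longrightarrow> sqrt8 y = 1"
proof -
  assume "y \<ge> 1/8"
  then have "sqrt 1 \<le> sqrt (8 * y)" by (intro real_sqrt_le_mono) simp
  then show ?thesis by (simp add: sqrt8_def)
qed

lemma sqrt8_pos: "y > 0 \<Longrightarrow> sqrt8 y > 0"
  by (auto simp: sqrt8_def less_max_iff_disj)

lemma continuous_on_sqrt8 [continuous_intros]: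
  "continuous_on S f \<Longrightarrow> continuous_on S (\<lambda>x. sqrt8 (f x))"
  unfolding sqrt8_def by (intro continuous_intros)

text \<open>The model depends on the eigenvalue \<open>lam\<close> and on the absolute degree \<open>m\<close> of the circle map, which is
  taken to be increasing here. On \<open>[0, 1/2]\<close>, extended by symmetry, the derivative of the circle map
  \<open>g0\<close> is \<open>lam\<^sup>2\<close> up to \<open>\<delta>\<close>, decreases linearly to \<open>1/2\<close> on \<open>[\<delta>, 2 \<delta>]\<close>, is \<open>1/2\<close> up to \<open>a\<close>, rises
  linearly to \<open>M\<close> on \<open>[a, a + d]\<close> and is \<open>M\<close> on the remaining interval of length \<open>h\<close>. The value of
  \<open>\<delta>\<close> puts the attracting fixed point at \<open>1/4\<close>, the value of \<open>a\<close> makes the total increase over a period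
  equal to \<open>m\<close>, and \<open>d\<close> is so small that \<open>g0\<close> still maps the ramp below \<open>a\<close>. The summands
  of \<open>M\<close> are the threshold of \<open>steep_step\<close> and a term that ensures \<open>a \<ge> 3/8\<close>.\<close>

locale circle_model =
  fixes lam m :: real
  assumes lam: "lam \<ge> 2" and m: "m \<ge> 1" and m_Int: "m \<in> \<int>"
begin

definition \<rho> :: real where "\<rho> = 1 / (10 * lam)"
definition \<delta> :: real where "\<delta> = 1 / (12 * lam\<^sup>2 - 6)"
definition M :: real where
  "M = (3 * lam + 1) / \<rho> + \<rho> * (lam + 1) + 3 * lam + 4 + 8 * m + 8"
definition d :: real where "d = 1 / (16 * M)"
definition a :: real where "a = 1/2 - d/2 - (m/2 - 3/8) / (M - 1/2)"
definition h :: real where "h = 1/2 - a - d"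

definition \<gamma>0 :: "real \<Rightarrow> real" where
  "\<gamma>0 y = 1/2 + (lam\<^sup>2 - 1/2) * (clamp01 (2 + y/\<delta>) + clamp01 (2 - y/\<delta>) - 1) +
     (M - 1/2) * (clamp01 ((y - a)/d) + clamp01 ((- y - a)/d))"

definition g0 :: "real \<Rightarrow> real" where
  "g0 y = y/2 + (lam\<^sup>2 - 1/2) * (\<delta> * (clamp01_int (2 + y/\<delta>) - clamp01_int (2 - y/\<delta>)) - y) +
     (M - 1/2) * (d * (clamp01_int ((y - a)/d) - clamp01_int ((- y - a)/d)))"

text \<open>Three factors: the square root with its plateau at \<open>1\<close>; the decrease that the invariance of slopes
  forces on the ramp, where slopes are mapped to the plateau by a derivative that increases; and a cut-off
  that brings the slope to zero at \<open>1/2\<close>.\<close>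

definition \<tau>0 :: "real \<Rightarrow> real" where
  "\<tau>0 y = sqrt8 y * (lam / (lam + (M - 1/2) * clamp01 ((\<bar>y\<bar> - a)/d))) * clamp01 ((1/2 - \<bar>y\<bar>)/h)"

text \<open>The first factor is the solution \<open>\<psi>\<close> of the invariance equation \<open>lam T' = T (\<gamma> - \<psi> T')\<close> for the
  slope field \<open>\<tau>0\<close>. It vanishes at \<open>\<delta>\<close>, so that it can be continued by zero to the neighbourhood of
  \<open>y = 0\<close>, where the two terms cancel identically; hence the maximum in the next definition.\<close>

definition k :: "real \<Rightarrow> real" where
  "k y = (\<gamma>0 y / sqrt8 (g0 y) - lam / sqrt8 y - (M - 1/2) * clamp01 ((y - a)/d)) * clamp01 ((1/2 - y)/h)"

definition \<psi>0 :: "real \<Rightarrow> real" where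
  "\<psi>0 y = k (max \<delta> y) - k (max \<delta> (- y))"

lemma lam_sq: "lam\<^sup>2 \<ge> 4" "lam\<^sup>2 \<ge> 2 * lam"
proof -
  show "lam\<^sup>2 \<ge> 2 * lam" using lam by (simp add: power2_eq_square)
  then show "lam\<^sup>2 \<ge> 4" using lam by linarith
qed

lemma \<rho>_pos: "\<rho> > 0" using lam by (simp add: \<rho>_def)

lemma \<delta>_bounds: "\<delta> > 0" "\<delta> \<le> 1/42" and \<delta>_eq: "(lam\<^sup>2 - 1/2) * \<delta> = 1/12"
  using lam_sq by (auto simp: \<delta>_def field_simps)

lemma M_bounds: "M \<ge> (3 * lam + 1) / \<rho> + \<rho> * (lam + 1) + 3 * lam + 4" "M \<ge> 8 * m + 8"
proof -
  have "(3 * lam + 1) / \<rho> \<ge> 0" "\<rho> * (lam + 1) \<ge> 0" using lam \<rho>_pos by auto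
  then show "M \<ge> 8 * m + 8" using lam unfolding M_def by linarith
  show "M \<ge> (3 * lam + 1) / \<rho> + \<rho> * (lam + 1) + 3 * lam + 4" using m unfolding M_def by linarith
qed

lemma M_ge: "M \<ge> 16" using M_bounds(2) m by linarith

lemma d_bounds: "d > 0" "d \<le> 1/256" and M_d: "M * d = 1/16"
  using M_ge by (auto simp: d_def field_simps)

lemma a_bounds: "3/8 \<le> a" "a + d < 1/2"
proof -
  define q where "q = (m/2 - 3/8) / (M - 1/2)"
  have "q \<le> 1/16" using M_bounds(2) m by (simp add: q_def field_simps)
  moreover have "d < q"
  proof -
    have "d * (M - 1/2) \<le> 1/16" using M_d d_bounds by (simp add: algebra_simps)
    also have "\<dots> < m/2 - 3/8" using m by simp
    finally show ?thesis using M_ge by (simp add: q_def pos_less_divide_eq)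
  qed
  ultimately show "3/8 \<le> a" "a + d < 1/2"
    using d_bounds by (simp_all add: a_def flip: q_def)
qed

lemma h_pos: "h > 0" using a_bounds by (simp add: h_def)

lemma \<gamma>0_minus: "\<gamma>0 (- y) = \<gamma>0 y"
  by (simp add: \<gamma>0_def algebra_simps)

lemma g0_minus: "g0 (- y) = - g0 y"
  by (simp add: g0_def algebra_simps)

lemma \<tau>0_minus: "\<tau>0 (- y) = - \<tau>0 y"
  by (simp add: \<tau>0_def sqrt8_minus)

lemma \<psi>0_minus: "\<psi>0 (- y) = - \<psi>0 y"
  by (simp add: \<psi>0_def)

lemma g0_deriv: "(g0 has_real_derivative \<gamma>0 y) (at y)"
proof -
  have "((\<lambda>y. 2 + y/\<delta>) has_real_derivative 1/\<delta>) (at y)" "((\<lambda>y. 2 - y/\<delta>) has_real_derivative -1/\<delta>) (at y)"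
    "((\<lambda>y. (y - a)/d) has_real_derivative 1/d) (at y)" "((\<lambda>y. (- y - a)/d) has_real_derivative -1/d) (at y)"
    using \<delta>_bounds d_bounds by (auto intro!: derivative_eq_intros simp: field_simps)
  note d4 = this[THEN clamp01_int_deriv_comp]
  show ?thesis
    unfolding g0_def[abs_def]
    by (rule DERIV_cong[OF DERIV_add[OF DERIV_add[OF DERIV_cdivide[OF DERIV_ident]
            DERIV_cmult[OF DERIV_diff[OF DERIV_cmult[OF DERIV_diff[OF d4(1) d4(2)]] DERIV_ident]]]
            DERIV_cmult[OF DERIV_cmult[OF DERIV_diff[OF d4(3) d4(4)]]]]])
      (use \<delta>_bounds d_bounds in \<open>simp add: \<gamma>0_def field_simps\<close>)
qed

lemma \<gamma>0_nonneg:
  assumes "0 \<le> y"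
  shows "\<gamma>0 y = 1/2 + (lam\<^sup>2 - 1/2) * clamp01 (2 - y/\<delta>) + (M - 1/2) * clamp01 ((y - a)/d)"
proof -
  have "clamp01 (2 + y/\<delta>) = 1" using assms \<delta>_bounds by (intro clamp01_eq) (simp add: field_simps)
  moreover have "clamp01 ((- y - a)/d) = 0"
    using assms a_bounds d_bounds by (intro clamp01_eq) (simp add: field_simps)
  ultimately show ?thesis by (simp add: \<gamma>0_def)
qed

lemma g0_nonneg:
  assumes "0 \<le> y"
  shows "g0 y = y/2 + 1/12 * (3/2 - clamp01_int (2 - y/\<delta>)) + (M - 1/2) * (d * clamp01_int ((y - a)/d))"
proof -
  have "clamp01_int (2 + y/\<delta>) = 2 + y/\<delta> - 1/2"
    using assms \<delta>_bounds by (intro clamp01_int_eq) (simp add: field_simps)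
  moreover have "clamp01_int ((- y - a)/d) = 0"
    using assms a_bounds d_bounds by (intro clamp01_int_eq) (simp add: field_simps)
  ultimately have "g0 y = y/2 + (lam\<^sup>2 - 1/2) * (\<delta> * (3/2 - clamp01_int (2 - y/\<delta>))) + (M - 1/2) * (d * clamp01_int ((y - a)/d))"
    using \<delta>_bounds(1) by (simp add: g0_def algebra_simps)
  also have "(lam\<^sup>2 - 1/2) * (\<delta> * (3/2 - clamp01_int (2 - y/\<delta>))) = 1/12 * (3/2 - clamp01_int (2 - y/\<delta>))"
    using \<delta>_eq by (metis mult.assoc)
  finally show ?thesis .
qed

lemma \<gamma>0_pos: "\<gamma>0 y \<ge> 1/2"
proof -
  have "\<gamma>0 y \<ge> 1/2" if "y \<ge> 0" for y
    using lam_sq M_ge that by (simp add: \<gamma>0_nonneg)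
  from this[of y] this[of "-y"] show ?thesis by (cases "y \<ge> 0") (auto simp: \<gamma>0_minus)
qed

lemma near_zero:
  assumes "0 \<le> y" "y \<le> \<delta>"
  shows "\<gamma>0 y = lam\<^sup>2" "g0 y = lam\<^sup>2 * y"
proof -
  have y: "y/\<delta> \<le> 1" using assms \<delta>_bounds by simp
  have y_small: "y \<le> a" using assms \<delta>_bounds a_bounds by linarith
  then have z: "(y - a)/d \<le> 0" using d_bounds by (simp add: divide_nonpos_pos)
  show "\<gamma>0 y = lam\<^sup>2"
    using y z by (simp add: \<gamma>0_nonneg[OF assms(1)] clamp01_eq)
  have "g0 y = y/2 + 1/12 * (y/\<delta>)"
    using y z by (simp add: g0_nonneg[OF assms(1)] clamp01_int_eq)
  also have "1/12 * (y/\<delta>) = ((lam\<^sup>2 - 1/2) * \<delta>) * (y/\<delta>)" by (simp only: \<delta>_eq)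
  also have "\<dots> = (lam\<^sup>2 - 1/2) * y" using \<delta>_bounds by simp
  finally show "g0 y = lam\<^sup>2 * y" by (simp add: algebra_simps)
qed

lemma before_ramp:
  assumes "0 \<le> y" "y \<le> a"
  shows "\<gamma>0 y = 1/2 + (lam\<^sup>2 - 1/2) * clamp01 (2 - y/\<delta>)"
    and "g0 y = y/2 + 1/12 * (3/2 - clamp01_int (2 - y/\<delta>))"
proof -
  have "(y - a)/d \<le> 0" using assms d_bounds by (simp add: divide_nonpos_pos)
  then show "\<gamma>0 y = 1/2 + (lam\<^sup>2 - 1/2) * clamp01 (2 - y/\<delta>)"
    and "g0 y = y/2 + 1/12 * (3/2 - clamp01_int (2 - y/\<delta>))"
    by (simp_all add: \<gamma>0_nonneg g0_nonneg assms clamp01_eq clamp01_int_eq)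
qed

lemma plateau:
  assumes "1/8 \<le> y"
  shows "\<gamma>0 y = 1/2 + (M - 1/2) * clamp01 ((y - a)/d)"
    and "g0 y = y/2 + 1/8 + (M - 1/2) * (d * clamp01_int ((y - a)/d))"
proof -
  have "2 - y/\<delta> \<le> 0" using assms \<delta>_bounds by (simp add: field_simps)
  then show "\<gamma>0 y = 1/2 + (M - 1/2) * clamp01 ((y - a)/d)"
    and "g0 y = y/2 + 1/8 + (M - 1/2) * (d * clamp01_int ((y - a)/d))"
    using assms by (simp_all add: \<gamma>0_nonneg g0_nonneg clamp01_eq clamp01_int_eq)
qed

lemma concave_estimates:
  assumes z: "0 \<le> (z::real)"
  shows "clamp01 (2 - z) * z \<le> 3/2 - clamp01_int (2 - z)"
    and "z \<le> 2 \<Longrightarrow> 3/4 * z \<le> 3/2 - clamp01_int (2 - z)"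
    and "0 \<le> 3/2 - clamp01_int (2 - z)" "3/2 - clamp01_int (2 - z) \<le> 3/2"
proof -
  consider "z \<le> 1" | "1 \<le> z" "z \<le> 2" | "2 \<le> z" by linarith
  then have "clamp01 (2 - z) * z \<le> 3/2 - clamp01_int (2 - z) \<and>
    (z \<le> 2 \<longrightarrow> 3/4 * z \<le> 3/2 - clamp01_int (2 - z)) \<and>
    0 \<le> 3/2 - clamp01_int (2 - z) \<and> 3/2 - clamp01_int (2 - z) \<le> 3/2"
  proof cases
    case 1
    then show ?thesis using z by (simp add: clamp01_eq clamp01_int_eq)
  next
    case 2
    have C: "clamp01_int (2 - z) = (2 - z)\<^sup>2 / 2" "clamp01 (2 - z) = 2 - z"
      using 2 by (simp_all add: clamp01_int_eq clamp01_eq)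
    have "3/2 - (2 - z)\<^sup>2 / 2 - (2 - z) * z = (z - 1) * (z + 1) / 2"
      "3/2 - (2 - z)\<^sup>2 / 2 - 3/4 * z = (2 - z) * (z - 1/2) / 2"
      by (simp_all add: power2_eq_square field_simps)
    moreover have "0 \<le> (z - 1) * (z + 1) / 2" "0 \<le> (2 - z) * (z - 1/2) / 2" using 2 by simp_all
    ultimately have "(2 - z) * z \<le> 3/2 - (2 - z)\<^sup>2 / 2" "3/4 * z \<le> 3/2 - (2 - z)\<^sup>2 / 2"
      by (metis diff_ge_0_iff_ge)+
    moreover have "(2 - z)\<^sup>2 \<le> 1" using 2 by (intro power_le_one) auto
    then have "0 \<le> 3/2 - (2 - z)\<^sup>2 / 2" by simp
    moreover have "3/2 - (2 - z)\<^sup>2 / 2 \<le> 3/2" by simp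
    ultimately show ?thesis unfolding C by blast
  next
    case 3
    then show ?thesis using z by (simp add: clamp01_eq clamp01_int_eq)
  qed
  then show "clamp01 (2 - z) * z \<le> 3/2 - clamp01_int (2 - z)"
    and "z \<le> 2 \<Longrightarrow> 3/4 * z \<le> 3/2 - clamp01_int (2 - z)"
    and "0 \<le> 3/2 - clamp01_int (2 - z)" "3/2 - clamp01_int (2 - z) \<le> 3/2"
    by auto
qed

text \<open>The circle map is concave on \<open>[0, 1/8]\<close> with value zero at zero, so its tangent lines meet the
  vertical axis at nonnegative height and its graph lies above the chord of slope \<open>3/2\<close> that ends at height
  \<open>3/16\<close>.\<close>

lemma g0_concave:
  assumes y: "0 \<le> y" "y \<le> 1/8"
  shows "\<gamma>0 y * y \<le> g0 y" "y \<le> g0 y" "g0 y \<le> 3/16"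
proof -
  define z where "z = y/\<delta>"
  have z: "z \<ge> 0" "y = \<delta> * z" using y \<delta>_bounds by (simp_all add: z_def)
  have ya: "y \<le> a" using y a_bounds by linarith
  have \<gamma>: "\<gamma>0 y = 1/2 + (lam\<^sup>2 - 1/2) * clamp01 (2 - z)"
    and g: "g0 y = y/2 + 1/12 * (3/2 - clamp01_int (2 - z))"
    using before_ramp[OF y(1) ya] by (simp_all add: z_def)
  note c = concave_estimates[OF z(1)]
  have "(lam\<^sup>2 - 1/2) * clamp01 (2 - z) * y = ((lam\<^sup>2 - 1/2) * \<delta>) * (clamp01 (2 - z) * z)"
    by (simp add: z(2))
  also have "\<dots> \<le> 1/12 * (3/2 - clamp01_int (2 - z))"
    unfolding \<delta>_eq using c(1) by simp
  finally show "\<gamma>0 y * y \<le> g0 y" unfolding \<gamma> g by (simp add: algebra_simps)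
  have "g0 y \<le> (1/8)/2 + 1/12 * (3/2)"
    unfolding g using c(4) y by (intro add_mono mult_left_mono divide_right_mono) auto
  then show "g0 y \<le> 3/16" by simp
  show "y \<le> g0 y"
  proof (cases "z \<le> 2")
    case True
    have "\<delta> \<le> 1/42" by (rule \<delta>_bounds)
    then have "y \<le> 1/42 * z" unfolding z(2) using z(1) by (intro mult_right_mono)
    moreover have "1/12 * (3/4 * z) \<le> 1/12 * (3/2 - clamp01_int (2 - z))" using c(2)[OF True] by simp
    ultimately show ?thesis unfolding g using z(1) by linarith
  next
    case False
    then have "clamp01_int (2 - z) = 0" by (intro clamp01_int_eq) simp
    then show ?thesis unfolding g using y by simp
  qed
qed

lemma g0_plateau:
  assumes y: "1/8 \<le> y" "y \<le> a + d"
  shows "1/8 \<le> g0 y" "g0 y \<le> a"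
proof -
  have i: "0 \<le> clamp01_int ((y - a)/d)" "clamp01_int ((y - a)/d) \<le> 1/2"
  proof -
    have le: "(y - a)/d \<le> 1" using y d_bounds by (simp add: field_simps)
    show "0 \<le> clamp01_int ((y - a)/d)"
      using le by (cases "(y - a)/d \<le> 0") (auto simp: clamp01_int_eq)
    show "clamp01_int ((y - a)/d) \<le> 1/2"
      using le by (cases "(y - a)/d \<le> 0") (auto simp: clamp01_int_eq power_le_one)
  qed
  have dM: "d * (M - 1/2) \<le> 1/16" "0 \<le> d * (M - 1/2)"
    using M_d d_bounds M_ge by (simp_all add: algebra_simps)
  have "(M - 1/2) * (d * clamp01_int ((y - a)/d)) = (d * (M - 1/2)) * clamp01_int ((y - a)/d)" by simp
  moreover have "0 \<le> (d * (M - 1/2)) * clamp01_int ((y - a)/d)"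
    "(d * (M - 1/2)) * clamp01_int ((y - a)/d) \<le> 1/16 * (1/2)"
    by (rule mult_nonneg_nonneg[OF dM(2) i(1)]) (rule mult_mono[OF dM(1) i(2) _ i(1)], simp)
  ultimately have e: "0 \<le> (M - 1/2) * (d * clamp01_int ((y - a)/d))"
      "(M - 1/2) * (d * clamp01_int ((y - a)/d)) \<le> 1/16 * (1/2)"
    by (simp_all only:)
  show "1/8 \<le> g0 y" "g0 y \<le> a"
    using e y a_bounds d_bounds unfolding plateau(2)[OF y(1)] by linarith+
qed

lemma g0_half: "g0 (1/2) = m/2"
proof -
  have "clamp01_int ((1/2 - a)/d) = (1/2 - a)/d - 1/2"
    using a_bounds d_bounds by (intro clamp01_int_eq) (simp add: field_simps)
  then have "d * clamp01_int ((1/2 - a)/d) = 1/2 - a - d/2"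
    using d_bounds by (simp add: field_simps)
  also have "\<dots> = (m/2 - 3/8) / (M - 1/2)" by (simp add: a_def)
  finally have "(M - 1/2) * (d * clamp01_int ((1/2 - a)/d)) = m/2 - 3/8" using M_ge by simp
  then show ?thesis using plateau(2)[of "1/2"] by simp
qed

end

section \<open>Cone estimates for the model\<close>

context circle_model
begin

lemma g0_mono: "x \<le> y \<Longrightarrow> g0 x \<le> g0 y"
proof (rule DERIV_nonneg_imp_nondecreasing[of x y g0])
  fix t show "\<exists>D. (g0 has_real_derivative D) (at t) \<and> 0 \<le> D"
    using g0_deriv[of t] order_trans[of 0 "1/2", OF _ \<gamma>0_pos[of t]] by auto
qed

lemma g0_zone:
  assumes "0 \<le> y" "y \<le> a + d"
  shows "0 \<le> g0 y" "g0 y \<le> a" "y \<le> 1/8 \<or> 1/8 \<le> g0 y"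
  using g0_concave[of y] g0_plateau[of y] assms a_bounds by (cases "y \<le> 1/8"; force)+

lemma \<tau>0_zone:
  assumes "0 \<le> y" "y \<le> a + d"
  shows "\<tau>0 y = sqrt8 y * (lam / (lam + (M - 1/2) * clamp01 ((y - a)/d)))"
proof -
  have "1 \<le> (1/2 - y)/h" using assms h_pos by (simp add: h_def field_simps)
  then show ?thesis using assms by (simp add: \<tau>0_def clamp01_eq)
qed

lemma \<tau>0_plateau: "0 \<le> y \<Longrightarrow> y \<le> a \<Longrightarrow> \<tau>0 y = sqrt8 y"
proof -
  assume "0 \<le> y" "y \<le> a"
  then have "(y - a)/d \<le> 0" using d_bounds by (simp add: divide_nonpos_pos)
  then show ?thesis using \<open>0 \<le> y\<close> \<open>y \<le> a\<close> d_bounds lam by (simp add: \<tau>0_zone clamp01_eq)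
qed

lemma \<tau>0_bound: "\<bar>\<tau>0 y\<bar> \<le> 1"
proof -
  define q where "q = lam / (lam + (M - 1/2) * clamp01 ((\<bar>y\<bar> - a)/d))"
  have "0 \<le> (M - 1/2) * clamp01 ((\<bar>y\<bar> - a)/d)" using M_ge by simp
  then have "0 \<le> q" "q \<le> 1" using lam by (simp_all add: q_def divide_le_eq)
  then have "\<bar>\<tau>0 y\<bar> \<le> 1 * 1 * 1"
    unfolding \<tau>0_def abs_mult q_def[symmetric] using sqrt8_bounds[of y] by (intro mult_mono) auto
  then show ?thesis by simp
qed

lemma sqrt8_g0_near_zero:
  assumes "0 \<le> y" "y \<le> \<delta>" shows "sqrt8 (g0 y) = lam * sqrt8 y"
proof -
  have "lam\<^sup>2 * y \<le> lam\<^sup>2 * \<delta>" using assms by (intro mult_left_mono) auto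
  also have "\<dots> = 1/12 + \<delta>/2" using \<delta>_eq by (simp add: algebra_simps)
  also have "\<dots> \<le> 1/8" using \<delta>_bounds by simp
  finally have "lam\<^sup>2 * y \<le> 1/8" .
  then have "sqrt8 (g0 y) = sqrt (8 * (lam\<^sup>2 * y))"
    using assms by (simp add: near_zero sqrt8_small)
  also have "\<dots> = lam * sqrt (8 * y)"
    using lam by (simp add: real_sqrt_mult)
  also have "sqrt (8 * y) = sqrt8 y" using assms \<delta>_bounds by (intro sqrt8_small[symmetric]) auto
  finally show ?thesis .
qed

lemma k_\<delta>: "k \<delta> = 0"
proof -
  have "sqrt8 \<delta> > 0" using \<delta>_bounds by (intro sqrt8_pos)
  moreover have "(\<delta> - a)/d \<le> 0" using \<delta>_bounds a_bounds d_bounds by (simp add: divide_nonpos_pos)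
  ultimately show ?thesis
    using lam \<delta>_bounds by (simp add: k_def near_zero(1) sqrt8_g0_near_zero clamp01_eq power2_eq_square)
qed

lemma \<psi>0_nonneg: "0 \<le> y \<Longrightarrow> \<psi>0 y = k (max \<delta> y)"
  using \<delta>_bounds by (simp add: \<psi>0_def max_absorb1 k_\<delta>)

text \<open>Up to height \<open>1/8\<close> the domination inequality \<open>lam \<gamma> T\<^sup>2 \<le> 3/4 (lam T')\<^sup>2\<close> becomes, with
  \<open>T\<^sup>2 = 8 y\<close> and \<open>T'\<^sup>2 = 8 g0 y\<close>, a consequence of \<open>\<gamma>0 y * y \<le> g0 y\<close>, which is concavity, and of
  \<open>lam \<ge> 2\<close>; if \<open>g0 y\<close> exceeds \<open>1/8\<close>, then \<open>T' = 1\<close> and \<open>g0 y \<le> 3/16\<close> suffices. Above \<open>1/8\<close> the factor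
  \<open>\<Lambda>\<close> is \<open>lam + e\<close> and the derivative is \<open>1/2 + e\<close>.\<close>

lemma exact_zone_nonneg:
  assumes y: "0 \<le> y" "y \<le> a + d"
  shows "exact_slopes lam \<rho> (\<tau>0 y) (\<tau>0 (g0 y)) (\<gamma>0 y) (\<psi>0 y)"
proof (cases "y \<le> \<delta>")
  case True
  have ya: "y \<le> a" using True \<delta>_bounds a_bounds by linarith
  have "\<psi>0 y = 0" using True y by (simp add: \<psi>0_nonneg k_\<delta> max_absorb1)
  moreover have "\<tau>0 y = sqrt8 y" using y ya by (simp add: \<tau>0_plateau)
  moreover have "\<tau>0 (g0 y) = lam * sqrt8 y"
    using g0_zone[OF y] True y by (simp add: \<tau>0_plateau sqrt8_g0_near_zero)
  moreover have "\<gamma>0 y = lam\<^sup>2" using True y by (simp add: near_zero)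
  moreover have "lam * lam\<^sup>2 \<le> 3/4 * (lam\<^sup>2)\<^sup>2"
  proof -
    have "lam\<^sup>2 * (4 * lam) \<le> lam\<^sup>2 * (3 * lam\<^sup>2)" using lam_sq lam by (intro mult_left_mono) auto
    then show ?thesis by (simp add: power2_eq_square mult_ac)
  qed
  ultimately show ?thesis
    using lam lam_sq by (simp add: exact_slopes_def power2_eq_square)
next
  case False
  define s s' e where "s = sqrt8 y" and "s' = sqrt8 (g0 y)" and "e = (M - 1/2) * clamp01 ((y - a)/d)"
  have e: "e \<ge> 0" using M_ge by (simp add: e_def)
  have ge: "y \<le> g0 y \<or> 1/8 \<le> g0 y" using g0_concave[of y] g0_zone[OF y] y by auto
  have g0: "0 < g0 y"
    using ge False \<delta>_bounds by auto
  have s: "0 < s" "0 < s'" using False \<delta>_bounds g0 by (auto simp: s_def s'_def intro: sqrt8_pos)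
  have ss': "s \<le> s'"
    using ge sqrt8_mono[of y "g0 y"] sqrt8_large[of "g0 y"] sqrt8_bounds[of y] by (auto simp: s_def s'_def)
  have es: "e * s = e"
  proof (cases "y \<le> a")
    case True
    then have "(y - a)/d \<le> 0" using d_bounds by (simp add: divide_nonpos_pos)
    then show ?thesis by (simp add: e_def clamp01_eq)
  next
    case False
    then show ?thesis using a_bounds by (simp add: s_def sqrt8_large)
  qed
  have T: "\<tau>0 y = s * (lam / (lam + e))" using y by (simp add: \<tau>0_zone s_def e_def)
  have T': "\<tau>0 (g0 y) = s'" using g0_zone[OF y] by (simp add: \<tau>0_plateau s'_def)
  have "1 \<le> (1/2 - y)/h" using y h_pos by (simp add: h_def field_simps)
  then have \<psi>: "\<psi>0 y = \<gamma>0 y / s' - lam / s - e"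
    using False y by (simp add: \<psi>0_nonneg k_def clamp01_eq s_def s'_def e_def max_absorb2)
  define \<Lambda> where "\<Lambda> = \<gamma>0 y - \<psi>0 y * s'"
  have \<Lambda>: "\<Lambda> = s' * (lam / s + e)" using s by (simp add: \<Lambda>_def \<psi> field_simps)
  have inv: "lam * s' = (s * (lam / (lam + e))) * \<Lambda>"
  proof -
    have "lam + e > 0" using lam e by linarith
    have "s * (lam / s + e) = lam + e" using s es by (simp add: field_simps)
    moreover have "(s * (lam / (lam + e))) * \<Lambda> = lam / (lam + e) * s' * (s * (lam / s + e))"
      by (simp add: \<Lambda>)
    ultimately show ?thesis using \<open>lam + e > 0\<close> by simp
  qed
  have big: "lam \<le> \<Lambda>"
  proof -
    have "lam = s' * lam / s'" using s by simp
    also have "\<dots> \<le> s' * lam / s" using s ss' lam by (intro divide_left_mono) auto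
    also have "\<dots> \<le> \<Lambda>" using s e by (simp add: \<Lambda> algebra_simps)
    finally show ?thesis .
  qed
  have "lam * \<gamma>0 y \<le> 3/4 * \<Lambda>\<^sup>2 \<and> \<rho> * \<bar>\<psi>0 y\<bar> \<le> lam / 8"
  proof (cases "y \<le> 1/8")
    case True
    have ya: "y \<le> a" using True a_bounds by linarith
    then have "(y - a)/d \<le> 0" using d_bounds by (simp add: divide_nonpos_pos)
    then have e0: "e = 0" by (simp add: e_def clamp01_eq)
    note c = g0_concave[OF y(1) True]
    have s2: "s\<^sup>2 = 8 * y" using True y by (simp add: s_def sqrt8_small)
    have gs: "\<gamma>0 y * s\<^sup>2 \<le> 3/4 * lam * s'\<^sup>2"
    proof (cases "g0 y \<le> 1/8")
      case True
      have "\<gamma>0 y * s\<^sup>2 \<le> 1 * (8 * g0 y)" using c(1) by (simp add: s2)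
      also have "\<dots> \<le> 3/4 * lam * (8 * g0 y)" using lam g0 by (intro mult_right_mono) auto
      also have "8 * g0 y = s'\<^sup>2" using True g0 by (simp add: s'_def sqrt8_small)
      finally show ?thesis .
    next
      case False
      then have "s' = 1" by (simp add: s'_def sqrt8_large)
      have "\<gamma>0 y * s\<^sup>2 \<le> 8 * g0 y" using c(1) by (simp add: s2)
      also have "\<dots> \<le> 3/4 * 2" using c(3) by simp
      also have "\<dots> \<le> 3/4 * lam" using lam by (intro mult_left_mono) auto
      finally show ?thesis using \<open>s' = 1\<close> by simp
    qed
    have "lam * \<gamma>0 y = lam * (\<gamma>0 y * s\<^sup>2) / s\<^sup>2" using s by simp
    also have "\<dots> \<le> lam * (3/4 * lam * s'\<^sup>2) / s\<^sup>2"
      using gs lam by (intro divide_right_mono mult_left_mono) auto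
    also have "\<dots> = 3/4 * \<Lambda>\<^sup>2" by (simp add: \<Lambda> e0 power2_eq_square field_simps)
    finally have dom: "lam * \<gamma>0 y \<le> 3/4 * \<Lambda>\<^sup>2" .
    \<comment> \<open>Beyond \<open>\<delta>\<close> the slopes are bounded below by their values for \<open>y = \<delta>\<close>, which bounds \<open>\<psi>\<close>.\<close>
    define s0 where "s0 = sqrt8 \<delta>"
    have s0: "s0 > 0" using \<delta>_bounds by (simp add: s0_def sqrt8_pos)
    have s0_le: "s0 \<le> s" using False by (simp add: s0_def s_def sqrt8_mono)
    have s0_le': "lam * s0 \<le> s'"
      using sqrt8_g0_near_zero[of \<delta>] sqrt8_mono[OF g0_mono[of \<delta> y]] False \<delta>_bounds
      by (simp add: s0_def s'_def)
    have "\<gamma>0 y \<le> 1/2 + (lam\<^sup>2 - 1/2) * 1"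
      unfolding before_ramp(1)[OF y(1) ya] using lam_sq by (intro add_left_mono mult_left_mono) auto
    then have \<gamma>: "\<gamma>0 y \<le> lam\<^sup>2" by simp
    have "\<gamma>0 y / s' \<le> lam\<^sup>2 / (lam * s0)"
      using \<gamma> s0_le' s0 lam \<gamma>0_pos[of y] by (intro frac_le) auto
    then have 1: "\<gamma>0 y / s' \<le> lam / s0" using lam by (simp add: power2_eq_square)
    have 2: "lam / s \<le> lam / s0" using s0 s0_le lam by (intro frac_le) auto
    have 3: "0 \<le> \<gamma>0 y / s'" "0 \<le> lam / s" using s lam \<gamma>0_pos[of y] by auto
    have "\<bar>\<psi>0 y\<bar> \<le> lam / s0" using 1 2 3 unfolding \<psi> e0 by (simp add: abs_le_iff)
    then have "\<rho> * \<bar>\<psi>0 y\<bar> \<le> \<rho> * (lam / s0)" using \<rho>_pos by (intro mult_left_mono) auto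
    also have "\<dots> = 1 / (10 * s0)" using lam by (simp add: \<rho>_def)
    also have "\<dots> \<le> lam / 8"
    proof -
      have "s0\<^sup>2 = 8 * \<delta>" using \<delta>_bounds by (simp add: s0_def sqrt8_small)
      then have "(lam * s0)\<^sup>2 = 8 * (lam\<^sup>2 * \<delta>)" by (simp add: power_mult_distrib)
      also have "lam\<^sup>2 * \<delta> = 1/12 + \<delta>/2" using \<delta>_eq by (simp add: algebra_simps)
      finally have "(4/5)\<^sup>2 \<le> (lam * s0)\<^sup>2" using \<delta>_bounds by (simp add: power2_eq_square)
      then have "4/5 \<le> lam * s0" by (rule power2_le_imp_le) (use lam s0 in auto)
      then show ?thesis using s0 by (simp add: field_simps)
    qed
    finally show ?thesis using dom by simp
  next
    case False
    then have y8: "1/8 \<le> y" by simp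
    have s1: "s = 1" "s' = 1"
      using y8 g0_plateau[OF y8 y(2)] by (simp_all add: s_def s'_def sqrt8_large)
    have \<gamma>: "\<gamma>0 y = 1/2 + e" using plateau(1)[OF y8] by (simp add: e_def)
    have "\<Lambda> = lam + e" by (simp add: \<Lambda> s1)
    moreover have "lam * (1/2 + e) \<le> 3/4 * (lam + e)\<^sup>2"
    proof -
      have "3/4 * (lam + e)\<^sup>2 - lam * (1/2 + e) = 3/4 * lam\<^sup>2 - lam/2 + lam * e / 2 + 3/4 * e\<^sup>2"
        by (simp add: power2_eq_square field_simps)
      moreover have "0 \<le> lam * e / 2" "0 \<le> 3/4 * e\<^sup>2" "0 \<le> 3/4 * lam\<^sup>2 - lam/2"
        using lam e lam_sq by auto
      ultimately show ?thesis by (metis add_nonneg_nonneg diff_ge_0_iff_ge)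
    qed
    moreover have "\<rho> * \<bar>\<psi>0 y\<bar> \<le> lam / 8"
    proof -
      have "\<bar>\<psi>0 y\<bar> \<le> lam" using lam by (simp add: \<psi> s1 \<gamma>)
      then have "\<rho> * \<bar>\<psi>0 y\<bar> \<le> \<rho> * lam" using \<rho>_pos by (intro mult_left_mono) auto
      also have "\<dots> = 1/10" using lam by (simp add: \<rho>_def)
      also have "\<dots> \<le> lam/8" using lam by simp
      finally show ?thesis .
    qed
    ultimately show ?thesis by (simp add: \<gamma>)
  qed
  then show ?thesis
    unfolding exact_slopes_def T T' using inv big by (simp add: \<Lambda>_def)
qed

lemma exact_zone:
  assumes "\<bar>y\<bar> \<le> a + d"
  shows "exact_slopes lam \<rho> (\<tau>0 y) (\<tau>0 (g0 y)) (\<gamma>0 y) (\<psi>0 y)" "\<bar>g0 y\<bar> \<le> a"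
proof -
  have "exact_slopes lam \<rho> (\<tau>0 y) (\<tau>0 (g0 y)) (\<gamma>0 y) (\<psi>0 y) \<and> \<bar>g0 y\<bar> \<le> a"
  proof (cases "y \<ge> 0")
    case True
    then show ?thesis using exact_zone_nonneg[of y] g0_zone[of y] assms by simp
  next
    case False
    then show ?thesis
      using exact_slopes_reflect[OF exact_zone_nonneg[of "- y"]] g0_zone[of "- y"] assms
      by (simp add: \<tau>0_minus g0_minus \<gamma>0_minus \<psi>0_minus)
  qed
  then show "exact_slopes lam \<rho> (\<tau>0 y) (\<tau>0 (g0 y)) (\<gamma>0 y) (\<psi>0 y)" "\<bar>g0 y\<bar> \<le> a" by auto
qed

lemma steep_zone:
  assumes "a + d \<le> \<bar>y\<bar>" "\<bar>y\<bar> \<le> 1/2"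
  shows "\<gamma>0 y = M" "\<bar>\<tau>0 y\<bar> * M \<le> lam" "\<bar>\<psi>0 y\<bar> \<le> lam"
proof -
  have nonneg: "\<gamma>0 y = M \<and> \<bar>\<tau>0 y\<bar> * M \<le> lam \<and> \<bar>\<psi>0 y\<bar> \<le> lam" if y: "a + d \<le> y" "y \<le> 1/2" for y
  proof -
    have y8: "1/8 \<le> y" using y a_bounds d_bounds by linarith
    have cl: "clamp01 ((y - a)/d) = 1" using y d_bounds by (intro clamp01_eq) (simp add: field_simps)
    have \<gamma>: "\<gamma>0 y = M" by (simp add: plateau(1)[OF y8] cl)
    have "\<tau>0 y = lam / (lam + (M - 1/2)) * clamp01 ((1/2 - y)/h)"
      using y8 cl by (simp add: \<tau>0_def sqrt8_large)
    then have "\<bar>\<tau>0 y\<bar> \<le> lam / (lam + (M - 1/2)) * 1"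
      using lam M_ge unfolding abs_mult by (simp only: abs_mult) (intro mult_mono, auto)
    then have "\<bar>\<tau>0 y\<bar> * M \<le> lam / (lam + (M - 1/2)) * M"
      using M_ge by (intro mult_right_mono) auto
    also have "\<dots> \<le> lam" using lam M_ge by (simp add: field_simps)
    finally have \<tau>: "\<bar>\<tau>0 y\<bar> * M \<le> lam" .
    have "1/8 \<le> g0 (a + d)" using a_bounds d_bounds by (intro g0_plateau) auto
    also have "\<dots> \<le> g0 y" using y by (intro g0_mono)
    finally have "sqrt8 (g0 y) = 1" by (rule sqrt8_large)
    moreover have "max \<delta> y = y" using y8 \<delta>_bounds by simp
    ultimately have "\<psi>0 y = - ((lam - 1/2) * clamp01 ((1/2 - y)/h))"
      using y8 \<gamma> cl by (simp add: \<psi>0_nonneg k_def sqrt8_large algebra_simps)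
    then have "\<bar>\<psi>0 y\<bar> = (lam - 1/2) * clamp01 ((1/2 - y)/h)" using lam by (simp add: abs_mult)
    also have "\<dots> \<le> (lam - 1/2) * 1" using lam by (intro mult_left_mono) auto
    finally show ?thesis using \<gamma> \<tau> by simp
  qed
  have "\<gamma>0 y = M \<and> \<bar>\<tau>0 y\<bar> * M \<le> lam \<and> \<bar>\<psi>0 y\<bar> \<le> lam"
    using nonneg[of y] nonneg[of "- y"] assms
    by (cases "y \<ge> 0") (auto simp: \<gamma>0_minus \<tau>0_minus \<psi>0_minus)
  then show "\<gamma>0 y = M" "\<bar>\<tau>0 y\<bar> * M \<le> lam" "\<bar>\<psi>0 y\<bar> \<le> lam" by auto
qed

text \<open>Supported in the steep zone, where the cone estimate tolerates a bounded change of \<open>\<psi>\<close>; multiples of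
  it adjust the increment of \<open>\<Phi>\<close> over a period.\<close>

definition bump :: "real \<Rightarrow> real" where
  "bump y = 1 - clamp01 ((1/2 - \<bar>y\<bar>)/h)"

lemma bump_zone: "\<bar>y\<bar> \<le> a + d \<Longrightarrow> bump y = 0"
proof -
  assume "\<bar>y\<bar> \<le> a + d"
  then have "1 \<le> (1/2 - \<bar>y\<bar>)/h" using h_pos by (simp add: h_def field_simps)
  then show ?thesis by (simp add: bump_def clamp01_eq)
qed

lemma bump_bounds: "0 \<le> bump y" "bump y \<le> 1"
  by (simp_all add: bump_def)

lemma continuous_parts:
  "continuous_on {-1/2..1/2} \<gamma>0" "continuous_on {-1/2..1/2} \<tau>0"
  "continuous_on {-1/2..1/2} \<psi>0" "continuous_on {-1/2..1/2} bump"
proof -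
  have \<gamma>: "continuous_on S \<gamma>0" for S
    unfolding \<gamma>0_def[abs_def] using \<delta>_bounds d_bounds by (intro continuous_intros) auto
  then show "continuous_on {-1/2..1/2} \<gamma>0" .
  have "lam + (M - 1/2) * clamp01 z \<noteq> 0" for z
  proof -
    have "0 \<le> (M - 1/2) * clamp01 z" using M_ge by simp
    then show ?thesis using lam by linarith
  qed
  then show "continuous_on {-1/2..1/2} \<tau>0"
    unfolding \<tau>0_def[abs_def] using h_pos d_bounds by (intro continuous_intros) auto
  show "continuous_on {-1/2..1/2} bump"
    unfolding bump_def[abs_def] using h_pos by (intro continuous_intros) auto
  have g: "continuous_on S g0" for S
    using g0_deriv by (intro continuous_at_imp_continuous_on ballI DERIV_isCont)
  have "sqrt8 y \<noteq> 0 \<and> sqrt8 (g0 y) \<noteq> 0" if "\<delta> \<le> y" for y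
  proof -
    have "0 < lam\<^sup>2 * \<delta>" using lam \<delta>_bounds by simp
    also have "\<dots> = g0 \<delta>" using \<delta>_bounds by (simp add: near_zero)
    also have "\<dots> \<le> g0 y" by (rule g0_mono[OF that])
    finally show ?thesis using sqrt8_pos[of y] sqrt8_pos[of "g0 y"] that \<delta>_bounds by auto
  qed
  then have k: "continuous_on {\<delta>..} k"
    unfolding k_def[abs_def] using h_pos d_bounds by (intro continuous_intros \<gamma> g) auto
  have "continuous_on {-1/2..1/2} (\<lambda>y. k (max \<delta> y))" "continuous_on {-1/2..1/2} (\<lambda>y. k (max \<delta> (- y)))"
    by (rule continuous_on_compose2[OF k]; auto intro!: continuous_intros)+
  then show "continuous_on {-1/2..1/2} \<psi>0"
    unfolding \<psi>0_def[abs_def] by (rule continuous_on_diff)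
qed

lemma matching_ends:
  "\<gamma>0 (-1/2) = \<gamma>0 (1/2)" "\<tau>0 (-1/2) = \<tau>0 (1/2)" "\<psi>0 (-1/2) = \<psi>0 (1/2)" "bump (-1/2) = bump (1/2)"
proof -
  have "clamp01 0 = 0" by (simp add: clamp01_def)
  then have "\<tau>0 (1/2) = 0" "k (1/2) = 0" by (simp_all add: \<tau>0_def k_def)
  moreover have "\<psi>0 (1/2) = 0" using calculation \<delta>_bounds by (simp add: \<psi>0_nonneg max_absorb2)
  ultimately show "\<gamma>0 (-1/2) = \<gamma>0 (1/2)" "\<tau>0 (-1/2) = \<tau>0 (1/2)" "\<psi>0 (-1/2) = \<psi>0 (1/2)"
      "bump (-1/2) = bump (1/2)"
    using \<gamma>0_minus[of "1/2"] \<tau>0_minus[of "1/2"] \<psi>0_minus[of "1/2"] by (simp_all add: bump_def)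
qed

end

section \<open>Scaling, orientation and period increments\<close>

context circle_model
begin

lemma bump_integral_pos:
  assumes B: "\<And>y. (B has_real_derivative periodise bump y) (at y)"
  shows "B (-1/2) < B (1/2)"
proof -
  have p: "periodise bump y = bump y" if "\<bar>y\<bar> \<le> 1/2" for y
    using that matching_ends by (simp add: periodise_eq)
  have nn: "periodise bump y \<ge> 0" for y
    using bump_bounds by (simp add: periodise_def)
  have "B (-1/2) \<le> B (a + d)"
  proof (rule DERIV_nonneg_imp_nondecreasing[of _ _ B])
    show "-1/2 \<le> a + d" using a_bounds d_bounds by simp
    fix t show "\<exists>D. (B has_real_derivative D) (at t) \<and> 0 \<le> D" using B nn by blast
  qed
  also have "B (a + d) < B (1/2)"
  proof (rule DERIV_pos_imp_increasing_open[of _ _ B])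
    show "a + d < 1/2" by (rule a_bounds)
    show "continuous_on {a + d..1/2} B"
      using B by (intro continuous_at_imp_continuous_on ballI DERIV_isCont)
    fix t assume t: "a + d < t" "t < 1/2"
    have "\<bar>t\<bar> = t" using t a_bounds d_bounds by simp
    moreover have "0 \<le> (1/2 - t)/h" "(1/2 - t)/h < 1" using t h_pos by (auto simp: h_def field_simps)
    ultimately have "bump t > 0" by (simp add: bump_def clamp01_eq)
    then have "periodise bump t > 0" using p[of t] t \<open>\<bar>t\<bar> = t\<close> by simp
    then show "\<exists>D. (B has_real_derivative D) (at t) \<and> 0 < D" using B by blast
  qed
  finally show ?thesis .
qed

lemma unscaled_step:
  assumes G: "\<And>y. \<bar>y\<bar> \<le> 1/2 \<Longrightarrow> G y = g0 y" "\<And>y. G (y + 1) = G y + m" and \<theta>: "\<bar>\<theta>\<bar> \<le> 1"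
    and cone: "\<rho> * \<bar>u\<bar> \<le> \<bar>periodise \<tau>0 y * u - v\<bar>" "periodise \<tau>0 y * u - v \<noteq> 0"
  defines "P \<equiv> periodise \<psi>0 y + \<theta> * periodise bump y"
  shows "\<rho> * \<bar>lam * u + P * v\<bar> < \<bar>periodise \<tau>0 (G y) * (lam * u + P * v) - periodise \<gamma>0 y * v\<bar>"
    and "2 * \<bar>periodise \<tau>0 y * u - v\<bar> \<le>
      \<bar>periodise \<tau>0 (G y) * (lam * u + P * v) - periodise \<gamma>0 y * v\<bar>"
proof -
  define n where "n = round y"
  define x where "x = y - of_int n"
  have y: "y = x + of_int n" by (simp add: x_def)
  have x: "\<bar>x\<bar> \<le> 1/2" using of_int_round_abs_le[of y] by (simp add: x_def n_def abs_minus_commute)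
  have \<tau>: "periodise \<tau>0 y = \<tau>0 x" and \<gamma>: "periodise \<gamma>0 y = \<gamma>0 x"
    and P: "P = \<psi>0 x + \<theta> * bump x"
    unfolding P_def y periodise_shift using x matching_ends by (simp_all add: periodise_eq)
  obtain k where k: "m = of_int k" using m_Int by (elim Ints_cases)
  have "G y = g0 x + of_int (n * k)"
    unfolding y shift_periodic_int[of G m, OF G(2)] using G(1)[OF x] by (simp add: k)
  then have \<tau>': "periodise \<tau>0 (G y) = periodise \<tau>0 (g0 x)" by (simp only: periodise_shift)
  have bound: "\<bar>periodise \<tau>0 z\<bar> \<le> 1" for z using \<tau>0_bound by (simp add: periodise_def)
  have pos: "\<gamma>0 x > 0" using \<gamma>0_pos[of x] by linarith
  have "\<rho> * \<bar>lam * u + P * v\<bar> < \<bar>periodise \<tau>0 (g0 x) * (lam * u + P * v) - \<gamma>0 x * v\<bar> \<and>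
    2 * \<bar>\<tau>0 x * u - v\<bar> \<le> \<bar>periodise \<tau>0 (g0 x) * (lam * u + P * v) - \<gamma>0 x * v\<bar>"
  proof (cases "\<bar>x\<bar> \<le> a + d")
    case True
    have "P = \<psi>0 x" using bump_zone[OF True] by (simp add: P)
    moreover have "periodise \<tau>0 (g0 x) = \<tau>0 (g0 x)"
      using exact_zone(2)[OF True] a_bounds d_bounds matching_ends by (intro periodise_eq) auto
    ultimately show ?thesis
      using exact_slopes_step[OF exact_zone(1)[OF True] lam \<rho>_pos pos] cone unfolding \<tau> by simp
  next
    case False
    then have z: "\<gamma>0 x = M" "\<bar>\<tau>0 x\<bar> * M \<le> lam" "\<bar>\<psi>0 x\<bar> \<le> lam"
      using steep_zone[of x] x by auto
    have "\<bar>\<theta> * bump x\<bar> \<le> 1 * 1"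
      unfolding abs_mult using \<theta> bump_bounds[of x] by (intro mult_mono) auto
    then have "\<bar>P\<bar> \<le> lam + 1" unfolding P using z(3) by linarith
    then show ?thesis
      using steep_step[OF lam \<rho>_pos z(2) \<tau>0_bound bound _ M_bounds(1)] cone
      unfolding \<tau> z(1) by blast
  qed
  then show "\<rho> * \<bar>lam * u + P * v\<bar> < \<bar>periodise \<tau>0 (G y) * (lam * u + P * v) - periodise \<gamma>0 y * v\<bar>"
    and "2 * \<bar>periodise \<tau>0 y * u - v\<bar> \<le>
      \<bar>periodise \<tau>0 (G y) * (lam * u + P * v) - periodise \<gamma>0 y * v\<bar>"
    unfolding \<tau> \<tau>' \<gamma> by auto
qed

text \<open>The slope field and \<open>\<psi>\<close> are rescaled by a factor \<open>\<eta>\<close>, which amounts to a rescaling of the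
  \<open>x\<close> coordinate and leaves the cone estimates intact. Since \<open>\<psi>0\<close> is odd, its integral over a period
  vanishes; the multiple \<open>\<theta>\<close> of the bump contributes the increment \<open>\<eta> c\<close>, and \<open>\<eta>\<close> is chosen so small that
  \<open>\<bar>\<theta>\<bar> \<le> 1\<close>. A negative degree is obtained by changing the sign \<open>\<sigma>\<close> of the circle map, which only
  changes the sign of the form at image points because \<open>\<tau>0\<close> is odd.\<close>

lemma branching_skew_data:
  fixes mu c :: int
  assumes mu: "\<bar>real_of_int mu\<bar> = m"
  obtains \<Phi> g \<psi> \<gamma> \<tau> r \<kappa> where
    "\<And>y. \<Phi> (y + 1) = \<Phi> y + of_int c" "\<And>y. g (y + 1) = g y + of_int mu"
    "\<And>y. (\<Phi> has_real_derivative \<psi> y) (at y)" "\<And>y. (g has_real_derivative \<gamma> y) (at y)"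
    "continuous_on UNIV \<psi>" "continuous_on UNIV \<gamma>" "\<And>y. \<gamma> y \<noteq> 0"
    "\<And>y. \<psi> (y + 1) = \<psi> y" "\<And>y. \<gamma> (y + 1) = \<gamma> y"
    "continuous_on UNIV \<tau>" "\<And>y. \<tau> (y + 1) = \<tau> y" "r > 0"
    "\<And>y u v. r * \<bar>u\<bar> \<le> \<bar>\<tau> y * u - v\<bar> \<Longrightarrow> \<tau> y * u - v \<noteq> 0 \<Longrightarrow>
        r * \<bar>lam * u + \<psi> y * v\<bar> < \<bar>\<tau> (g y) * (lam * u + \<psi> y * v) - \<gamma> y * v\<bar> \<and>
        2 * \<bar>\<tau> y * u - v\<bar> \<le> \<bar>\<tau> (g y) * (lam * u + \<psi> y * v) - \<gamma> y * v\<bar>"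
    "\<kappa> > 0" "\<And>y. \<bar>y\<bar> \<le> 1/8 \<Longrightarrow> \<tau> y = \<kappa> * sqrt y"
    "\<And>y. \<bar>y\<bar> \<le> a + d \<Longrightarrow> \<bar>g y\<bar> \<le> a + d \<and> \<bar>\<tau> y\<bar> \<le> 1 \<and>
        lam * \<tau> (g y) = \<tau> y * (\<gamma> y - \<psi> y * \<tau> (g y)) \<and>
        lam * \<bar>\<gamma> y\<bar> \<le> 3/4 * (\<gamma> y - \<psi> y * \<tau> (g y))\<^sup>2"
proof -
  note cont = continuous_parts[THEN continuous_on_periodise] matching_ends
  have contp: "continuous_on UNIV (periodise \<gamma>0)" "continuous_on UNIV (periodise \<tau>0)"
    "continuous_on UNIV (periodise \<psi>0)" "continuous_on UNIV (periodise bump)"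
    using cont by auto
  have per1: "periodise h (y + 1) = periodise h y" for h y
    using periodise_shift[of h y 1] by simp
  have eq: "\<bar>y\<bar> \<le> 1/2 \<Longrightarrow> periodise \<gamma>0 y = \<gamma>0 y" "\<bar>y\<bar> \<le> 1/2 \<Longrightarrow> periodise \<tau>0 y = \<tau>0 y"
    "\<bar>y\<bar> \<le> 1/2 \<Longrightarrow> periodise \<psi>0 y = \<psi>0 y" "\<bar>y\<bar> \<le> 1/2 \<Longrightarrow> periodise bump y = bump y" for y
    using matching_ends by (simp_all add: periodise_eq)
  obtain G where G: "\<And>y. (G has_real_derivative periodise \<gamma>0 y) (at y)" "G 0 = 0"
      "\<And>y. G (y + 1) = G y + (G (1/2) - G (-1/2))"
    using antiderivative_periodic[OF contp(1) per1] by metis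
  have G_eq: "G y = g0 y" if "\<bar>y\<bar> \<le> 1/2" for y
    by (rule antiderivative_eq[OF G(1) g0_deriv _ _ _ that]) (use G(2) g0_minus[of 0] eq(1) in auto)
  have G_shift: "G (y + 1) = G y + m" for y
    using G(3)[of y] g0_minus[of "1/2"] by (simp add: G_eq g0_half)
  obtain \<Psi> where \<Psi>: "\<And>y. (\<Psi> has_real_derivative periodise \<psi>0 y) (at y)"
      "\<And>y. \<Psi> (y + 1) = \<Psi> y + (\<Psi> (1/2) - \<Psi> (-1/2))"
    using antiderivative_periodic[OF contp(3) per1] by metis
  have \<Psi>_shift: "\<Psi> (y + 1) = \<Psi> y" for y
  proof -
    have "((\<lambda>y. \<Psi> (- y)) has_real_derivative - periodise \<psi>0 (- y)) (at y)" for y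
      using \<Psi>(1)[of "- y"] by (simp add: DERIV_mirror)
    moreover have "- periodise \<psi>0 (- y) = periodise \<psi>0 y" for y
      using periodise_odd[OF \<psi>0_minus matching_ends(3)] by simp
    ultimately have d: "((\<lambda>y. \<Psi> (- y)) has_real_derivative periodise \<psi>0 y) (at y)" for y
      by simp
    have "\<Psi> (1/2) = \<Psi> (- (1/2))"
      by (rule antiderivative_eq[OF \<Psi>(1) d, where b = "1/2"]) auto
    then show ?thesis using \<Psi>(2)[of y] by simp
  qed
  obtain B where B: "\<And>y. (B has_real_derivative periodise bump y) (at y)"
      "\<And>y. B (y + 1) = B y + (B (1/2) - B (-1/2))"
    using antiderivative_periodic[OF contp(4) per1] by metis
  define I where "I = B (1/2) - B (-1/2)"
  have I: "I > 0" using bump_integral_pos[of B, OF B(1)] by (simp add: I_def)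
  define \<eta> where "\<eta> = I / (I + \<bar>real_of_int c\<bar>)"
  have \<eta>: "0 < \<eta>" "\<eta> \<le> 1" using I by (simp_all add: \<eta>_def divide_le_eq)
  define \<theta> where "\<theta> = \<eta> * of_int c / I"
  have \<theta>: "\<bar>\<theta>\<bar> \<le> 1" "\<theta> * I = \<eta> * of_int c"
    using I by (simp_all add: \<theta>_def \<eta>_def abs_mult divide_le_eq)
  define \<sigma> where "\<sigma> = (sgn (real_of_int mu))"
  have "real_of_int mu \<noteq> 0" using mu m by auto
  then have \<sigma>: "\<sigma> = 1 \<or> \<sigma> = -1" "\<sigma> * m = of_int mu"
    using mu by (auto simp: \<sigma>_def sgn_if)
  define P where "P y = periodise \<psi>0 y + \<theta> * periodise bump y" for y
  define \<Phi> where "\<Phi> y = (\<Psi> y + \<theta> * B y) / \<eta>" for y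
  define \<tau> where "\<tau> y = \<eta> * periodise \<tau>0 y" for y
  have \<tau>_G: "\<tau> (\<sigma> * G y) = \<eta> * \<sigma> * periodise \<tau>0 (G y)" for y
    using \<sigma>(1) periodise_odd[of \<tau>0 "G y"] \<tau>0_minus matching_ends(2) by (auto simp: \<tau>_def)
  show ?thesis
  proof (rule that[of \<Phi> "\<lambda>y. \<sigma> * G y" "\<lambda>y. P y / \<eta>" "\<lambda>y. \<sigma> * periodise \<gamma>0 y" \<tau> "\<eta> * \<rho>" "\<eta> * sqrt 8"])
    show "\<Phi> (y + 1) = \<Phi> y + of_int c" for y
    proof -
      have "B (y + 1) = B y + I" unfolding I_def by (rule B(2))
      then have "\<Phi> (y + 1) = (\<Psi> y + \<theta> * B y + \<theta> * I) / \<eta>"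
        unfolding \<Phi>_def \<Psi>_shift by (simp add: distrib_left)
      then show ?thesis using \<eta> by (simp add: \<Phi>_def \<theta>(2) add_divide_distrib)
    qed
    show "\<sigma> * G (y + 1) = \<sigma> * G y + of_int mu" for y
      by (simp only: G_shift distrib_left \<sigma>(2))
    show "(\<Phi> has_real_derivative P y / \<eta>) (at y)" for y
      unfolding \<Phi>_def[abs_def] P_def by (intro DERIV_cdivide DERIV_add DERIV_cmult \<Psi>(1) B(1))
    show "((\<lambda>y. \<sigma> * G y) has_real_derivative \<sigma> * periodise \<gamma>0 y) (at y)" for y
      by (intro DERIV_cmult G(1))
    show "continuous_on UNIV (\<lambda>y. P y / \<eta>)"
      unfolding P_def using \<eta> by (intro continuous_intros contp) auto
    show "continuous_on UNIV (\<lambda>y. \<sigma> * periodise \<gamma>0 y)" by (intro continuous_intros contp)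
    show "\<sigma> * periodise \<gamma>0 y \<noteq> 0" for y
      using \<sigma>(1) \<gamma>0_pos[of "y - of_int (round y)"] by (auto simp: periodise_def)
    show "P (y + 1) / \<eta> = P y / \<eta>" "\<sigma> * periodise \<gamma>0 (y + 1) = \<sigma> * periodise \<gamma>0 y"
      "\<tau> (y + 1) = \<tau> y" for y
      by (simp_all add: P_def \<tau>_def per1)
    show "continuous_on UNIV \<tau>" unfolding \<tau>_def[abs_def] by (intro continuous_intros contp)
    show "\<eta> * \<rho> > 0" "\<eta> * sqrt 8 > 0" using \<eta> \<rho>_pos by auto
    show "\<tau> y = \<eta> * sqrt 8 * sqrt y" if "\<bar>y\<bar> \<le> 1/8" for y
    proof -
      have "\<tau>0 y = sqrt8 y"
        using \<tau>0_plateau[of y] \<tau>0_plateau[of "- y"] that a_bounds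
        by (cases "y \<ge> 0") (auto simp: \<tau>0_minus sqrt8_minus)
      then show ?thesis using eq(2)[of y] that by (simp add: \<tau>_def sqrt8_small real_sqrt_mult)
    qed
    show "\<eta> * \<rho> * \<bar>lam * u + P y / \<eta> * v\<bar> <
          \<bar>\<tau> (\<sigma> * G y) * (lam * u + P y / \<eta> * v) - \<sigma> * periodise \<gamma>0 y * v\<bar> \<and>
        2 * \<bar>\<tau> y * u - v\<bar> \<le>
          \<bar>\<tau> (\<sigma> * G y) * (lam * u + P y / \<eta> * v) - \<sigma> * periodise \<gamma>0 y * v\<bar>"
      if cone: "\<eta> * \<rho> * \<bar>u\<bar> \<le> \<bar>\<tau> y * u - v\<bar>" "\<tau> y * u - v \<noteq> 0" for y u v
    proof -
      define u' where "u' = \<eta> * u"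
      have 1: "\<tau> y * u - v = periodise \<tau>0 y * u' - v" by (simp add: \<tau>_def u'_def)
      have 2: "\<eta> * \<rho> * \<bar>u\<bar> = \<rho> * \<bar>u'\<bar>" using \<eta> by (simp add: u'_def abs_mult)
      have 3: "lam * u + P y / \<eta> * v = (lam * u' + P y * v) / \<eta>" using \<eta> by (simp add: u'_def field_simps)
      have "\<tau> (\<sigma> * G y) * (lam * u + P y / \<eta> * v) - \<sigma> * periodise \<gamma>0 y * v =
          \<sigma> * (periodise \<tau>0 (G y) * (lam * u' + P y * v) - periodise \<gamma>0 y * v)"
      proof -
        have "\<eta> * \<sigma> * t * (x / \<eta>) = \<sigma> * (t * x)" for t x using \<eta> by simp
        then show ?thesis unfolding 3 \<tau>_G by (simp only: right_diff_distrib mult.assoc)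
      qed
      then have 4: "\<bar>\<tau> (\<sigma> * G y) * (lam * u + P y / \<eta> * v) - \<sigma> * periodise \<gamma>0 y * v\<bar> =
          \<bar>periodise \<tau>0 (G y) * (lam * u' + P y * v) - periodise \<gamma>0 y * v\<bar>"
        using \<sigma>(1) by (auto simp: abs_mult)
      have 5: "\<eta> * \<rho> * \<bar>lam * u + P y / \<eta> * v\<bar> = \<rho> * \<bar>lam * u' + P y * v\<bar>"
        unfolding 3 using \<eta> by (simp add: abs_mult)
      show ?thesis
        unfolding 4 5 unfolding 1
        using unscaled_step[OF G_eq G_shift \<theta>(1) cone[unfolded 1 2], folded P_def] by blast
    qed
    fix y assume y: "\<bar>y\<bar> \<le> a + d"
    have y2: "\<bar>y\<bar> \<le> 1/2" using y a_bounds by linarith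
    note z = exact_zone[OF y]
    have "\<bar>g0 y\<bar> \<le> 1/2" using z(2) a_bounds d_bounds by linarith
    then have T': "periodise \<tau>0 (G y) = \<tau>0 (g0 y)" by (simp add: G_eq[OF y2] eq(2))
    have P: "P y = \<psi>0 y" by (simp add: P_def eq[OF y2] bump_zone[OF y])
    define \<Lambda> where "\<Lambda> = \<gamma>0 y - \<psi>0 y * \<tau>0 (g0 y)"
    have ex: "lam * \<tau>0 (g0 y) = \<tau>0 y * \<Lambda>" "lam * \<gamma>0 y \<le> 3/4 * \<Lambda>\<^sup>2"
      using z(1) by (auto simp: exact_slopes_def \<Lambda>_def)
    have \<Lambda>: "\<sigma> * periodise \<gamma>0 y - P y / \<eta> * \<tau> (\<sigma> * G y) = \<sigma> * \<Lambda>"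
      unfolding \<tau>_G T' P eq(1)[OF y2] using \<eta> by (simp add: \<Lambda>_def algebra_simps)
    have "\<bar>\<sigma> * G y\<bar> \<le> a + d"
      using \<sigma>(1) z(2) d_bounds by (auto simp: G_eq[OF y2])
    moreover have "\<bar>\<tau> y\<bar> \<le> 1 * 1"
      unfolding \<tau>_def abs_mult eq(2)[OF y2] using \<eta> \<tau>0_bound[of y] by (intro mult_mono) auto
    moreover have "lam * \<tau> (\<sigma> * G y) = \<tau> y * (\<sigma> * \<Lambda>)"
    proof -
      have "lam * \<tau> (\<sigma> * G y) = \<eta> * \<sigma> * (lam * \<tau>0 (g0 y))" by (simp add: \<tau>_G T')
      also have "\<dots> = \<tau> y * (\<sigma> * \<Lambda>)" unfolding ex(1) by (simp add: \<tau>_def eq(2)[OF y2])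
      finally show ?thesis .
    qed
    moreover have "lam * \<bar>\<sigma> * periodise \<gamma>0 y\<bar> \<le> 3/4 * (\<sigma> * \<Lambda>)\<^sup>2"
      using ex(2) \<sigma>(1) \<gamma>0_pos[of y] by (auto simp: eq(1)[OF y2] abs_mult power_mult_distrib)
    ultimately show "\<bar>\<sigma> * G y\<bar> \<le> a + d \<and> \<bar>\<tau> y\<bar> \<le> 1 \<and>
        lam * \<tau> (\<sigma> * G y) = \<tau> y * (\<sigma> * periodise \<gamma>0 y - P y / \<eta> * \<tau> (\<sigma> * G y)) \<and>
        lam * \<bar>\<sigma> * periodise \<gamma>0 y\<bar> \<le> 3/4 * (\<sigma> * periodise \<gamma>0 y - P y / \<eta> * \<tau> (\<sigma> * G y))\<^sup>2"
      unfolding \<Lambda> by simp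
  qed
qed

end

section \<open>Eigenvectors of the linear map\<close>

lemma complex_eigenvalue_of_real:
  fixes A :: "int^2^2" and l :: real
  assumes "is_eigenvalue (map_matrix of_int A) l"
  shows "is_eigenvalue (map_matrix of_int A) (complex_of_real l)"
proof -
  obtain x where x: "x \<noteq> 0" "map_matrix real_of_int A *v x = l *s x"
    using assms by (auto simp: is_eigenvalue_def)
  define X where "X = (\<chi> i. complex_of_real (x $ i))"
  have "(map_matrix of_int A *v X) $ i = complex_of_real ((map_matrix real_of_int A *v x) $ i)" for i
    by (simp add: matrix_vector_mult_def X_def map_matrix_def)
  then have "map_matrix of_int A *v X = complex_of_real l *s X"
    by (simp add: vec_eq_iff x(2) X_def)
  moreover have "X \<noteq> 0" using x(1) by (auto simp: X_def vec_eq_iff)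
  ultimately show ?thesis by (auto simp: is_eigenvalue_def)
qed

lemma singular_int_kernel:
  fixes p q r s :: int
  assumes "p * s = q * r"
  obtains a b where "a \<noteq> 0 \<or> b \<noteq> 0" "p * a + q * b = 0" "r * a + s * b = 0"
proof (cases "p = 0 \<and> q = 0")
  case False
  then show ?thesis using that[of "- q" p] assms by (auto simp: algebra_simps)
next
  case True
  show ?thesis
  proof (cases "r = 0 \<and> s = 0")
    case False
    then show ?thesis using that[of s "- r"] True by (auto simp: algebra_simps)
  next
    case True': True
    then show ?thesis using that[of 1 0] True by simp
  qed
qed

text \<open>An integral kernel vector of \<open>A - lam\<close>, divided by the greatest common divisor of its entries, is
  completed to a basis by a Bezout identity. Comparing determinants gives \<open>det A = lam mu\<close>, so \<open>mu\<close> is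
  not zero.\<close>

lemma triangular_basis:
  fixes A :: "int^2^2"
  assumes det: "det A \<noteq> 0"
    and ints: "\<forall>l::complex. is_eigenvalue (map_matrix of_int A) l \<longrightarrow> l \<in> \<int>"
    and ev: "\<exists>l::real. is_eigenvalue (map_matrix of_int A) l \<and> l > 1"
  obtains v w :: "int^2" and lam c mu :: int where
    "v $ 1 * w $ 2 - v $ 2 * w $ 1 = 1" "lam \<ge> 2" "mu \<noteq> 0"
    "\<And>i. A $ i $ 1 * v $ 1 + A $ i $ 2 * v $ 2 = lam * v $ i"
    "\<And>i. A $ i $ 1 * w $ 1 + A $ i $ 2 * w $ 2 = c * v $ i + mu * w $ i"
proof -
  obtain l :: real where l: "is_eigenvalue (map_matrix of_int A) l" "l > 1" using ev by blast
  have "complex_of_real l \<in> \<int>" using ints complex_eigenvalue_of_real[OF l(1)] by blast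
  then obtain lam where "complex_of_real l = of_int lam" by (elim Ints_cases)
  then have lam: "l = of_int lam" by (metis of_real_eq_iff of_real_of_int_eq)
  have lam2: "lam \<ge> 2" using l(2) by (simp add: lam)
  obtain x where x: "x \<noteq> 0" "map_matrix real_of_int A *v x = l *s x"
    using l(1) by (auto simp: is_eigenvalue_def)
  define p q r s where "p = A $ 1 $ 1 - lam" and "q = A $ 1 $ 2" and "r = A $ 2 $ 1" and "s = A $ 2 $ 2 - lam"
  have "(map_matrix real_of_int A *v x) $ i = l * x $ i" for i by (simp add: x(2))
  then have eqs: "of_int p * x $ 1 + of_int q * x $ 2 = 0" "of_int r * x $ 1 + of_int s * x $ 2 = 0"
    by (simp_all add: matrix_vector_mult_def sum_2 lam p_def q_def r_def s_def map_matrix_def algebra_simps)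
  have "(of_int p * of_int s - of_int q * of_int r) * x $ 1 = 0"
    "(of_int p * of_int s - of_int q * of_int r) * x $ 2 = 0"
    using eqs by algebra+
  moreover have "x $ 1 \<noteq> 0 \<or> x $ 2 \<noteq> 0" using x(1) by (auto simp: vec_eq_iff forall_2)
  ultimately have "real_of_int (p * s) = real_of_int (q * r)" by auto
  then have "p * s = q * r" by (simp only: of_int_eq_iff)
  then obtain a b where ab: "a \<noteq> 0 \<or> b \<noteq> 0" "p * a + q * b = 0" "r * a + s * b = 0"
    by (rule singular_int_kernel)
  define h where "h = gcd a b"
  have h: "h \<noteq> 0" using ab(1) by (simp add: h_def)
  have "\<exists>a' b'. a = a' * h \<and> b = b' * h \<and> coprime a' b'"
    using h unfolding h_def by (rule gcd_coprime_exists)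
  then obtain a' b' where a': "a = a' * h" "b = b' * h" "coprime a' b'" by (elim exE conjE)
  have "\<exists>u t. u * a' + t * b' = gcd a' b'" by (rule bezout_int)
  then obtain u t where ut: "u * a' + t * b' = 1" using a'(3) by (elim exE) simp
  define v w :: "int^2" where "v = (\<chi> i. if i = 1 then a' else b')" and "w = (\<chi> i. if i = 1 then - t else u)"
  have v: "v $ 1 = a'" "v $ 2 = b'" and w: "w $ 1 = - t" "w $ 2 = u" by (simp_all add: v_def w_def)
  have uni: "v $ 1 * w $ 2 - v $ 2 * w $ 1 = 1" using ut by (simp add: v w algebra_simps)
  have "(p * a' + q * b') * h = 0" "(r * a' + s * b') * h = 0"
    using ab(2,3) by (simp_all add: a' algebra_simps)
  then have "p * a' + q * b' = 0" "r * a' + s * b' = 0" using h by auto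
  then have Av: "A $ 1 $ 1 * v $ 1 + A $ 1 $ 2 * v $ 2 = lam * v $ 1"
    "A $ 2 $ 1 * v $ 1 + A $ 2 $ 2 * v $ 2 = lam * v $ 2"
    by (simp_all add: v p_def q_def r_def s_def algebra_simps)
  define y1 y2 where "y1 = A $ 1 $ 1 * w $ 1 + A $ 1 $ 2 * w $ 2" and "y2 = A $ 2 $ 1 * w $ 1 + A $ 2 $ 2 * w $ 2"
  define c mu where "c = y1 * w $ 2 - y2 * w $ 1" and "mu = v $ 1 * y2 - v $ 2 * y1"
  have "det A * (v $ 1 * w $ 2 - v $ 2 * w $ 1) = lam * mu"
    using Av unfolding det_2 mu_def y1_def y2_def by algebra
  then have mu: "mu \<noteq> 0" using det uni by auto
  have "y1 = c * v $ 1 + mu * w $ 1" "y2 = c * v $ 2 + mu * w $ 2"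
    using uni unfolding c_def mu_def by algebra+
  then have Aw: "A $ i $ 1 * w $ 1 + A $ i $ 2 * w $ 2 = c * v $ i + mu * w $ i" for i
    using exhaust_2[of i] by (auto simp: y1_def y2_def)
  show ?thesis
  proof (rule that[OF uni lam2 mu])
    show "A $ i $ 1 * v $ 1 + A $ i $ 2 * v $ 2 = lam * v $ i" for i
      using Av exhaust_2[of i] by auto
  qed (rule Aw)
qed

theorem theorem2:
  fixes A :: "int^2^2"
  assumes "det A \<noteq> 0"
    and "\<forall>l::complex. is_eigenvalue (map_matrix of_int A) l \<longrightarrow> l \<in> \<int>"
    and "\<exists>l::real. is_eigenvalue (map_matrix of_int A) l \<and> l > 1"
  shows "\<exists>f. partially_hyperbolic f \<and>
             homotopic_with_canon (\<lambda>_. True) UNIV UNIV f (linear_torus_map A) \<and>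
             dynamically_incoherent f"
proof -
  obtain v w :: "int^2" and lam c mu :: int where
    uni: "v $ 1 * w $ 2 - v $ 2 * w $ 1 = 1" and lam: "lam \<ge> 2" and mu: "mu \<noteq> 0"
    and Av: "\<And>i. A $ i $ 1 * v $ 1 + A $ i $ 2 * v $ 2 = lam * v $ i"
    and Aw: "\<And>i. A $ i $ 1 * w $ 1 + A $ i $ 2 * w $ 2 = c * v $ i + mu * w $ i"
    using triangular_basis[OF assms] by metis
  define m where "m = \<bar>real_of_int mu\<bar>"
  interpret circle_model "real_of_int lam" m
  proof
    show "real_of_int lam \<ge> 2" using lam by simp
    show "m \<ge> 1" using mu by (simp add: m_def)
    show "m \<in> \<int>" unfolding m_def by (simp flip: of_int_abs)
  qed
  show ?thesis
  proof (rule branching_skew_data[of mu c, OF m_def[symmetric]])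
    fix \<Phi> g \<psi> \<gamma> \<tau> r \<kappa>
    assume skew: "\<And>y. \<Phi> (y + 1) = \<Phi> y + of_int c" "\<And>y. g (y + 1) = g y + of_int mu"
        "\<And>y. (\<Phi> has_real_derivative \<psi> y) (at y)" "\<And>y. (g has_real_derivative \<gamma> y) (at y)"
        "continuous_on UNIV \<psi>" "continuous_on UNIV \<gamma>" "\<And>y. \<gamma> y \<noteq> 0"
        "\<And>y. \<psi> (y + 1) = \<psi> y" "\<And>y. \<gamma> (y + 1) = \<gamma> y"
      and cone: "continuous_on UNIV \<tau>" "\<And>y. \<tau> (y + 1) = \<tau> y" "r > 0"
        "\<And>y s t. r * \<bar>s\<bar> \<le> \<bar>\<tau> y * s - t\<bar> \<Longrightarrow> \<tau> y * s - t \<noteq> 0 \<Longrightarrow>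
          r * \<bar>of_int lam * s + \<psi> y * t\<bar> < \<bar>\<tau> (g y) * (of_int lam * s + \<psi> y * t) - \<gamma> y * t\<bar> \<and>
          2 * \<bar>\<tau> y * s - t\<bar> \<le> \<bar>\<tau> (g y) * (of_int lam * s + \<psi> y * t) - \<gamma> y * t\<bar>"
      and \<kappa>: "\<kappa> > 0" "\<And>y. \<bar>y\<bar> \<le> 1/8 \<Longrightarrow> \<tau> y = \<kappa> * sqrt y"
      and zone: "\<And>y. \<bar>y\<bar> \<le> a + d \<Longrightarrow> \<bar>g y\<bar> \<le> a + d \<and> \<bar>\<tau> y\<bar> \<le> 1 \<and>
          of_int lam * \<tau> (g y) = \<tau> y * (\<gamma> y - \<psi> y * \<tau> (g y)) \<and>
          of_int lam * \<bar>\<gamma> y\<bar> \<le> 3/4 * (\<gamma> y - \<psi> y * \<tau> (g y))\<^sup>2"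
    interpret S: skew_cone v w "real_of_int lam" c mu \<Phi> g \<psi> \<gamma> \<tau> r 2
      by unfold_locales (use uni lam skew cone in simp_all)
    have "map_matrix real_of_int A *v S.pt x y = S.pt (of_int lam * x + of_int c * y) (of_int mu * y)" for x y
    proof -
      have "(map_matrix real_of_int A *v S.pt x y) $ i =
          x * of_int (A $ i $ 1 * v $ 1 + A $ i $ 2 * v $ 2) + y * of_int (A $ i $ 1 * w $ 1 + A $ i $ 2 * w $ 2)" for i
        by (simp add: matrix_vector_mult_def sum_2 map_matrix_def S.pt_def algebra_simps)
      then show ?thesis by (simp only: Av Aw vec_eq_iff) (simp add: S.pt_def algebra_simps)
    qed
    then have "homotopic_with_canon (\<lambda>_. True) UNIV UNIV S.f (linear_torus_map A)"
      by (rule S.homotopic_f)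
    moreover have "dynamically_incoherent S.f"
    proof
      assume "dynamically_coherent S.f"
      then obtain E F where E: "centre_direction S.f E" and F: "foliation F" "tangent_to F E"
        by (auto simp: dynamically_coherent_def invariant_foliation_def)
      show False
      proof (rule S.no_foliation_tangent_to_branching[OF F \<kappa>(1)])
        show "S.yc h = \<kappa> * sqrt (S.yc z) * S.xc h" if z: "\<bar>S.yc z\<bar> < 1/8" and h: "h \<in> E (proj z)" for z h
        proof -
          have "S.yc h = \<tau> (S.yc z) * S.xc h"
          proof (rule S.centre_in_invariant_slopes[OF E, where Z = "{y. \<bar>y\<bar> \<le> a + d}"])
            show "S.yc z \<in> {y. \<bar>y\<bar> \<le> a + d}" using z a_bounds d_bounds by simp
          qed (use zone h in auto)
          then show ?thesis using \<kappa>(2)[of "S.yc z"] z by simp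
        qed
      qed simp
    qed
    ultimately show ?thesis using S.partially_hyperbolic_f by blast
  qed
qed

end
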